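(* Let $\mathcal{M}$ and $\mathcal{N}$ be species of non-trivial 01-networks. Then $$W^+_{\mathcal{M}\cdot_s\mathcal{N}}(\mathbf{a};\mathbf{b};\mathbf{c})=a_1W^+_{\mathcal{M}}(\mathbf{a};\mathbf{b};\mathbf{c})\,W^+_{\mathcal{N}}(\mathbf{a};\mathbf{b};\mathbf{c}),$$ $$W^-_{\mathcal{M}\cdot_s\mathcal{M}}(\mathbf{a};\mathbf{b};\mathbf{c})=a_1W^+_{\mathcal{M},2}(\mathbf{a};\mathbf{b};\mathbf{c}),$$ $$W^-_{\mathcal{M}\cdot_s\mathcal{N}\cdot_s\mathcal{M}}(\mathbf{a};\mathbf{b};\mathbf{c})=a_2W^+_{\mathcal{M},2}(\mathbf{a};\mathbf{b};\mathbf{c})\,W^-_{\mathcal{N}}(\mathbf{a};\mathbf{b};\mathbf{c}).$$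
   Context: All graphs are finite and simple. A 01-network is a connected graph $N$ with two distinguished vertices $0,1$ (poles) such that $N\cup01$ ($N$ with edge $01$ added if absent) is 2-connected; its underlying set $U$ is its set of internal vertices; it is trivial if it has no edges and no internal vertices. Isomorphisms and automorphisms of networks preserve the poles. $\tau$ exchanges the poles; $N$ is $\tau$-symmetric if $\tau\cdot N\cong N$. Series composition: for disjoint non-trivial networks $M,N$, $M\cdot_sN$ is obtained from their union by identifying pole $1$ of $M$ with pole $0$ of $N$, the connecting vertex being an extra (new) internal vertex; $\mathcal{M}\cdot_s\mathcal{N}$ is the species of all such compositions with $M\in\mathcal{M}$, $N\in\mathcal{N}$ (and $\mathcal{M}\cdot_s\mathcal{N}\cdot_s\mathcal{M}$ is defined by iterating). Edge index series: variables $\mathbf{a}=(a_1,a_2,\dots)$, $\mathbf{b}=(b_1,b_2,\dots)$, $\mathbf{c}=(c_1,c_2,\dots)$. For a graph $G$ and automorphism $\sigma$ of $G$, $\sigma$ permutes the edges; an edge cycle of length $l$ is cylindrical if $\sigma^l$ fixes both endpoints of each of its edges and Möbius if $\sigma^l$ exchanges them. The weight is $w(G,\sigma)=\prod_k a_k^{\sigma_k}b_k^{\mathrm{cyl}_k}c_k^{\mathrm{m\ddot{o}b}_k}$, where $\sigma_k$ is the number of $k$-cycles of $\sigma$ on vertices and $\mathrm{cyl}_k$, $\mathrm{m\ddot{o}b}_k$ the numbers of cylindrical and Möbius edge cycles of length $k$. For a network $N$ with internal vertex set $U$ and graph $\hat N$ on $U\cup\{0,1\}$, let $\mathrm{Aut}^+(N)$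 (resp. $\mathrm{Aut}^-(N)$) be the set of permutations $\sigma$ of $U$ such that $\sigma^+=(0)(1)\sigma$ (resp. $\sigma^-=(0\,1)\sigma$) is an automorphism of $\hat N$; set $w(N,\sigma)=w(\hat N,\sigma^+)/a_1^2$ for $\sigma\in\mathrm{Aut}^+(N)$ and $w(N,\sigma)=w(\hat N,\sigma^-)/a_2$ for $\sigma\in\mathrm{Aut}^-(N)$. For a species $\mathcal{N}$ of networks, $W^+_{\mathcal{N}}=\sum_N\frac{1}{|\mathrm{Aut}^+(N)|}\sum_{\sigma\in\mathrm{Aut}^+(N)}w(N,\sigma)$ summed over representatives of isomorphism classes of $\mathcal{N}$, and $W^-_{\mathcal{N}}=\sum_N\frac{1}{|\mathrm{Aut}^-(N)|}\sum_{\sigma\in\mathrm{Aut}^-(N)}w(N,\sigma)$ summed over representatives of isomorphism classes of $\tau$-symmetric networks of $\mathcal{N}$. Plethystic notation: for a series $f(\mathbf{a};\mathbf{b};\mathbf{c})$ and $k\ge1$, $f_k=f(a_k,a_{2k},\dots;b_k,b_{2k},\dots;c_k,c_{2k},\dots)$; e.g. $W^+_{\mathcal{M},2}=(W^+_{\mathcal{M}})_2$.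
   Formalization: The second and third identities are proved for 𝓜 closed under τ (they fail, e.g., for the class of one network K with τ·K not isomorphic to K), and a composition is taken together with its connecting vertices, which isomorphisms and automorphisms must respect. *)

theory Defs
  imports Complex_Main "HOL-Library.Multiset" "HOL-Combinatorics.Permutations"
    "HOL-Combinatorics.Orbits"
begin

text \<open>
  Formal power series in the variables \<open>a\<^sub>k, b\<^sub>k, c\<^sub>k\<close>.  A monomial is the multiset of its
  variables (product of monomials = sum of multisets), and a series is its coefficient function.
\<close>

datatype var = VA nat | VB nat | VC nat

type_synonym monomial = "var multiset"
type_synonym series = "monomial \<Rightarrow> rat"

definition monom_ser :: "monomial \<Rightarrow> series" where
  "monom_ser p = (\<lambda>m. if m = p then 1 else 0)"

abbreviation avar :: "nat \<Rightarrow> series" where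
  "avar k \<equiv> monom_ser {#VA k#}"

definition ser_mult :: "series \<Rightarrow> series \<Rightarrow> series" (infixl "\<otimes>" 70) where
  "f \<otimes> g = (\<lambda>m. \<Sum>(p, q) | p + q = m. f p * g q)"

text \<open>Coefficientwise sum of a family in which every monomial occurs in finitely many members.\<close>

definition ser_sum :: "('i \<Rightarrow> series) \<Rightarrow> 'i set \<Rightarrow> series" where
  "ser_sum f I = (\<lambda>m. \<Sum>i | i \<in> I \<and> f i m \<noteq> 0. f i m)"

text \<open>The substitution \<open>f\<^sub>k\<close>: every index \<open>i\<close> is replaced by \<open>k * i\<close>.  For \<open>k \<ge> 1\<close> this is injective
  on monomials, so the sum below has at most one term.\<close>

fun scale_var :: "nat \<Rightarrow> var \<Rightarrow> var" where
  "scale_var k (VA i) = VA (k * i)"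
| "scale_var k (VB i) = VB (k * i)"
| "scale_var k (VC i) = VC (k * i)"

definition pleth :: "nat \<Rightarrow> series \<Rightarrow> series" where
  "pleth k f = (\<lambda>m. \<Sum>p | image_mset (scale_var k) p = m. f p)"


text \<open>Graphs are given by a vertex set and a set of two-element edges.\<close>

definition gconnected :: "'v set \<Rightarrow> 'v set set \<Rightarrow> bool" where
  "gconnected V E \<longleftrightarrow> V \<noteq> {} \<and>
     (\<forall>x\<in>V. \<forall>y\<in>V. (x, y) \<in> {(u, w). u \<in> V \<and> w \<in> V \<and> {u, w} \<in> E}\<^sup>*)"

text \<open>Connected without cut vertex, on at least two vertices; \<open>K\<^sub>2\<close> counts as 2-connected, so that
  a single edge between the poles is a network.\<close>

definition two_connected :: "'v set \<Rightarrow> 'v set set \<Rightarrow> bool" where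
  "two_connected V E \<longleftrightarrow> card V \<ge> 2 \<and> gconnected V E \<and> (\<forall>x\<in>V. gconnected (V - {x}) E)"

definition graph_aut :: "'v set \<Rightarrow> 'v set set \<Rightarrow> ('v \<Rightarrow> 'v) \<Rightarrow> bool" where
  "graph_aut V E s \<longleftrightarrow> bij_betw s V V \<and> (`) s ` E = E"

definition vertex_cycles :: "'v set \<Rightarrow> ('v \<Rightarrow> 'v) \<Rightarrow> 'v set set" where
  "vertex_cycles V s = orbit s ` V"

definition edge_cycles :: "'v set set \<Rightarrow> ('v \<Rightarrow> 'v) \<Rightarrow> 'v set set set" where
  "edge_cycles E s = orbit ((`) s) ` E"

definition cylindrical :: "('v \<Rightarrow> 'v) \<Rightarrow> 'v set set \<Rightarrow> bool" where
  "cylindrical s c \<longleftrightarrow> (\<forall>e\<in>c. \<forall>x\<in>e. (s ^^ card c) x = x)"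

definition moebius :: "('v \<Rightarrow> 'v) \<Rightarrow> 'v set set \<Rightarrow> bool" where
  "moebius s c \<longleftrightarrow> (\<forall>e\<in>c. \<exists>x y. x \<noteq> y \<and> e = {x, y} \<and>
     (s ^^ card c) x = y \<and> (s ^^ card c) y = x)"

text \<open>Each cycle contributes one variable indexed by its length, so the exponent of \<open>a\<^sub>k\<close> is the
  number of vertex cycles of length \<open>k\<close>, and similarly for \<open>b\<^sub>k\<close> and \<open>c\<^sub>k\<close>.\<close>

definition graph_weight :: "'v set \<Rightarrow> 'v set set \<Rightarrow> ('v \<Rightarrow> 'v) \<Rightarrow> monomial" where
  "graph_weight V E s =
     image_mset (\<lambda>c. VA (card c)) (mset_set (vertex_cycles V s)) +
     image_mset (\<lambda>c. VB (card c)) (mset_set {c \<in> edge_cycles E s. cylindrical s c}) +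
     image_mset (\<lambda>c. VC (card c)) (mset_set {c \<in> edge_cycles E s. moebius s c})"


text \<open>
  Networks have internal vertices labelled by natural numbers.  The field \<open>joints\<close> is empty for an
  ordinary network.  In a series composition it holds the connecting vertices, so that a structure
  of the composite species is a composition and not merely its underlying graph: one graph may
  arise from several choices of the connecting vertices, and these are different structures.
  The joints lie in a row between the poles, so recording them as a set loses nothing.
\<close>

datatype 'a vert = Pole0 | Pole1 | Inner 'a

record network =
  inner :: "nat set"
  edges :: "nat vert set set"
  joints :: "nat set"

definition verts :: "network \<Rightarrow> nat vert set" where
  "verts N = {Pole0, Pole1} \<union> Inner ` inner N"

definition is_network :: "network \<Rightarrow> bool" where
  "is_network N \<longleftrightarrow>
     finite (inner N) \<and>
     edges N \<subseteq> {{x, y} | x y. x \<in> verts N \<and> y \<in> verts N \<and> x \<noteq> y} \<and>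
     joints N \<subseteq> inner N \<and>
     gconnected (verts N) (edges N) \<and>
     two_connected (verts N) (insert {Pole0, Pole1} (edges N))"

definition trivial_network :: "network \<Rightarrow> bool" where
  "trivial_network N \<longleftrightarrow> edges N = {} \<and> inner N = {}"

definition relabel :: "(nat \<Rightarrow> nat) \<Rightarrow> network \<Rightarrow> network" where
  "relabel f N = \<lparr>inner = f ` inner N, edges = (`) (map_vert f) ` edges N, joints = f ` joints N\<rparr>"

definition isomorphic :: "network \<Rightarrow> network \<Rightarrow> bool" where
  "isomorphic N N' \<longleftrightarrow> (\<exists>f. inj_on f (inner N) \<and> N' = relabel f N)"

fun swap_poles :: "'a vert \<Rightarrow> 'a vert" where
  "swap_poles Pole0 = Pole1"
| "swap_poles Pole1 = Pole0"
| "swap_poles (Inner x) = Inner x"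

definition tau :: "network \<Rightarrow> network" where
  "tau N = N\<lparr>edges := (`) swap_poles ` edges N\<rparr>"

definition tau_symmetric :: "network \<Rightarrow> bool" where
  "tau_symmetric N \<longleftrightarrow> isomorphic (tau N) N"

definition network_species :: "network set \<Rightarrow> bool" where
  "network_species F \<longleftrightarrow>
     (\<forall>N\<in>F. is_network N \<and> joints N = {}) \<and>
     (\<forall>N\<in>F. \<forall>N'. isomorphic N N' \<longrightarrow> N' \<in> F)"

definition tau_closed :: "network set \<Rightarrow> bool" where
  "tau_closed F \<longleftrightarrow> (\<forall>N\<in>F. tau N \<in> F)"


fun join_left :: "'a \<Rightarrow> 'a vert \<Rightarrow> 'a vert" where
  "join_left v Pole0 = Pole0"
| "join_left v Pole1 = Inner v"
| "join_left v (Inner x) = Inner x"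

fun join_right :: "'a \<Rightarrow> 'a vert \<Rightarrow> 'a vert" where
  "join_right v Pole0 = Inner v"
| "join_right v Pole1 = Pole1"
| "join_right v (Inner x) = Inner x"

definition series_comp :: "nat \<Rightarrow> network \<Rightarrow> network \<Rightarrow> network" where
  "series_comp v M N =
     \<lparr>inner = insert v (inner M \<union> inner N),
      edges = (`) (join_left v) ` edges M \<union> (`) (join_right v) ` edges N,
      joints = insert v (joints M \<union> joints N)\<rparr>"

definition series_species :: "network set \<Rightarrow> network set \<Rightarrow> network set" (infixl "\<cdot>\<^sub>s" 75) where
  "F \<cdot>\<^sub>s G = {series_comp v M N | v M N. M \<in> F \<and> N \<in> G \<and>
      inner M \<inter> inner N = {} \<and> v \<notin> inner M \<union> inner N}"


definition plus_ext :: "(nat \<Rightarrow> nat) \<Rightarrow> nat vert \<Rightarrow> nat vert" where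
  "plus_ext s = map_vert s"

definition minus_ext :: "(nat \<Rightarrow> nat) \<Rightarrow> nat vert \<Rightarrow> nat vert" where
  "minus_ext s = swap_poles \<circ> map_vert s"

text \<open>The condition on the joints is vacuous for ordinary networks.\<close>

definition Aut_plus :: "network \<Rightarrow> (nat \<Rightarrow> nat) set" where
  "Aut_plus N = {s. s permutes inner N \<and> graph_aut (verts N) (edges N) (plus_ext s) \<and>
     s ` joints N = joints N}"

definition Aut_minus :: "network \<Rightarrow> (nat \<Rightarrow> nat) set" where
  "Aut_minus N = {s. s permutes inner N \<and> graph_aut (verts N) (edges N) (minus_ext s) \<and>
     s ` joints N = joints N}"

text \<open>The subtracted variables, those of the cycles \<open>(0)(1)\<close> resp. \<open>(0 1)\<close>, always occur.\<close>

definition weight_plus :: "network \<Rightarrow> (nat \<Rightarrow> nat) \<Rightarrow> monomial" where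
  "weight_plus N s = graph_weight (verts N) (edges N) (plus_ext s) - {#VA 1, VA 1#}"

definition weight_minus :: "network \<Rightarrow> (nat \<Rightarrow> nat) \<Rightarrow> monomial" where
  "weight_minus N s = graph_weight (verts N) (edges N) (minus_ext s) - {#VA 2#}"

definition index_plus :: "network \<Rightarrow> series" where
  "index_plus N = (\<lambda>m. (\<Sum>s\<in>Aut_plus N. monom_ser (weight_plus N s) m) / of_nat (card (Aut_plus N)))"

definition index_minus :: "network \<Rightarrow> series" where
  "index_minus N = (\<lambda>m. (\<Sum>s\<in>Aut_minus N. monom_ser (weight_minus N s) m) / of_nat (card (Aut_minus N)))"

definition iso_classes :: "network set \<Rightarrow> network set set" where
  "iso_classes F = F // {(N, N'). N \<in> F \<and> N' \<in> F \<and> isomorphic N N'}"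

definition representative :: "network set \<Rightarrow> network" where
  "representative C = (SOME N. N \<in> C)"

text \<open>A weight determines the number of internal vertices, hence each monomial occurs for only
  finitely many isomorphism classes.\<close>

definition W_plus :: "network set \<Rightarrow> series" ("W\<^sup>+") where
  "W\<^sup>+ F = ser_sum (\<lambda>C. index_plus (representative C)) (iso_classes F)"

definition W_minus :: "network set \<Rightarrow> series" ("W\<^sup>-") where
  "W\<^sup>- F = ser_sum (\<lambda>C. index_minus (representative C)) (iso_classes {N \<in> F. tau_symmetric N})"

end

theory Submission
  imports Defs
begin

text \<open>
  A series composition remembers its connecting vertices, and deleting one of them separates the two
  parts because each part stays connected after removal of a pole. Hence a composition determines its
  parts, and isomorphisms of compositions are tuples of isomorphisms of the parts. This gives
  \<open>Aut\<^sup>+ (M \<cdot> N) = Aut\<^sup>+ M \<times> Aut\<^sup>+ N\<close>, with the connecting vertex as an additional fixed point.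

  An automorphism \<open>s\<close> exchanging the poles of \<open>A \<cdot> C\<close> or \<open>A \<cdot> B \<cdot> C\<close> exchanges \<open>A\<close> and \<open>C\<close>, so
  \<open>C\<close> is the reversal of \<open>A\<close> and each cycle of \<open>s\<close> on \<open>A \<union> C\<close> is twice as long as the cycle of
  \<open>\<rho> = s\<^sup>2\<close> on \<open>A\<close> that it contains, with the same type (cylindrical or Moebius). Every
  \<open>\<rho> \<in> Aut\<^sup>+ A\<close> arises from the same number \<open>|Aut\<^sup>+ A|\<close> of choices of \<open>s\<close> on \<open>A\<close>, which turns the
  average over \<open>s\<close> into the average over \<open>\<rho>\<close> with all indices doubled.
\<close>

section \<open>Series\<close>

text \<open>An index series is an average of monomials over a finite set of permutations, so an
  identity between index series reduces to a weight-preserving bijection of index sets, a product of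
  index sets, or the removal of a factor that the weight ignores. A composition of two chosen class
  representatives is in general not the chosen representative of its own class; the sums in
  \<open>W\<^sup>+\<close> and \<open>W\<^sup>-\<close> are therefore moved to transversals, and
  canonical compositions of members of transversals form a transversal again. An infinite HOL sum is
  0, hence every exchange of sums needs local finiteness, which comes from the number of vertices
  that a weight encodes. Being a network is replaced by \<open>good_net\<close>, a condition
  preserved by relabelling, reversal and series composition: the left factor of a triple composition
  is itself a composition. In the formulas for \<open>W\<^sup>-\<close> the closure under
  \<open>tau\<close> places the reversal of every representative in the species, so that the
  composition with its reversal is available for each of them.\<close>

definition avg :: "'i set \<Rightarrow> ('i \<Rightarrow> monomial) \<Rightarrow> series" where
  "avg I p = (\<lambda>m. (\<Sum>i\<in>I. monom_ser (p i) m) / of_nat (card I))"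

text \<open>\<open>ser_sum\<close> takes the value 0 at a monomial to which infinitely many members
  contribute. This condition excludes that case, so that \<open>ser_sum\<close> is the true
  coefficientwise sum and commutes with products and substitutions.\<close>

definition locally_finite :: "('i \<Rightarrow> series) \<Rightarrow> 'i set \<Rightarrow> bool" where
  "locally_finite f I \<longleftrightarrow> (\<forall>m. finite {i \<in> I. f i m \<noteq> 0})"

text \<open>Every submultiset is listed by a word over the support of \<open>m\<close> of length at
  most the size of \<open>m\<close>. Hence a monomial has finitely many divisors and the
  coefficients of a product are finite sums.\<close>

lemma finite_submultisets: "finite {p. p \<subseteq># (m :: 'a multiset)}"
proof (rule finite_subset)
  show "{p. p \<subseteq># m} \<subseteq> mset ` {xs. set xs \<subseteq> set_mset m \<and> length xs \<le> size m}"
  proof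
    fix p assume "p \<in> {p. p \<subseteq># m}"
    moreover obtain xs where "mset xs = p"
      using ex_mset by blast
    ultimately show "p \<in> mset ` {xs. set xs \<subseteq> set_mset m \<and> length xs \<le> size m}"
      by (auto simp flip: set_mset_mset size_mset intro: size_mset_mono dest: set_mset_mono)
  qed
qed (simp add: finite_lists_length_le)

lemma finite_add_pairs: "finite {(p, q). p + q = (m :: 'a multiset)}"
proof (rule finite_subset)
  show "{(p, q). p + q = m} \<subseteq> {p. p \<subseteq># m} \<times> {q. q \<subseteq># m}"
    by auto
qed (simp add: finite_submultisets)

lemma ser_mult_alt: "(f \<otimes> g) m = (\<Sum>p | p \<subseteq># m. f p * g (m - p))"
  unfolding ser_mult_def
  by (rule sum.reindex_bij_witness[where i = "\<lambda>p. (p, m - p)" and j = fst]) auto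

lemma avg_mult:
  assumes "finite I" "finite J"
  shows "avg I p \<otimes> avg J q = avg (I \<times> J) (\<lambda>(i, j). p i + q j)"
proof
  fix m
  have one: "(monom_ser u \<otimes> monom_ser v) m = monom_ser (u + v) m" for u v
  proof -
    have "(monom_ser u \<otimes> monom_ser v) m
        = (\<Sum>x\<in>{(p, q). p + q = m}. if x = (u, v) then 1 else 0)"
      unfolding ser_mult_def by (rule sum.cong) (auto simp: monom_ser_def split: if_splits)
    also have "\<dots> = monom_ser (u + v) m"
      by (subst sum.delta) (auto simp: finite_add_pairs monom_ser_def)
    finally show ?thesis .
  qed
  have "(avg I p \<otimes> avg J q) m = (\<Sum>x\<in>{(p, q). p + q = m}. \<Sum>y\<in>I \<times> J.
      monom_ser (p (fst y)) (fst x) * monom_ser (q (snd y)) (snd x)) / of_nat (card (I \<times> J))"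
    by (simp add: ser_mult_def avg_def case_prod_beta sum_product sum.cartesian_product
        card_cartesian_product sum_divide_distrib)
  also have "\<dots> = (\<Sum>y\<in>I \<times> J. (monom_ser (p (fst y)) \<otimes> monom_ser (q (snd y))) m)
      / of_nat (card (I \<times> J))"
    by (subst sum.swap) (simp add: ser_mult_def case_prod_beta)
  finally show "(avg I p \<otimes> avg J q) m = avg (I \<times> J) (\<lambda>(i, j). p i + q j) m"
    by (simp add: one avg_def case_prod_beta)
qed

lemma avg_reindex:
  assumes "bij_betw h I J" "\<And>i. i \<in> I \<Longrightarrow> p i = q (h i)"
  shows "avg I p = avg J q"
proof
  fix m
  have "(\<Sum>i\<in>I. monom_ser (p i) m) = (\<Sum>j\<in>J. monom_ser (q j) m)"
    using sum.reindex_bij_betw[OF assms(1), of "\<lambda>j. monom_ser (q j) m"] assms(2) by simp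
  then show "avg I p m = avg J q m"
    using bij_betw_same_card[OF assms(1)] by (simp add: avg_def)
qed

lemma monom_mult_avg:
  assumes "finite I"
  shows "monom_ser u \<otimes> avg I p = avg I (\<lambda>i. u + p i)"
proof -
  have "monom_ser u = avg {()} (\<lambda>_. u)"
    by (simp add: avg_def)
  moreover have "avg ({()} \<times> I) (\<lambda>(_, i). u + p i) = avg I (\<lambda>i. u + p i)"
    by (rule avg_reindex[where h = snd]) (auto simp: bij_betw_def inj_on_def)
  ultimately show ?thesis
    using assms by (simp add: avg_mult)
qed

text \<open>A factor of the index set that the weight ignores contributes its cardinality to both
  numerator and denominator. This removes the auxiliary choice made in parametrizing pole-exchanging
  automorphisms.\<close>

lemma avg_snd:
  assumes "finite I" "I \<noteq> {}"
  shows "avg (I \<times> J) (\<lambda>(_, j). q j) = avg J q"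
proof
  fix m
  have "(\<Sum>y\<in>I \<times> J. monom_ser (q (snd y)) m) = of_nat (card I) * (\<Sum>j\<in>J. monom_ser (q j) m)"
    using sum.cartesian_product[of "\<lambda>_ j. monom_ser (q j) m" J I, symmetric]
    by (simp add: case_prod_beta)
  then show "avg (I \<times> J) (\<lambda>(_, j). q j) m = avg J q m"
    using assms by (simp add: avg_def case_prod_beta card_cartesian_product)
qed

text \<open>Doubling indices is injective on variables, hence on monomials; the fibres of the
  substitution have at most one element and \<open>pleth\<close> is a finite sum.\<close>

lemma inj_scale_mset: "inj (image_mset (scale_var 2))"
proof -
  have "inj (scale_var 2)"
  proof (rule injI)
    fix x y :: var assume "scale_var 2 x = scale_var 2 y"
    then show "x = y" by (cases x; cases y) auto
  qed
  then show ?thesis by (simp add: multiset.inj_map)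
qed

lemma finite_pleth_index: "finite {p. image_mset (scale_var 2) p = m}"
  using finite_vimageI[OF _ inj_scale_mset, of "{m}"] by (simp add: vimage_def)

lemma pleth_avg: "pleth 2 (avg I p) = avg I (\<lambda>i. image_mset (scale_var 2) (p i))"
proof
  fix m
  let ?S = "{p. image_mset (scale_var 2) p = m}"
  have one: "(\<Sum>x\<in>?S. monom_ser u x) = monom_ser (image_mset (scale_var 2) u) m" for u
    using sum.delta[OF finite_pleth_index[of m], of u "\<lambda>_. 1"]
    by (auto simp: monom_ser_def)
  have "pleth 2 (avg I p) m = (\<Sum>i\<in>I. \<Sum>x\<in>?S. monom_ser (p i) x) / of_nat (card I)"
    unfolding pleth_def avg_def sum_divide_distrib[symmetric] by (subst sum.swap) simp
  then show "pleth 2 (avg I p) m = avg I (\<lambda>i. image_mset (scale_var 2) (p i)) m"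
    by (simp add: one avg_def)
qed

text \<open>The support depends on the family and on the monomial. Any finite set containing it
  serves as well, so several sums can be put over one common finite index set.\<close>

lemma ser_sum_eq_sum:
  assumes "finite J" "J \<subseteq> I" "\<And>i. i \<in> I - J \<Longrightarrow> f i m = 0"
  shows "ser_sum f I m = (\<Sum>i\<in>J. f i m)"
  unfolding ser_sum_def
  by (rule sum.mono_neutral_left) (use assms in auto)

lemma ser_sum_reindex:
  assumes "inj_on h I" "\<And>i. i \<in> I \<Longrightarrow> f (h i) = g i"
  shows "ser_sum f (h ` I) = ser_sum g I"
proof
  fix m
  have "{i \<in> h ` I. f i m \<noteq> 0} = h ` {i \<in> I. g i m \<noteq> 0}"
    using assms(2) by auto
  then show "ser_sum f (h ` I) m = ser_sum g I m"
    unfolding ser_sum_def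
    using assms by (simp add: sum.reindex inj_on_def)
qed

text \<open>The coefficient at \<open>m\<close> involves only the finitely many divisors of
  \<open>m\<close>. The indices contributing to some divisor form finite sets \<open>I'\<close> and
  \<open>J'\<close>, on which this is ordinary distributivity.\<close>

lemma ser_sum_mult:
  assumes "locally_finite f I" "locally_finite g J"
  shows "ser_sum (\<lambda>(i, j). f i \<otimes> g j) (I \<times> J) = ser_sum f I \<otimes> ser_sum g J"
proof
  fix m :: monomial
  define P where "P = {p. p \<subseteq># m}"
  have P: "finite P" by (simp add: P_def finite_submultisets)
  define I' where "I' = (\<Union>p\<in>P. {i \<in> I. f i p \<noteq> 0})"
  define J' where "J' = (\<Union>p\<in>P. {j \<in> J. g j p \<noteq> 0})"
  have I': "finite I'" "I' \<subseteq> I" "\<And>i p. p \<in> P \<Longrightarrow> i \<in> I - I' \<Longrightarrow> f i p = 0"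
    using assms P by (auto simp: I'_def locally_finite_def)
  have J': "finite J'" "J' \<subseteq> J" "\<And>j p. p \<in> P \<Longrightarrow> j \<in> J - J' \<Longrightarrow> g j p = 0"
    using assms P by (auto simp: J'_def locally_finite_def)
  have diff: "m - p \<in> P" if "p \<in> P" for p
    by (simp add: P_def)
  have "ser_sum (\<lambda>(i, j). f i \<otimes> g j) (I \<times> J) m = (\<Sum>(i, j)\<in>I' \<times> J'. (f i \<otimes> g j) m)"
  proof (subst ser_sum_eq_sum[where J = "I' \<times> J'"])
    fix x assume "x \<in> I \<times> J - I' \<times> J'"
    then have "fst x \<in> I - I' \<or> snd x \<in> J - J'" by auto
    then have "f (fst x) p * g (snd x) (m - p) = 0" if "p \<in> P" for p
      using that I'(3) J'(3) diff by auto
    then show "(case x of (i, j) \<Rightarrow> f i \<otimes> g j) m = 0"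
      unfolding case_prod_beta ser_mult_alt P_def[symmetric] by (simp add: sum.neutral)
  qed (use I' J' in \<open>auto simp: case_prod_beta\<close>)
  also have "\<dots> = (\<Sum>p\<in>P. (\<Sum>i\<in>I'. f i p) * (\<Sum>j\<in>J'. g j (m - p)))"
    unfolding case_prod_beta ser_mult_alt P_def[symmetric]
    by (subst sum.swap) (simp add: sum_product sum.cartesian_product case_prod_beta)
  also have "\<dots> = (\<Sum>p\<in>P. ser_sum f I p * ser_sum g J (m - p))"
  proof (rule sum.cong[OF refl])
    fix p assume p: "p \<in> P"
    have "ser_sum f I p = (\<Sum>i\<in>I'. f i p)"
      by (rule ser_sum_eq_sum) (use I' p in auto)
    moreover have "ser_sum g J (m - p) = (\<Sum>j\<in>J'. g j (m - p))"
      by (rule ser_sum_eq_sum) (use J' diff[OF p] in auto)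
    ultimately show "(\<Sum>i\<in>I'. f i p) * (\<Sum>j\<in>J'. g j (m - p)) = ser_sum f I p * ser_sum g J (m - p)"
      by simp
  qed
  finally show "ser_sum (\<lambda>(i, j). f i \<otimes> g j) (I \<times> J) m = (ser_sum f I \<otimes> ser_sum g J) m"
    by (simp add: ser_mult_alt P_def)
qed

text \<open>A nonzero coefficient of the product at \<open>m\<close> forces a nonzero coefficient of
  \<open>f i\<close> at one of the finitely many divisors of \<open>m\<close>.\<close>

lemma locally_finite_mult:
  assumes "locally_finite f I"
  shows "locally_finite (\<lambda>i. h \<otimes> f i) I"
  unfolding locally_finite_def
proof
  fix m
  have "{i \<in> I. (h \<otimes> f i) m \<noteq> 0} \<subseteq> (\<Union>p\<in>{p. p \<subseteq># m}. {i \<in> I. f i (m - p) \<noteq> 0})"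
    by (auto simp: ser_mult_alt elim!: sum.not_neutral_contains_not_neutral)
  then show "finite {i \<in> I. (h \<otimes> f i) m \<noteq> 0}"
    by (rule finite_subset) (use assms in \<open>simp add: locally_finite_def finite_submultisets\<close>)
qed

lemma ser_sum_mult_left:
  assumes "locally_finite f I"
  shows "ser_sum (\<lambda>i. h \<otimes> f i) I = h \<otimes> ser_sum f I"
proof -
  \<comment> \<open>The constant \<open>h\<close> is read as a sum over a one-element index set, so
    the product rule for sums applies.\<close>
  have "ser_sum (\<lambda>(_, i). h \<otimes> f i) ({()} \<times> I) = ser_sum (\<lambda>_. h) {()} \<otimes> ser_sum f I"
    using ser_sum_mult[of "\<lambda>_. h" "{()}" f I] assms by (simp add: locally_finite_def)
  moreover have "ser_sum (\<lambda>_. h) {()} = h"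
  proof
    show "ser_sum (\<lambda>_. h) {()} m = h m" for m
      by (subst ser_sum_eq_sum[where J = "{()}"]) auto
  qed
  moreover have "ser_sum (\<lambda>(_, i). h \<otimes> f i) (Pair () ` I) = ser_sum (\<lambda>i. h \<otimes> f i) I"
    by (rule ser_sum_reindex) (auto simp: inj_on_def)
  moreover have "Pair () ` I = {()} \<times> I" by auto
  ultimately show ?thesis by simp
qed

lemma locally_finite_pleth:
  assumes "locally_finite f I"
  shows "locally_finite (\<lambda>i. pleth 2 (f i)) I"
  unfolding locally_finite_def
proof
  fix m
  have "{i \<in> I. pleth 2 (f i) m \<noteq> 0}
      \<subseteq> (\<Union>p\<in>{p. image_mset (scale_var 2) p = m}. {i \<in> I. f i p \<noteq> 0})"
    by (auto simp: pleth_def elim!: sum.not_neutral_contains_not_neutral)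
  then show "finite {i \<in> I. pleth 2 (f i) m \<noteq> 0}"
    by (rule finite_subset) (use assms finite_pleth_index in \<open>auto simp: locally_finite_def\<close>)
qed

lemma ser_sum_pleth:
  assumes "locally_finite f I"
  shows "ser_sum (\<lambda>i. pleth 2 (f i)) I = pleth 2 (ser_sum f I)"
proof
  fix m
  let ?S = "{p. image_mset (scale_var 2) p = m}"
  define J where "J = (\<Union>p\<in>?S. {i \<in> I. f i p \<noteq> 0})"
  have J: "finite J" "J \<subseteq> I" "\<And>i p. p \<in> ?S \<Longrightarrow> i \<in> I - J \<Longrightarrow> f i p = 0"
    using assms finite_pleth_index by (auto simp: J_def locally_finite_def)
  have "ser_sum (\<lambda>i. pleth 2 (f i)) I m = (\<Sum>i\<in>J. pleth 2 (f i) m)"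
    by (rule ser_sum_eq_sum) (use J in \<open>auto simp: pleth_def intro!: sum.neutral\<close>)
  also have "\<dots> = (\<Sum>p\<in>?S. \<Sum>i\<in>J. f i p)"
    unfolding pleth_def by (rule sum.swap)
  also have "\<dots> = (\<Sum>p\<in>?S. ser_sum f I p)"
    by (rule sum.cong[OF refl], rule ser_sum_eq_sum[symmetric]) (use J in auto)
  finally show "ser_sum (\<lambda>i. pleth 2 (f i)) I m = pleth 2 (ser_sum f I) m"
    by (simp add: pleth_def)
qed

section \<open>Cycle weights\<close>

definition vweight :: "'v set \<Rightarrow> ('v \<Rightarrow> 'v) \<Rightarrow> monomial" where
  "vweight V s = image_mset (\<lambda>c. VA (card c)) (mset_set (vertex_cycles V s))"

definition eweight :: "'v set set \<Rightarrow> ('v \<Rightarrow> 'v) \<Rightarrow> monomial" where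
  "eweight E s =
     image_mset (\<lambda>c. VB (card c)) (mset_set {c \<in> edge_cycles E s. cylindrical s c}) +
     image_mset (\<lambda>c. VC (card c)) (mset_set {c \<in> edge_cycles E s. moebius s c})"

lemma graph_weight_eq: "graph_weight V E s = vweight V s + eweight E s"
  by (simp add: graph_weight_def vweight_def eweight_def)

section \<open>Orbits under invariance and semiconjugacy\<close>

lemma orbit_subset_invariant:
  assumes "f ` X \<subseteq> X" "x \<in> X"
  shows "orbit f x \<subseteq> X"
proof
  fix y assume "y \<in> orbit f x"
  then show "y \<in> X" by induction (use assms in auto)
qed

lemma funpow_invariant:
  assumes "f ` X \<subseteq> X" "x \<in> X"
  shows "(f ^^ n) x \<in> X"
  by (induction n) (use assms in auto)

lemma funpow_semiconj:
  assumes "f ` X \<subseteq> X" "\<And>y. y \<in> X \<Longrightarrow> g (h y) = h (f y)" "x \<in> X"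
  shows "(g ^^ n) (h x) = h ((f ^^ n) x)"
  by (induction n) (use assms funpow_invariant[OF assms(1,3)] in auto)

lemma orbit_semiconj:
  assumes "f ` X \<subseteq> X" "\<And>y. y \<in> X \<Longrightarrow> g (h y) = h (f y)" "x \<in> X"
  shows "orbit g (h x) = h ` orbit f x"
  using funpow_semiconj[of f X g h, OF assms] by (auto simp: orbit_altdef)

text \<open>An orbit collects the positive iterates, so containing its starting point is a matter of
  recurrence. That holds for permutations of finite support; \<open>perm_restrict f X\<close> is
  one, and it has the same orbits on \<open>X\<close> as \<open>f\<close>.\<close>

lemma self_in_orbit_bij_betw:
  assumes "finite X" "bij_betw f X X" "x \<in> X"
  shows "x \<in> orbit f x"
proof -
  have "bij_betw (perm_restrict f X) X X"
    using assms(2) by (subst bij_betw_cong[where g = f]) (auto simp: perm_restrict_simps)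
  then have "perm_restrict f X permutes X"
    by (rule bij_imp_permutes) (auto simp: perm_restrict_simps)
  then have "x \<in> orbit (perm_restrict f X) x"
    using assms(1) by (intro permutation_self_in_orbit) (auto simp: permutation_permutes)
  moreover have "orbit f x = orbit (perm_restrict f X) x"
    by (rule orbit_cong0[where A = X])
      (use assms in \<open>auto simp: perm_restrict_simps bij_betw_def\<close>)
  ultimately show ?thesis by simp
qed

lemma edge_cycles_Un: "edge_cycles (X \<union> Y) s = edge_cycles X s \<union> edge_cycles Y s"
  by (auto simp: edge_cycles_def)

lemma orbit_images_disjoint:
  assumes "f ` X \<subseteq> X" "f ` Y \<subseteq> Y" "X \<inter> Y = {}"
  shows "orbit f ` X \<inter> orbit f ` Y = {}"
proof -
  have False if "x \<in> X" "y \<in> Y" "orbit f x = orbit f y" for x y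
    using orbit_subset_invariant[OF assms(1) that(1)] orbit_subset_invariant[OF assms(2) that(2)]
      orbit.base[of f x] that(3) assms(3) by auto
  then show ?thesis by auto
qed

text \<open>A cycle that starts in an invariant part stays there, so the cycles of the union are
  those of the two parts. Monomials are multisets, hence the sum stands for a product of
  weights.\<close>

lemma vweight_Un:
  assumes "finite X" "finite Y" "X \<inter> Y = {}" "s ` X \<subseteq> X" "s ` Y \<subseteq> Y"
  shows "vweight (X \<union> Y) s = vweight X s + vweight Y s"
  using assms orbit_images_disjoint[of s X Y]
  by (simp add: vweight_def vertex_cycles_def image_Un mset_set_Union)

lemma eweight_Un:
  assumes "finite X" "finite Y" "X \<inter> Y = {}" "(`) s ` X \<subseteq> X" "(`) s ` Y \<subseteq> Y"
  shows "eweight (X \<union> Y) s = eweight X s + eweight Y s"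
proof -
  have dis: "edge_cycles X s \<inter> edge_cycles Y s = {}"
    unfolding edge_cycles_def using orbit_images_disjoint assms(3-5) by blast
  have fin: "finite (edge_cycles X s)" "finite (edge_cycles Y s)"
    using assms by (auto simp: edge_cycles_def)
  have split: "mset_set {c \<in> edge_cycles (X \<union> Y) s. P c}
      = mset_set {c \<in> edge_cycles X s. P c} + mset_set {c \<in> edge_cycles Y s. P c}" for P
    unfolding edge_cycles_Un using fin dis
    by (subst mset_set_Union[symmetric]) (auto intro!: arg_cong[where f = mset_set])
  show ?thesis
    by (simp add: eweight_def split)
qed

text \<open>Common pattern of the two ways in which cycles are compared: \<open>k = 1\<close> for
  maps conjugate by an injection, \<open>k = 2\<close> for a map and its square on one of two
  exchanged halves.\<close>

lemma vweight_transfer: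
  assumes "vertex_cycles X s = H ` vertex_cycles Y t" "inj_on H (vertex_cycles Y t)"
    and "\<And>c. c \<in> vertex_cycles Y t \<Longrightarrow> card (H c) = k * card c"
  shows "vweight X s = image_mset (scale_var k) (vweight Y t)"
proof (cases "finite (vertex_cycles Y t)")
  case True
  have "vweight X s = image_mset (\<lambda>c. VA (card (H c))) (mset_set (vertex_cycles Y t))"
    unfolding vweight_def assms(1) image_mset_mset_set[OF assms(2), symmetric]
    by (simp add: multiset.map_comp comp_def)
  also have "\<dots> = image_mset (\<lambda>c. VA (k * card c)) (mset_set (vertex_cycles Y t))"
    by (rule image_mset_cong) (use assms(3) True in auto)
  finally show ?thesis
    by (simp add: vweight_def multiset.map_comp comp_def)
next
  \<comment> \<open>\<open>mset_set\<close> of an infinite set is the empty multiset, so both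
    weights are empty.\<close>
  case False
  then have "\<not> finite (vertex_cycles X s)"
    using assms by (simp add: finite_image_iff)
  then show ?thesis
    using False by (simp add: vweight_def)
qed

lemma eweight_transfer:
  assumes "edge_cycles X s = H ` edge_cycles Y t" "inj_on H (edge_cycles Y t)"
    and "finite (edge_cycles Y t)"
    and card: "\<And>c. c \<in> edge_cycles Y t \<Longrightarrow> card (H c) = k * card c"
    and cyl: "\<And>c. c \<in> edge_cycles Y t \<Longrightarrow> cylindrical s (H c) \<longleftrightarrow> cylindrical t c"
    and moeb: "\<And>c. c \<in> edge_cycles Y t \<Longrightarrow> moebius s (H c) \<longleftrightarrow> moebius t c"
  shows "eweight X s = image_mset (scale_var k) (eweight Y t)"
proof -
  \<comment> \<open>One argument for both kinds of edge cycle: \<open>C\<close> is the variable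
    constructor, \<open>P\<close> and \<open>Q\<close> are the corresponding type predicates on the
    two sides.\<close>
  have part: "image_mset (\<lambda>c. C (card c)) (mset_set {c \<in> edge_cycles X s. P c})
      = image_mset (\<lambda>c. C (k * card c)) (mset_set {c \<in> edge_cycles Y t. Q c})"
    if PQ: "\<And>c. c \<in> edge_cycles Y t \<Longrightarrow> P (H c) \<longleftrightarrow> Q c" for P Q and C :: "nat \<Rightarrow> var"
  proof -
    have "{c \<in> edge_cycles X s. P c} = H ` {c \<in> edge_cycles Y t. Q c}"
      using PQ by (auto simp: assms(1))
    moreover have "inj_on H {c \<in> edge_cycles Y t. Q c}"
      using assms(2) by (rule inj_on_subset) auto
    ultimately have "image_mset (\<lambda>c. C (card c)) (mset_set {c \<in> edge_cycles X s. P c})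
        = image_mset (\<lambda>c. C (card (H c))) (mset_set {c \<in> edge_cycles Y t. Q c})"
      by (simp add: image_mset_mset_set[symmetric] multiset.map_comp comp_def)
    also have "\<dots> = image_mset (\<lambda>c. C (k * card c)) (mset_set {c \<in> edge_cycles Y t. Q c})"
      by (rule image_mset_cong) (use card assms(3) in auto)
    finally show ?thesis .
  qed
  show ?thesis
    using part[of "cylindrical s" "cylindrical t" VB] part[of "moebius s" "moebius t" VC] cyl moeb
    by (simp add: eweight_def multiset.map_comp comp_def)
qed

lemma image_scale_var_1 [simp]: "image_mset (scale_var (Suc 0)) m = m"
proof -
  have "scale_var (Suc 0) = id"
  proof
    show "scale_var (Suc 0) x = id x" for x by (cases x) auto
  qed
  then show ?thesis by simp
qed

lemma vweight_semiconj:
  assumes "inj_on h X" "f ` X \<subseteq> X" "\<And>y. y \<in> X \<Longrightarrow> g (h y) = h (f y)"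
  shows "vweight (h ` X) g = vweight X f"
proof -
  have "vweight (h ` X) g = image_mset (scale_var 1) (vweight X f)"
  proof (rule vweight_transfer[where H = "(`) h"])
    show "vertex_cycles (h ` X) g = (`) h ` vertex_cycles X f"
      unfolding vertex_cycles_def image_image
      by (rule image_cong[OF refl]) (use orbit_semiconj[of f X g h] assms in auto)
    have sub: "c \<subseteq> X" if "c \<in> vertex_cycles X f" for c
      using that orbit_subset_invariant[OF assms(2)] by (auto simp: vertex_cycles_def)
    show "inj_on ((`) h) (vertex_cycles X f)"
      using sub assms(1) by (auto intro!: inj_onI simp: inj_on_image_eq_iff)
    show "card (h ` c) = 1 * card c" if "c \<in> vertex_cycles X f" for c
      using sub[OF that] assms(1) by (simp add: card_image inj_on_subset)
  qed
  then show ?thesis by simp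
qed

text \<open>The type of an edge cycle is decided by where a power of the map sends the ends of its
  edges. These ends lie in \<open>V\<close>, where \<open>h\<close> both preserves and reflects such
  equations.\<close>

lemma eweight_semiconj:
  assumes "finite E" "inj_on h V" "\<And>e. e \<in> E \<Longrightarrow> e \<subseteq> V" "f ` V \<subseteq> V" "(`) f ` E \<subseteq> E"
    and "\<And>y. y \<in> V \<Longrightarrow> g (h y) = h (f y)"
  shows "eweight ((`) h ` E) g = eweight E f"
proof -
  have sub: "c \<subseteq> E" if "c \<in> edge_cycles E f" for c
    using that orbit_subset_invariant[OF assms(5)] by (auto simp: edge_cycles_def)
  have injE: "inj_on ((`) h) E"
    using assms(2,3) by (auto intro!: inj_onI simp: inj_on_image_eq_iff)
  have card: "card ((`) h ` c) = card c" if "c \<in> edge_cycles E f" for c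
    using sub[OF that] injE by (simp add: card_image inj_on_subset)
  have pow: "(g ^^ n) (h x) = h ((f ^^ n) x)" if "x \<in> V" for n x
    using funpow_semiconj[of f V g h] assms(4,6) that by blast
  have eq: "(g ^^ n) (h x) = h y \<longleftrightarrow> (f ^^ n) x = y" if "x \<in> V" "y \<in> V" for n x y
    using pow that funpow_invariant[OF assms(4)] assms(2) by (auto simp: inj_on_eq_iff)
  have "eweight ((`) h ` E) g = image_mset (scale_var 1) (eweight E f)"
  proof (rule eweight_transfer[where H = "(`) ((`) h)"])
    show "edge_cycles ((`) h ` E) g = (`) ((`) h) ` edge_cycles E f"
      unfolding edge_cycles_def image_image
    proof (rule image_cong[OF refl])
      fix e assume "e \<in> E"
      moreover have "g ` h ` e' = h ` f ` e'" if "e' \<in> E" for e'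
        using assms(3)[OF that] assms(6) by (force simp: image_iff)
      ultimately show "orbit ((`) g) (h ` e) = (`) h ` orbit ((`) f) e"
        using orbit_semiconj[of "(`) f" E "(`) g" "(`) h" e] assms(5) by auto
    qed
    show "inj_on ((`) ((`) h)) (edge_cycles E f)"
      using sub injE by (auto intro!: inj_onI simp: inj_on_image_eq_iff)
    show "finite (edge_cycles E f)"
      using assms(1) by (simp add: edge_cycles_def)
    fix c assume c: "c \<in> edge_cycles E f"
    then have V: "e \<subseteq> V" if "e \<in> c" for e
      using sub assms(3) that by blast
    show "card ((`) h ` c) = 1 * card c"
      using card[OF c] by simp
    show "cylindrical g ((`) h ` c) \<longleftrightarrow> cylindrical f c"
      using V eq unfolding cylindrical_def card[OF c] by (simp add: subset_iff)
    show "moebius g ((`) h ` c) \<longleftrightarrow> moebius f c"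
      unfolding moebius_def card[OF c] ball_simps
    proof (rule ball_cong[OF refl])
      fix e assume e: "e \<in> c"
      show "(\<exists>x y. x \<noteq> y \<and> h ` e = {x, y} \<and> (g ^^ card c) x = y \<and> (g ^^ card c) y = x) \<longleftrightarrow>
        (\<exists>x y. x \<noteq> y \<and> e = {x, y} \<and> (f ^^ card c) x = y \<and> (f ^^ card c) y = x)" (is "?L \<longleftrightarrow> ?R")
      proof
        assume ?L
        then obtain x y where xy: "x \<noteq> y" "h ` e = {x, y}"
          "(g ^^ card c) x = y" "(g ^^ card c) y = x" by blast
        then obtain x' y' where x'y': "x' \<in> e" "y' \<in> e" "x = h x'" "y = h y'" by blast
        then have "h ` e = h ` {x', y'}" using xy by simp
        then have "e = {x', y'}"
          using inj_on_image_eq_iff[OF assms(2), of e "{x', y'}"] V[OF e] x'y' by blast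
        moreover have "x' \<in> V" "y' \<in> V" using x'y' V[OF e] by auto
        ultimately have "x' \<noteq> y' \<and> e = {x', y'} \<and> (f ^^ card c) x' = y' \<and> (f ^^ card c) y' = x'"
          using xy x'y' eq by metis
        then show ?R by blast
      next
        assume ?R
        then obtain x y where xy: "x \<noteq> y" "e = {x, y}"
          "(f ^^ card c) x = y" "(f ^^ card c) y = x" by blast
        moreover have "x \<in> V" "y \<in> V" using xy V[OF e] by auto
        ultimately have "h x \<noteq> h y" "h ` e = {h x, h y}"
          "(g ^^ card c) (h x) = h y" "(g ^^ card c) (h y) = h x"
          using eq assms(2) by (auto simp: inj_on_eq_iff)
        then show ?L by blast
      qed
    qed
  qed
  then show ?thesis by simp
qed

section \<open>Cycles of a map that exchanges two halves\<close>

context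
  fixes f :: "'v \<Rightarrow> 'v" and Y :: "'v set"
  assumes fin: "finite Y" and inj: "inj_on f (Y \<union> f ` Y)"
    and sq: "(f \<circ> f) ` Y = Y" and dis: "Y \<inter> f ` Y = {}"
begin

lemma orbit_double:
  assumes "y \<in> Y"
  shows "orbit f y = orbit (f \<circ> f) y \<union> f ` orbit (f \<circ> f) y"
proof -
  have ff: "bij_betw (f \<circ> f) Y Y"
    using sq inj by (auto simp: bij_betw_def inj_on_def)
  have self2: "y \<in> orbit (f \<circ> f) y"
    using fin ff assms by (rule self_in_orbit_bij_betw)
  have "(f \<circ> f) ` Y = f ` f ` Y" by (rule image_comp[symmetric])
  then have "f ` (Y \<union> f ` Y) = Y \<union> f ` Y"
    using sq by (auto simp: image_Un)
  then have self: "y \<in> orbit f y"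
    using inj fin assms self_in_orbit_bij_betw[of "Y \<union> f ` Y" f y] by (simp add: bij_betw_def)
  have pow: "(f \<circ> f) ^^ n = f ^^ (2 * n)" for n
    by (induction n) (simp_all add: comp_assoc)
  \<comment> \<open>Since the point recurs, exponent 0 may be included; the even exponents then give
    the orbit of the square and the odd ones its image.\<close>
  have "orbit f y = {(f ^^ n) y | n. True}"
    by (rule orbit_altdef_self_in[OF self])
  also have "\<dots> = {(f ^^ (2 * n)) y | n. True} \<union> {f ((f ^^ (2 * n)) y) | n. True}"
    (is "?L = ?R")
  proof (intro set_eqI iffI)
    fix x assume "x \<in> ?L"
    then obtain n where "x = (f ^^ n) y" by blast
    moreover have "n = 2 * (n div 2) \<or> n = Suc (2 * (n div 2))" by presburger
    ultimately have "x = (f ^^ (2 * (n div 2))) y \<or> x = f ((f ^^ (2 * (n div 2))) y)"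
      by (metis funpow.simps(2) comp_apply)
    then show "x \<in> ?R" by blast
  next
    fix x assume "x \<in> ?R"
    then obtain n where "x = (f ^^ (2 * n)) y \<or> x = (f ^^ Suc (2 * n)) y" by auto
    then show "x \<in> ?L" by blast
  qed
  also have "\<dots> = orbit (f \<circ> f) y \<union> f ` orbit (f \<circ> f) y"
    unfolding orbit_altdef_self_in[OF self2] pow by auto
  finally show ?thesis .
qed

lemma square_orbit_subset: "y \<in> Y \<Longrightarrow> orbit (f \<circ> f) y \<subseteq> Y"
  using orbit_subset_invariant[of "f \<circ> f" Y] sq by simp

text \<open>The points \<open>y\<close> and \<open>f y\<close> have the same orbit, so every orbit
  on the two halves already starts in \<open>Y\<close>.\<close>

lemma orbits_double:
  "orbit f ` (Y \<union> f ` Y) = (\<lambda>c. c \<union> f ` c) ` orbit (f \<circ> f) ` Y"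
proof -
  have "(f \<circ> f) ` Y = f ` f ` Y" by (rule image_comp[symmetric])
  then have "f ` (Y \<union> f ` Y) = Y \<union> f ` Y"
    using sq by (auto simp: image_Un)
  then have "orbit f (f y) = orbit f y" if "y \<in> Y" for y
    using inj fin that self_in_orbit_bij_betw[of "Y \<union> f ` Y" f y]
    by (intro self_in_orbit_step) (auto simp: bij_betw_def)
  then have "orbit f ` (Y \<union> f ` Y) = orbit f ` Y"
    by (auto simp: image_Un image_image)
  then show ?thesis
    unfolding image_image using orbit_double by simp
qed

text \<open>Intersecting the doubled cycle with \<open>Y\<close> recovers the original cycle,
  because the other half is disjoint from \<open>Y\<close>.\<close>

lemma inj_on_double: "inj_on (\<lambda>c. c \<union> f ` c) (orbit (f \<circ> f) ` Y)"
proof (rule inj_onI)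
  fix c d assume c: "c \<in> orbit (f \<circ> f) ` Y" and d: "d \<in> orbit (f \<circ> f) ` Y"
    and eq: "c \<union> f ` c = d \<union> f ` d"
  have "c \<subseteq> Y" "d \<subseteq> Y" using c d square_orbit_subset by auto
  then have "(c \<union> f ` c) \<inter> Y = c" "(d \<union> f ` d) \<inter> Y = d"
    using dis by auto
  then show "c = d" using eq by metis
qed

lemma card_double:
  assumes "c \<in> orbit (f \<circ> f) ` Y"
  shows "card (c \<union> f ` c) = 2 * card c"
proof -
  have c: "c \<subseteq> Y" using assms square_orbit_subset by auto
  then have "c \<inter> f ` c = {}" using dis by auto
  moreover have "card (f ` c) = card c"
    using c inj by (intro card_image) (auto intro: inj_on_subset)
  ultimately show ?thesis
    using finite_subset[OF c fin] by (subst card_Un_disjoint) auto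
qed

lemma vweight_double: "vweight (Y \<union> f ` Y) f = image_mset (scale_var 2) (vweight Y (f \<circ> f))"
proof (rule vweight_transfer[where H = "\<lambda>c. c \<union> f ` c"])
  show "vertex_cycles (Y \<union> f ` Y) f = (\<lambda>c. c \<union> f ` c) ` vertex_cycles Y (f \<circ> f)"
    unfolding vertex_cycles_def by (rule orbits_double)
  show "inj_on (\<lambda>c. c \<union> f ` c) (vertex_cycles Y (f \<circ> f))"
    unfolding vertex_cycles_def by (rule inj_on_double)
  show "card (c \<union> f ` c) = 2 * card c" if "c \<in> vertex_cycles Y (f \<circ> f)" for c
    using that unfolding vertex_cycles_def by (rule card_double)
qed

end

text \<open>A cycle of length \<open>l\<close> of the square becomes a cycle of length
  \<open>2 * l\<close> of \<open>s\<close>, and the return maps agree: the power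
  \<open>2 * l\<close> of \<open>s\<close> is the power \<open>l\<close> of
  \<open>s \<circ> s\<close>. On the edges in the second half the test transfers because
  \<open>s\<close> commutes with its powers.\<close>

lemma eweight_double:
  assumes fin: "finite E" and inj: "inj_on s V" and sV: "s ` V \<subseteq> V" and EV: "\<And>e. e \<in> E \<Longrightarrow> e \<subseteq> V"
    and sq: "(`) (s \<circ> s) ` E = E" and dis: "E \<inter> (`) s ` E = {}"
  shows "eweight (E \<union> (`) s ` E) s = image_mset (scale_var 2) (eweight E (s \<circ> s))"
proof -
  have comp: "(`) (s \<circ> s) = (`) s \<circ> (`) s"
    by (auto simp: fun_eq_iff image_comp)
  have injE: "inj_on ((`) s) (E \<union> (`) s ` E)"
  proof -
    have "\<And>e. e \<in> E \<union> (`) s ` E \<Longrightarrow> e \<subseteq> V" using EV sV by blast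
    then show ?thesis
      using inj by (intro inj_onI) (meson inj_on_image_eq_iff)
  qed
  note double = fin injE sq[unfolded comp] dis
  have sub: "c \<subseteq> E" if "c \<in> orbit ((`) s \<circ> (`) s) ` E" for c
    using that square_orbit_subset[OF double] by auto
  have pow: "s ^^ (2 * n) = (s \<circ> s) ^^ n" for n
    by (induction n) (simp_all add: comp_assoc)
  have shift: "(s ^^ n) (s x) = s ((s ^^ n) x)" for n x
    by (simp add: funpow_swap1)
  show ?thesis
  proof (rule eweight_transfer[where H = "\<lambda>c. c \<union> (`) s ` c"])
    show "edge_cycles (E \<union> (`) s ` E) s = (\<lambda>c. c \<union> (`) s ` c) ` edge_cycles E (s \<circ> s)"
      unfolding edge_cycles_def comp by (rule orbits_double[OF double])
    show "inj_on (\<lambda>c. c \<union> (`) s ` c) (edge_cycles E (s \<circ> s))"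
      unfolding edge_cycles_def comp by (rule inj_on_double[OF double])
    show "finite (edge_cycles E (s \<circ> s))"
      using fin by (simp add: edge_cycles_def)
    fix c assume c: "c \<in> edge_cycles E (s \<circ> s)"
    then have card: "card (c \<union> (`) s ` c) = 2 * card c"
      unfolding edge_cycles_def comp by (rule card_double[OF double])
    then show "card (c \<union> (`) s ` c) = 2 * card c" .
    show "cylindrical s (c \<union> (`) s ` c) \<longleftrightarrow> cylindrical (s \<circ> s) c"
      unfolding cylindrical_def card pow[symmetric] by (auto simp: shift)
    have cV: "e \<subseteq> V" if "e \<in> c" for e
      using c sub EV that unfolding edge_cycles_def comp by blast
    show "moebius s (c \<union> (`) s ` c) \<longleftrightarrow> moebius (s \<circ> s) c"
    proof
      assume "moebius s (c \<union> (`) s ` c)"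
      then show "moebius (s \<circ> s) c"
        unfolding moebius_def card pow by blast
    next
      assume m: "moebius (s \<circ> s) c"
      show "moebius s (c \<union> (`) s ` c)"
        unfolding moebius_def card
      proof
        fix e assume "e \<in> c \<union> (`) s ` c"
        then obtain e' where e': "e' \<in> c" "e = e' \<or> e = s ` e'" by blast
        then obtain x y where xy: "x \<noteq> y" "e' = {x, y}"
          "(s ^^ (2 * card c)) x = y" "(s ^^ (2 * card c)) y = x"
          using m unfolding moebius_def pow by metis
        have "x \<in> V" "y \<in> V" using cV[OF e'(1)] xy(2) by auto
        \<comment> \<open>A Moebius edge needs two distinct ends; injectivity on \<open>V\<close>
          keeps them distinct after passing to the second half.\<close>
        then have "s x \<noteq> s y" using inj xy(1) by (auto simp: inj_on_eq_iff)
        moreover have "(s ^^ (2 * card c)) (s x) = s y" "(s ^^ (2 * card c)) (s y) = s x"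
          using xy by (simp_all add: shift)
        moreover have "s ` e' = {s x, s y}" using xy by simp
        ultimately show "\<exists>x y. x \<noteq> y \<and> e = {x, y} \<and> (s ^^ (2 * card c)) x = y \<and> (s ^^ (2 * card c)) y = x"
          using e'(2) xy by metis
      qed
    qed
  qed
qed

section \<open>Networks and series composition\<close>

definition wf_net :: "network \<Rightarrow> bool" where
  "wf_net N \<longleftrightarrow> finite (inner N) \<and> (\<forall>e\<in>edges N. e \<subseteq> verts N \<and> card e = 2) \<and> joints N \<subseteq> inner N"

text \<open>Connectivity by closed sets: every inner vertex is reachable from \<open>Pole0\<close> without passing
  through \<open>Pole1\<close>, and \<open>Pole1\<close> is reachable from \<open>Pole0\<close>.\<close>

definition linked :: "network \<Rightarrow> bool" where
  "linked N \<longleftrightarrow>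
     (\<forall>S. Pole0 \<in> S \<and> (\<forall>u w. {u, w} \<in> edges N \<and> u \<in> S \<and> u \<noteq> Pole1 \<and> w \<noteq> Pole1 \<longrightarrow> w \<in> S)
        \<longrightarrow> Inner ` inner N \<subseteq> S) \<and>
     (\<forall>S. Pole0 \<in> S \<and> (\<forall>u w. {u, w} \<in> edges N \<and> u \<in> S \<longrightarrow> w \<in> S) \<longrightarrow> Pole1 \<in> S)"

text \<open>\<open>linked\<close> is asymmetric in the poles: it speaks of paths from
  \<open>Pole0\<close> that avoid \<open>Pole1\<close>. Requiring it of the reversal as well covers
  the paths from \<open>Pole1\<close> and makes the condition stable under
  \<open>tau\<close>.\<close>

definition good_net :: "network \<Rightarrow> bool" where
  "good_net N \<longleftrightarrow> wf_net N \<and> linked N \<and> linked (tau N)"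

section \<open>Relabelling, reversal and composition\<close>

lemma swap_poles_swap_poles [simp]: "swap_poles (swap_poles x) = x"
  by (cases x) auto

lemma inj_swap_poles: "inj swap_poles"
  by (metis injI swap_poles_swap_poles)

lemma swap_poles_map_vert [simp]: "swap_poles (map_vert f x) = map_vert f (swap_poles x)"
  by (cases x) auto

lemma map_vert_eq_iffs [simp]:
  "map_vert f x = Pole0 \<longleftrightarrow> x = Pole0" "map_vert f x = Pole1 \<longleftrightarrow> x = Pole1"
  "swap_poles y = Pole0 \<longleftrightarrow> y = Pole1" "swap_poles y = Pole1 \<longleftrightarrow> y = Pole0"
  "join_left v y \<noteq> Pole1" "join_left v y = Pole0 \<longleftrightarrow> y = Pole0"
  "join_right v y \<noteq> Pole0" "join_right v y = Pole1 \<longleftrightarrow> y = Pole1"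
  by (cases x; cases y; simp)+

lemma inner_simps [simp]:
  "inner (relabel f N) = f ` inner N" "inner (tau N) = inner N"
  "inner (series_comp v A B) = insert v (inner A \<union> inner B)"
  by (simp_all add: relabel_def tau_def series_comp_def)

lemma edges_simps [simp]:
  "edges (relabel f N) = (`) (map_vert f) ` edges N" "edges (tau N) = (`) swap_poles ` edges N"
  "edges (series_comp v A B) = (`) (join_left v) ` edges A \<union> (`) (join_right v) ` edges B"
  by (simp_all add: relabel_def tau_def series_comp_def)

lemma joints_simps [simp]:
  "joints (relabel f N) = f ` joints N" "joints (tau N) = joints N"
  "joints (series_comp v A B) = insert v (joints A \<union> joints B)"
  by (simp_all add: relabel_def tau_def series_comp_def)

lemma network_eqI:
  "inner A = inner B \<Longrightarrow> edges A = edges B \<Longrightarrow> joints A = joints B \<Longrightarrow> A = (B :: network)"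
  by simp

lemma verts_relabel [simp]: "verts (relabel f N) = map_vert f ` verts N"
  by (simp add: verts_def image_image)

lemma verts_tau [simp]: "verts (tau N) = verts N"
  by (auto simp: verts_def)

lemma swap_poles_verts [simp]: "swap_poles ` verts N = verts N"
  by (auto simp: verts_def image_iff image_Un)

lemma finite_verts: "finite (inner N) \<Longrightarrow> finite (verts N)"
  by (simp add: verts_def)

lemma finite_edges: "wf_net N \<Longrightarrow> finite (edges N)"
  by (rule finite_subset[of _ "Pow (verts N)"]) (auto simp: wf_net_def finite_verts)

lemma inj_on_map_vert:
  assumes "inj_on f (inner N)"
  shows "inj_on (map_vert f) (verts N)"
  using assms by (auto simp: inj_on_def verts_def)

lemma tau_tau [simp]: "tau (tau N) = N"
  by (rule network_eqI) (simp_all add: image_image)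

lemma tau_relabel: "tau (relabel f N) = relabel f (tau N)"
  by (rule network_eqI) (simp_all add: image_image)

lemma relabel_relabel: "relabel g (relabel f N) = relabel (g \<circ> f) N"
proof -
  have "map_vert g (map_vert f x) = map_vert (g \<circ> f) x" for x
    by (cases x) auto
  then show ?thesis
    by (intro network_eqI) (simp_all add: image_image image_comp)
qed

lemma relabel_cong:
  assumes "wf_net N" "\<And>x. x \<in> inner N \<Longrightarrow> f x = g x"
  shows "relabel f N = relabel g N"
proof (rule network_eqI)
  have v: "map_vert f x = map_vert g x" if "x \<in> verts N" for x
    using that assms(2) by (auto simp: verts_def)
  have "map_vert f ` e = map_vert g ` e" if "e \<in> edges N" for e
    using that assms(1) v by (intro image_cong) (auto simp: wf_net_def)
  then show "edges (relabel f N) = edges (relabel g N)" by simp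
  show "inner (relabel f N) = inner (relabel g N)"
    using assms(2) by simp
  show "joints (relabel f N) = joints (relabel g N)"
    using assms by (auto simp: wf_net_def intro!: image_cong)
qed

lemma relabel_id [simp]: "relabel id N = N"
proof -
  have "map_vert id x = x" for x :: "nat vert" by (cases x) auto
  then show ?thesis by (intro network_eqI) simp_all
qed

lemma relabel_series_comp:
  "relabel f (series_comp v A B) = series_comp (f v) (relabel f A) (relabel f B)"
proof -
  have "map_vert f (join_left v x) = join_left (f v) (map_vert f x)"
    "map_vert f (join_right v x) = join_right (f v) (map_vert f x)" for x
    by (cases x; simp)+
  then show ?thesis
    by (intro network_eqI) (simp_all add: image_Un image_image)
qed

lemma tau_series_comp: "tau (series_comp v A B) = series_comp v (tau B) (tau A)"
proof -
  have "swap_poles (join_left v x) = join_right v (swap_poles x)"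
    "swap_poles (join_right v x) = join_left v (swap_poles x)" for x
    by (cases x; simp)+
  then show ?thesis
    by (intro network_eqI) (auto simp: image_Un image_image)
qed

text \<open>Edges and joints are stored without any trace of the bracketing. A triple composition
  can therefore be cut at either joint, and its reversal can be bracketed to the left again.\<close>

lemma series_comp_assoc:
  "series_comp v (series_comp u A B) C = series_comp u A (series_comp v B C)"
proof -
  have "join_left v (join_left u x) = join_left u x"
    "join_left v (join_right u x) = join_right u (join_left v x)"
    "join_right u (join_right v x) = join_right v x" for x
    by (cases x; simp)+
  then show ?thesis
    by (intro network_eqI) (auto simp: image_Un image_image)
qed

lemma inj_on_join_left: "v \<notin> inner A \<Longrightarrow> inj_on (join_left v) (verts A)"
  by (auto simp: inj_on_def verts_def)

lemma inj_on_join_right: "v \<notin> inner A \<Longrightarrow> inj_on (join_right v) (verts A)"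
  by (auto simp: inj_on_def verts_def)

lemma join_left_verts: "join_left v ` verts A = {Pole0, Inner v} \<union> Inner ` inner A"
  by (auto simp: verts_def image_Un image_image)

lemma join_right_verts: "join_right v ` verts A = {Pole1, Inner v} \<union> Inner ` inner A"
  by (auto simp: verts_def image_Un image_image)

lemma card_image_edge:
  assumes "wf_net N" "inj_on h (verts N)" "e \<in> edges N"
  shows "card (h ` e) = 2" "h ` e \<subseteq> h ` verts N"
proof -
  have e: "e \<subseteq> verts N" "card e = 2" using assms by (auto simp: wf_net_def)
  then show "card (h ` e) = 2"
    using inj_on_subset[OF assms(2) e(1)] by (simp add: card_image)
  show "h ` e \<subseteq> h ` verts N" using e by blast
qed

lemma wf_net_relabel:
  assumes "wf_net N" "inj_on f (inner N)"
  shows "wf_net (relabel f N)"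
  using assms card_image_edge[OF assms(1) inj_on_map_vert[OF assms(2)]]
  by (auto simp: wf_net_def)

lemma wf_net_tau [simp]: "wf_net (tau N) \<longleftrightarrow> wf_net N"
proof -
  have "wf_net (tau N)" if "wf_net N" for N
    using that card_image_edge[OF that inj_on_subset[OF inj_swap_poles subset_UNIV]]
    by (auto simp: wf_net_def)
  then show ?thesis by (metis tau_tau)
qed

lemma wf_net_series_comp:
  assumes "wf_net A" "wf_net B" "v \<notin> inner A" "v \<notin> inner B"
  shows "wf_net (series_comp v A B)"
proof -
  have "e \<subseteq> verts (series_comp v A B) \<and> card e = 2" if "e \<in> edges (series_comp v A B)" for e
  proof -
    from that consider e' where "e' \<in> edges A" "e = join_left v ` e'"
      | e' where "e' \<in> edges B" "e = join_right v ` e'" by auto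
    then show ?thesis
    proof cases
      case 1
      then show ?thesis
        using card_image_edge[OF assms(1) inj_on_join_left[OF assms(3)] 1(1)]
        unfolding join_left_verts by (auto simp: verts_def)
    next
      case 2
      then show ?thesis
        using card_image_edge[OF assms(2) inj_on_join_right[OF assms(4)] 2(1)]
        unfolding join_right_verts by (auto simp: verts_def)
    qed
  qed
  then show ?thesis
    using assms(1,2) by (auto simp: wf_net_def)
qed

section \<open>Linked networks\<close>

lemma linkedD1:
  assumes "linked N" "Pole0 \<in> S" "x \<in> inner N"
    "\<And>u w. {u, w} \<in> edges N \<Longrightarrow> u \<in> S \<Longrightarrow> u \<noteq> Pole1 \<Longrightarrow> w \<noteq> Pole1 \<Longrightarrow> w \<in> S"
  shows "Inner x \<in> S"
proof -
  have "Pole0 \<in> S \<and> (\<forall>u w. {u, w} \<in> edges N \<and> u \<in> S \<and> u \<noteq> Pole1 \<and> w \<noteq> Pole1 \<longrightarrow> w \<in> S)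
      \<longrightarrow> Inner ` inner N \<subseteq> S"
    using assms(1) unfolding linked_def by (elim conjE allE) assumption
  then show ?thesis using assms(2-4) by blast
qed

lemma linkedD2:
  assumes "linked N" "Pole0 \<in> S" "\<And>u w. {u, w} \<in> edges N \<Longrightarrow> u \<in> S \<Longrightarrow> w \<in> S"
  shows "Pole1 \<in> S"
proof -
  have "Pole0 \<in> S \<and> (\<forall>u w. {u, w} \<in> edges N \<and> u \<in> S \<longrightarrow> w \<in> S) \<longrightarrow> Pole1 \<in> S"
    using assms(1) unfolding linked_def by (elim conjE allE) assumption
  then show ?thesis using assms(2,3) by blast
qed

lemma linkedI:
  assumes "\<And>S x. Pole0 \<in> S \<Longrightarrow> x \<in> inner N \<Longrightarrow>
      (\<And>u w. {u, w} \<in> edges N \<Longrightarrow> u \<in> S \<Longrightarrow> u \<noteq> Pole1 \<Longrightarrow> w \<noteq> Pole1 \<Longrightarrow> w \<in> S) \<Longrightarrow> Inner x \<in> S"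
    and "\<And>S. Pole0 \<in> S \<Longrightarrow> (\<And>u w. {u, w} \<in> edges N \<Longrightarrow> u \<in> S \<Longrightarrow> w \<in> S) \<Longrightarrow> Pole1 \<in> S"
  shows "linked N"
  unfolding linked_def using assms by blast

text \<open>The preimage under \<open>map_vert f\<close> of a set closed under the new edges is
  closed under the old ones, and only the poles are sent to the poles.\<close>

lemma linked_relabel:
  assumes "linked N"
  shows "linked (relabel f N)"
proof (rule linkedI)
  fix S x assume S: "Pole0 \<in> S" "x \<in> inner (relabel f N)"
    "\<And>u w. {u, w} \<in> edges (relabel f N) \<Longrightarrow> u \<in> S \<Longrightarrow> u \<noteq> Pole1 \<Longrightarrow> w \<noteq> Pole1 \<Longrightarrow> w \<in> S"
  then obtain y where y: "y \<in> inner N" "x = f y" by auto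
  have "Inner y \<in> map_vert f -` S"
  proof (rule linkedD1[OF assms])
    fix u w assume "{u, w} \<in> edges N" "u \<in> map_vert f -` S" "u \<noteq> Pole1" "w \<noteq> Pole1"
    then show "w \<in> map_vert f -` S"
      using S(3)[of "map_vert f u" "map_vert f w"] by (force simp: image_iff)
  qed (use S y in auto)
  then show "Inner x \<in> S" using y by simp
next
  fix S assume S: "Pole0 \<in> S"
    "\<And>u w. {u, w} \<in> edges (relabel f N) \<Longrightarrow> u \<in> S \<Longrightarrow> w \<in> S"
  have "Pole1 \<in> map_vert f -` S"
  proof (rule linkedD2[OF assms])
    fix u w assume "{u, w} \<in> edges N" "u \<in> map_vert f -` S"
    then show "w \<in> map_vert f -` S"
      using S(2)[of "map_vert f u" "map_vert f w"] by (force simp: image_iff)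
  qed (use S in auto)
  then show "Pole1 \<in> S" by simp
qed

text \<open>\<open>join_left v\<close> never produces \<open>Pole1\<close>, so within the first part
  a path avoiding \<open>Pole1\<close> is unrestricted and reaches the joint as well as all inner
  vertices. From there the joint plays the part of \<open>Pole0\<close> in \<open>B\<close>.\<close>

lemma linked_series_comp:
  assumes "linked A" "linked B"
  shows "linked (series_comp v A B)"
proof -
  let ?E = "edges (series_comp v A B)"
  have EA: "{join_left v u, join_left v w} \<in> ?E" if "{u, w} \<in> edges A" for u w
  proof -
    have "join_left v ` {u, w} \<in> ?E" using that by (simp del: image_insert)
    then show ?thesis by simp
  qed
  have EB: "{join_right v u, join_right v w} \<in> ?E" if "{u, w} \<in> edges B" for u w
  proof -
    have "join_right v ` {u, w} \<in> ?E" using that by (simp del: image_insert)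
    then show ?thesis by simp
  qed
  have left: "Inner v \<in> S \<and> (\<forall>x\<in>inner A. Inner x \<in> S)"
    if S: "Pole0 \<in> S" "\<And>u w. {u, w} \<in> ?E \<Longrightarrow> u \<in> S \<Longrightarrow> u \<noteq> Pole1 \<Longrightarrow> w \<noteq> Pole1 \<Longrightarrow> w \<in> S" for S
  proof -
    have step: "w \<in> join_left v -` S" if "{u, w} \<in> edges A" "u \<in> join_left v -` S" for u w
      using S(2)[OF EA[OF that(1)]] that(2) by simp
    have "Pole1 \<in> join_left v -` S"
      by (rule linkedD2[OF assms(1)]) (use S(1) step in auto)
    moreover have "Inner x \<in> join_left v -` S" if "x \<in> inner A" for x
      by (rule linkedD1[OF assms(1)]) (use S(1) step that in auto)
    ultimately show ?thesis by auto
  qed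
  show ?thesis
  proof (rule linkedI)
    fix S x assume S: "Pole0 \<in> S" "x \<in> inner (series_comp v A B)"
      "\<And>u w. {u, w} \<in> ?E \<Longrightarrow> u \<in> S \<Longrightarrow> u \<noteq> Pole1 \<Longrightarrow> w \<noteq> Pole1 \<Longrightarrow> w \<in> S"
    note l = left[OF S(1) S(3)]
    have "Inner y \<in> join_right v -` S" if "y \<in> inner B" for y
    proof (rule linkedD1[OF assms(2)])
      show "w \<in> join_right v -` S"
        if "{u, w} \<in> edges B" "u \<in> join_right v -` S" "u \<noteq> Pole1" "w \<noteq> Pole1" for u w
        using S(3)[OF EB[OF that(1)]] that by simp
    qed (use l that in auto)
    then show "Inner x \<in> S" using l S(2) by auto
  next
    fix S assume S: "Pole0 \<in> S" "\<And>u w. {u, w} \<in> ?E \<Longrightarrow> u \<in> S \<Longrightarrow> w \<in> S"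
    have "Pole1 \<in> join_right v -` S"
    proof (rule linkedD2[OF assms(2)])
      show "w \<in> join_right v -` S" if "{u, w} \<in> edges B" "u \<in> join_right v -` S" for u w
        using S(2)[OF EB[OF that(1)]] that by simp
    qed (use left[OF S(1)] S(2) in auto)
    then show "Pole1 \<in> S" by simp
  qed
qed

lemma good_net_relabel: "good_net N \<Longrightarrow> inj_on f (inner N) \<Longrightarrow> good_net (relabel f N)"
  by (simp add: good_net_def wf_net_relabel linked_relabel tau_relabel)

lemma good_net_tau [simp]: "good_net (tau N) \<longleftrightarrow> good_net N"
  by (auto simp: good_net_def)

lemma good_net_series_comp:
  "good_net A \<Longrightarrow> good_net B \<Longrightarrow> v \<notin> inner A \<Longrightarrow> v \<notin> inner B \<Longrightarrow> good_net (series_comp v A B)"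
  by (simp add: good_net_def wf_net_series_comp linked_series_comp tau_series_comp)

lemma gconnected_closed:
  assumes "gconnected V E" "x \<in> V" "y \<in> V" "x \<in> S"
    and "\<And>u w. u \<in> V \<Longrightarrow> w \<in> V \<Longrightarrow> {u, w} \<in> E \<Longrightarrow> u \<in> S \<Longrightarrow> w \<in> S"
  shows "y \<in> S"
proof -
  have "(x, y) \<in> {(u, w). u \<in> V \<and> w \<in> V \<and> {u, w} \<in> E}\<^sup>*"
    using assms(1-3) by (simp add: gconnected_def)
  then show ?thesis
    by induction (use assms(4,5) in auto)
qed

text \<open>Deleting one pole from the network with the edge between the poles added also deletes
  that edge, so 2-connectedness yields paths in \<open>N\<close> itself that avoid this pole.
  Reaching the opposite pole uses the connectedness of \<open>N\<close>.\<close>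

lemma is_network_imp_good:
  assumes "is_network N"
  shows "good_net N"
proof -
  have wf: "wf_net N"
    unfolding wf_net_def
  proof (intro conjI ballI)
    fix e assume "e \<in> edges N"
    then obtain x y where "e = {x, y}" "x \<in> verts N" "y \<in> verts N" "x \<noteq> y"
      using assms unfolding is_network_def by blast
    then show "e \<subseteq> verts N" "card e = 2" by simp_all
  qed (use assms in \<open>auto simp: is_network_def\<close>)
  have conn: "gconnected (verts N) (edges N)"
    and two: "\<And>p. p \<in> verts N \<Longrightarrow> gconnected (verts N - {p}) (insert {Pole0, Pole1} (edges N))"
    using assms by (auto simp: is_network_def two_connected_def)
  have poles: "Pole0 \<in> verts N" "Pole1 \<in> verts N" by (auto simp: verts_def)
  have swap: "{swap_poles u, swap_poles w} \<in> (`) swap_poles ` edges N" if "{u, w} \<in> edges N" for u w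
    using imageI[OF that, of "(`) swap_poles"] by simp
  have "linked N"
  proof (rule linkedI)
    fix S x assume S: "Pole0 \<in> S" "x \<in> inner N"
      "\<And>u w. {u, w} \<in> edges N \<Longrightarrow> u \<in> S \<Longrightarrow> u \<noteq> Pole1 \<Longrightarrow> w \<noteq> Pole1 \<Longrightarrow> w \<in> S"
    show "Inner x \<in> S"
      by (rule gconnected_closed[OF two[OF poles(2)], of Pole0])
        (use S in \<open>auto simp: verts_def doubleton_eq_iff\<close>)
  next
    fix S assume S: "Pole0 \<in> S" "\<And>u w. {u, w} \<in> edges N \<Longrightarrow> u \<in> S \<Longrightarrow> w \<in> S"
    show "Pole1 \<in> S"
      by (rule gconnected_closed[OF conn poles]) (use S in auto)
  qed
  moreover have "linked (tau N)"
  proof (rule linkedI)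
    fix S x assume S: "Pole0 \<in> S" "x \<in> inner (tau N)"
      "\<And>u w. {u, w} \<in> edges (tau N) \<Longrightarrow> u \<in> S \<Longrightarrow> u \<noteq> Pole1 \<Longrightarrow> w \<noteq> Pole1 \<Longrightarrow> w \<in> S"
    have step: "w \<in> swap_poles -` S"
      if "{u, w} \<in> edges N" "u \<in> swap_poles -` S" "u \<noteq> Pole0" "w \<noteq> Pole0" for u w
      using S(3)[of "swap_poles u" "swap_poles w"] swap[OF that(1)] that by simp
    have "Inner x \<in> swap_poles -` S"
      by (rule gconnected_closed[OF two[OF poles(1)], of Pole1])
        (use S(1,2) step in \<open>auto simp: verts_def doubleton_eq_iff\<close>)
    then show "Inner x \<in> S" by simp
  next
    fix S assume S: "Pole0 \<in> S" "\<And>u w. {u, w} \<in> edges (tau N) \<Longrightarrow> u \<in> S \<Longrightarrow> w \<in> S"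
    have step: "w \<in> swap_poles -` S" if "{u, w} \<in> edges N" "u \<in> swap_poles -` S" for u w
      using S(2)[of "swap_poles u" "swap_poles w"] swap[OF that(1)] that by simp
    have "Pole0 \<in> swap_poles -` S"
      by (rule gconnected_closed[OF conn poles(2,1)]) (use S(1) step in auto)
    then show "Pole1 \<in> S" by simp
  qed
  ultimately show ?thesis using wf by (simp add: good_net_def)
qed

section \<open>Unique decomposition of a composition\<close>

definition disjoint_parts :: "nat \<Rightarrow> network \<Rightarrow> network \<Rightarrow> bool" where
  "disjoint_parts v A B \<longleftrightarrow> v \<notin> inner A \<and> v \<notin> inner B \<and> inner A \<inter> inner B = {}"

text \<open>The vertex sets of the two embedded parts meet only in the joint, and an edge has two
  ends. The ends of an edge therefore tell which part it comes from.\<close>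

lemma edges_parts:
  assumes "wf_net A" "wf_net B" "disjoint_parts v A B"
  shows "(`) (join_left v) ` edges A
    = {e \<in> edges (series_comp v A B). e \<subseteq> {Pole0, Inner v} \<union> Inner ` inner A}"
    and "(`) (join_right v) ` edges B
    = {e \<in> edges (series_comp v A B). e \<subseteq> {Pole1, Inner v} \<union> Inner ` inner B}"
    and "(`) (join_left v) ` edges A \<inter> (`) (join_right v) ` edges B = {}"
proof -
  have v: "v \<notin> inner A" "v \<notin> inner B" "inner A \<inter> inner B = {}"
    using assms(3) by (auto simp: disjoint_parts_def)
  note a = card_image_edge[OF assms(1) inj_on_join_left[OF v(1)], unfolded join_left_verts]
  note b = card_image_edge[OF assms(2) inj_on_join_right[OF v(2)], unfolded join_right_verts]
  have no: False if "card e = 2" "e \<subseteq> {Pole0, Inner v} \<union> Inner ` inner A"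
    "e \<subseteq> {Pole1, Inner v} \<union> Inner ` inner B" for e
  proof -
    have "e \<subseteq> {Inner v}" using that(2,3) v by blast
    then have "card e \<le> 1" using card_mono[of "{Inner v}" e] by simp
    then show False using that(1) by simp
  qed
  have l: "card e = 2 \<and> e \<subseteq> {Pole0, Inner v} \<union> Inner ` inner A"
    if "e \<in> (`) (join_left v) ` edges A" for e
    using that a by (elim imageE) blast
  have r: "card e = 2 \<and> e \<subseteq> {Pole1, Inner v} \<union> Inner ` inner B"
    if "e \<in> (`) (join_right v) ` edges B" for e
    using that b by (elim imageE) blast
  show "(`) (join_left v) ` edges A
    = {e \<in> edges (series_comp v A B). e \<subseteq> {Pole0, Inner v} \<union> Inner ` inner A}" (is "?L = ?R")
  proof (intro set_eqI iffI)
    fix e assume "e \<in> ?L"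
    then show "e \<in> ?R" using l by (simp only: edges_simps Un_iff mem_Collect_eq) simp
  next
    fix e assume "e \<in> ?R"
    then show "e \<in> ?L" using r no by (simp only: edges_simps Un_iff mem_Collect_eq) metis
  qed
  show "(`) (join_right v) ` edges B
    = {e \<in> edges (series_comp v A B). e \<subseteq> {Pole1, Inner v} \<union> Inner ` inner B}" (is "?L = ?R")
  proof (intro set_eqI iffI)
    fix e assume "e \<in> ?L"
    then show "e \<in> ?R" using r by (simp only: edges_simps Un_iff mem_Collect_eq) simp
  next
    fix e assume "e \<in> ?R"
    then show "e \<in> ?L" using l no by (simp only: edges_simps Un_iff mem_Collect_eq) metis
  qed
  show "(`) (join_left v) ` edges A \<inter> (`) (join_right v) ` edges B = {}"
    using l r no by (metis (no_types, lifting) disjoint_iff)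
qed

text \<open>Every inner vertex of \<open>A\<close> is reached from \<open>Pole0\<close> inside
  \<open>A\<close> without meeting the joint. In the other decomposition such a path cannot leave
  the part \<open>A'\<close>, whose only exit is the same joint.\<close>

lemma series_comp_left_inner_subset:
  assumes "good_net A" "good_net A'" "wf_net B'"
    and "disjoint_parts v A B" "disjoint_parts v A' B'"
    and eq: "series_comp v A B = series_comp v A' B'"
  shows "inner A \<subseteq> inner A'"
proof
  fix x assume x: "x \<in> inner A"
  \<comment> \<open>The \<open>Pole0\<close> side of the second decomposition with the joint
    deleted.\<close>
  define S where "S = insert Pole0 (Inner ` inner A')"
  have "Inner x \<in> S"
  proof (rule linkedD1[of A])
    fix u w assume uw: "{u, w} \<in> edges A" "u \<in> S" "u \<noteq> Pole1" "w \<noteq> Pole1"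
    have sub: "{u, w} \<subseteq> verts A" using assms(1) uw(1) by (auto simp: good_net_def wf_net_def)
    \<comment> \<open>Away from \<open>Pole1\<close> the embedding is the identity, so the edge of
      \<open>A\<close> is literally an edge of the composition.\<close>
    have "join_left v u = u" "join_left v w = w" using uw(3,4) by (cases u; cases w; simp)+
    then have "{u, w} \<in> (`) (join_left v) ` edges A"
      using imageI[OF uw(1), of "(`) (join_left v)"] by simp
    then have "{u, w} \<in> edges (series_comp v A' B')"
      using eq[symmetric] by simp
    then have "{u, w} \<subseteq> join_left v ` verts A' \<or> {u, w} \<subseteq> join_right v ` verts B'"
    proof (simp only: edges_simps Un_iff, elim disjE imageE)
      fix e assume "{u, w} = join_left v ` e" "e \<in> edges A'"
      then show ?thesis using assms(2) unfolding good_net_def wf_net_def by (metis image_mono)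
    next
      fix e assume "{u, w} = join_right v ` e" "e \<in> edges B'"
      then show ?thesis using assms(3) unfolding wf_net_def by (metis image_mono)
    qed
    moreover have "w \<noteq> Inner v" using assms(4) sub by (auto simp: disjoint_parts_def verts_def)
    ultimately show "w \<in> S"
      using uw(2) assms(5) unfolding join_left_verts join_right_verts
      by (auto simp: S_def disjoint_parts_def)
  qed (use assms(1) x in \<open>auto simp: S_def good_net_def\<close>)
  then show "x \<in> inner A'" by (auto simp: S_def)
qed

text \<open>Once the left inner vertices agree, the rest is cut out of the composition by vertex
  sets: the right part as what remains, the joints by intersection, and the edges by their
  ends.\<close>

lemma series_comp_cancel:
  assumes "good_net A" "wf_net B" "good_net A'" "wf_net B'"
    and dis: "disjoint_parts v A B" "disjoint_parts v A' B'"
    and eq: "series_comp v A B = series_comp v A' B'"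
  shows "A = A' \<and> B = B'"
proof -
  have wf: "wf_net A" "wf_net A'" using assms(1,3) by (auto simp: good_net_def)
  have A: "inner A = inner A'"
    using series_comp_left_inner_subset[OF assms(1,3,4) dis eq]
      series_comp_left_inner_subset[OF assms(3,1,2) dis(2,1) eq[symmetric]] by simp
  have "insert v (inner A \<union> inner B) = insert v (inner A' \<union> inner B')"
    using arg_cong[OF eq, of inner] by simp
  then have B: "inner B = inner B'"
    using A dis by (auto simp: disjoint_parts_def)
  have J: "insert v (joints A \<union> joints B) = insert v (joints A' \<union> joints B')"
    using arg_cong[OF eq, of joints] by simp
  have sub: "joints A \<subseteq> inner A" "joints B \<subseteq> inner B" "joints A' \<subseteq> inner A'" "joints B' \<subseteq> inner B'"
    using wf assms(2,4) by (auto simp: wf_net_def)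
  have cut: "joints A = insert v (joints A \<union> joints B) \<inter> inner A"
    "joints A' = insert v (joints A' \<union> joints B') \<inter> inner A'"
    "joints B = insert v (joints A \<union> joints B) \<inter> inner B"
    "joints B' = insert v (joints A' \<union> joints B') \<inter> inner B'"
    using sub dis by (auto simp: disjoint_parts_def)
  have jA: "joints A = joints A'" using cut(1,2) J A by metis
  have jB: "joints B = joints B'" using cut(3,4) J B by metis
  have "(`) (join_left v) ` edges A = (`) (join_left v) ` edges A'"
    unfolding edges_parts(1)[OF wf(1) assms(2) dis(1)]
      edges_parts(1)[OF wf(2) assms(4) dis(2)] eq A ..
  moreover have "edges A \<subseteq> Pow (verts A)" "edges A' \<subseteq> Pow (verts A)"
    using wf A by (auto simp: wf_net_def verts_def)
  ultimately have eA: "edges A = edges A'"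
    using inj_on_image_eq_iff[OF inj_on_image_Pow[OF inj_on_join_left], of v A "edges A" "edges A'"]
      dis by (simp add: disjoint_parts_def)
  have "(`) (join_right v) ` edges B = (`) (join_right v) ` edges B'"
    unfolding edges_parts(2)[OF wf(1) assms(2) dis(1)]
      edges_parts(2)[OF wf(2) assms(4) dis(2)] eq B ..
  moreover have "edges B \<subseteq> Pow (verts B)" "edges B' \<subseteq> Pow (verts B)"
    using assms(2,4) B by (auto simp: wf_net_def verts_def)
  ultimately have eB: "edges B = edges B'"
    using inj_on_image_eq_iff[OF inj_on_image_Pow[OF inj_on_join_right], of v B "edges B" "edges B'"]
      dis by (simp add: disjoint_parts_def)
  show ?thesis using A B jA jB eA eB by simp
qed

section \<open>Automorphisms, isomorphism classes and index series\<close>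

lemma network_eq_iff:
  "A = (B :: network) \<longleftrightarrow> inner A = inner B \<and> edges A = edges B \<and> joints A = joints B"
  by (auto intro: network_eqI)

lemma map_vert_verts:
  assumes "s permutes inner N"
  shows "bij_betw (map_vert s) (verts N) (verts N)"
proof -
  have "map_vert s ` verts N = verts N"
    using permutes_image[OF assms] by (simp add: verts_def image_image image_image[of Inner s, symmetric])
  then show ?thesis
    using inj_on_map_vert[of s N] permutes_inj_on[OF assms] by (simp add: bij_betw_def)
qed

lemma swap_map_vert_verts:
  assumes "s permutes inner N"
  shows "bij_betw (swap_poles \<circ> map_vert s) (verts N) (verts N)"
proof (rule bij_betw_trans[OF map_vert_verts[OF assms]])
  show "bij_betw swap_poles (verts N) (verts N)"
    using inj_swap_poles by (auto simp: bij_betw_def inj_on_def)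
qed

text \<open>Being an automorphism becomes an equation between networks, to which cancellation for
  compositions and the algebra of \<open>relabel\<close> apply.\<close>

lemma Aut_plus_eq: "Aut_plus N = {s. s permutes inner N \<and> relabel s N = N}"
proof (rule set_eqI)
  show "s \<in> Aut_plus N \<longleftrightarrow> s \<in> {s. s permutes inner N \<and> relabel s N = N}" for s
    using map_vert_verts[of s N] permutes_image[of s "inner N"]
    by (cases "s permutes inner N")
      (simp_all add: Aut_plus_def network_eq_iff graph_aut_def plus_ext_def)
qed

text \<open>The exchange of the poles is an involution, so it can be moved to the other side of the
  invariance of the edge set, where it is the reversal.\<close>

lemma Aut_minus_eq: "Aut_minus N = {s. s permutes inner N \<and> relabel s N = tau N}"
proof -
  have comp: "(`) (swap_poles \<circ> map_vert s) ` E = (`) swap_poles ` (`) (map_vert s) ` E"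
    for s :: "nat \<Rightarrow> nat" and E
    by (simp add: image_image image_comp)
  have inv: "(`) swap_poles ` (`) swap_poles ` E = E" for E :: "nat vert set set"
    by (simp add: image_image)
  have edges: "(`) (swap_poles \<circ> map_vert s) ` E = E \<longleftrightarrow> (`) (map_vert s) ` E = (`) swap_poles ` E"
    for s :: "nat \<Rightarrow> nat" and E
    unfolding comp using inv by metis
  show ?thesis
  proof (rule set_eqI)
    show "s \<in> Aut_minus N \<longleftrightarrow> s \<in> {s. s permutes inner N \<and> relabel s N = tau N}" for s
      using swap_map_vert_verts[of s N] permutes_image[of s "inner N"] edges[of s "edges N"]
      by (cases "s permutes inner N")
        (simp_all add: Aut_minus_def network_eq_iff graph_aut_def minus_ext_def)
  qed
qed

lemma finite_Aut:
  assumes "finite (inner N)"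
  shows "finite (Aut_plus N)" "finite (Aut_minus N)"
  using finite_permutations[OF assms]
  by (auto simp: Aut_plus_eq Aut_minus_eq intro: finite_subset[rotated])

lemma id_in_Aut_plus: "id \<in> Aut_plus N"
  by (simp add: Aut_plus_eq permutes_id)

lemma vweight_singleton: "s x = x \<Longrightarrow> vweight {x} s = {#VA 1#}"
  by (simp add: vweight_def vertex_cycles_def orbit_eq_singleton_iff[THEN iffD2])

lemma vweight_Inner:
  assumes "s permutes X" "\<And>x. x \<in> X \<Longrightarrow> g (Inner x) = Inner (s x)"
  shows "vweight (Inner ` X) g = vweight X s"
  by (rule vweight_semiconj) (use assms permutes_image[OF assms(1)] in \<open>auto simp: inj_on_def\<close>)

text \<open>The two fixed poles contribute exactly the variables that the definition subtracts. The
  form obtained is free of multiset subtraction and additive over invariant parts.\<close>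

lemma weight_plus_eq:
  assumes "finite (inner N)" "s permutes inner N"
  shows "weight_plus N s = vweight (inner N) s + eweight (edges N) (map_vert s)"
proof -
  have im: "s ` inner N = inner N" using assms(2) by (rule permutes_image)
  have "verts N = {Pole0} \<union> ({Pole1} \<union> Inner ` inner N)" by (auto simp: verts_def)
  then have "vweight (verts N) (map_vert s)
      = vweight {Pole0} (map_vert s) + (vweight {Pole1} (map_vert s) + vweight (Inner ` inner N) (map_vert s))"
    using assms(1) im
    by (subst vweight_Un[symmetric] | force)+
  then show ?thesis
    using vweight_Inner[OF assms(2), of "map_vert s"]
    by (simp add: weight_plus_def graph_weight_eq plus_ext_def vweight_singleton)
qed

lemma weight_minus_eq:
  assumes "finite (inner N)" "s permutes inner N"
  shows "weight_minus N s = vweight (inner N) s + eweight (edges N) (swap_poles \<circ> map_vert s)"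
proof -
  let ?g = "swap_poles \<circ> map_vert s"
  have im: "s ` inner N = inner N" using assms(2) by (rule permutes_image)
  have "verts N = ({Pole0} \<union> ?g ` {Pole0}) \<union> Inner ` inner N" by (auto simp: verts_def)
  then have "vweight (verts N) ?g = vweight ({Pole0} \<union> ?g ` {Pole0}) ?g + vweight (Inner ` inner N) ?g"
    using assms(1) im by (subst vweight_Un[symmetric]) force+
  \<comment> \<open>The pair of poles is a doubled cycle: \<open>Pole0\<close> is fixed by the
    square, so doubling its index gives the subtracted variable \<open>VA 2\<close>.\<close>
  moreover have "vweight ({Pole0} \<union> ?g ` {Pole0}) ?g
      = image_mset (scale_var 2) (vweight {Pole0} (?g \<circ> ?g))"
    by (rule vweight_double) auto
  moreover have "vweight {Pole0} (?g \<circ> ?g) = {#VA 1#}"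
    by (rule vweight_singleton) simp
  ultimately show ?thesis
    using vweight_Inner[OF assms(2), of ?g]
    by (simp add: weight_minus_def graph_weight_eq minus_ext_def)
qed

section \<open>Invariance under isomorphism\<close>

lemma isomorphic_refl: "isomorphic N N"
  unfolding isomorphic_def by (rule exI[of _ id]) simp

lemma isomorphic_trans:
  assumes "isomorphic A B" "isomorphic B C"
  shows "isomorphic A C"
proof -
  obtain f g where f: "inj_on f (inner A)" "B = relabel f A" and g: "inj_on g (inner B)" "C = relabel g B"
    using assms by (auto simp: isomorphic_def)
  then have "inj_on (g \<circ> f) (inner A)" "C = relabel (g \<circ> f) A"
    by (auto simp: relabel_relabel intro: comp_inj_on)
  then show ?thesis by (auto simp: isomorphic_def)
qed

text \<open>Let \<open>X\<close> be the finite inner vertex set and \<open>Z\<close> its union with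
  its image. The complements of \<open>X\<close> and of the image within \<open>Z\<close> have equal
  size and can be matched; outside \<open>Z\<close> the identity is used. A global bijection can be
  inverted and used for conjugation.\<close>

lemma isomorphic_bij:
  assumes "wf_net A" "isomorphic A B"
  obtains f where "bij f" "B = relabel f A"
proof -
  obtain f where f: "inj_on f (inner A)" "B = relabel f A"
    using assms(2) by (auto simp: isomorphic_def)
  define X Z where "X = inner A" and "Z = X \<union> f ` X"
  have fin: "finite X" "finite Z" using assms(1) by (auto simp: wf_net_def X_def Z_def)
  have "card (Z - X) = card (Z - f ` X)"
    using f(1) fin by (simp add: card_Diff_subset card_image X_def Z_def)
  then obtain g where g: "bij_betw g (Z - X) (Z - f ` X)"
    using finite_same_card_bij[of "Z - X" "Z - f ` X"] fin by auto
  define h where "h x = (if x \<in> X then f x else if x \<in> Z then g x else x)" for x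
  have "bij_betw h X (f ` X)"
    using f(1) by (subst bij_betw_cong[where g = f]) (auto simp: h_def X_def bij_betw_def)
  moreover have "bij_betw h (Z - X) (Z - f ` X)"
    using g by (subst bij_betw_cong[where g = g]) (auto simp: h_def)
  ultimately have "bij_betw h (X \<union> (Z - X)) (f ` X \<union> (Z - f ` X))"
    by (rule bij_betw_combine) auto
  moreover have "bij_betw h (- Z) (- Z)"
    by (subst bij_betw_cong[where g = id]) (auto simp: h_def Z_def)
  ultimately have "bij_betw h ((X \<union> (Z - X)) \<union> - Z) ((f ` X \<union> (Z - f ` X)) \<union> - Z)"
    by (rule bij_betw_combine) (auto simp: Z_def)
  moreover have "(X \<union> (Z - X)) \<union> - Z = UNIV" "(f ` X \<union> (Z - f ` X)) \<union> - Z = UNIV"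
    by (auto simp: Z_def)
  ultimately have "bij h" by simp
  moreover have "B = relabel h A"
    unfolding f(2) by (rule relabel_cong[OF assms(1)]) (simp add: h_def X_def)
  ultimately show ?thesis using that by blast
qed

lemma isomorphic_sym:
  assumes "wf_net A" "isomorphic A B"
  shows "isomorphic B A"
proof -
  obtain f where f: "bij f" "B = relabel f A"
    using isomorphic_bij[OF assms] .
  have "inv f \<circ> f = id" using f(1) by (simp add: bij_is_inj)
  then have "A = relabel (inv f) B" by (simp add: f(2) relabel_relabel)
  moreover have "inj_on (inv f) (inner B)"
    using f(1) bij_imp_bij_inv bij_is_inj inj_on_subset by blast
  ultimately show ?thesis by (auto simp: isomorphic_def)
qed

lemma isomorphic_tau: "isomorphic A B \<Longrightarrow> isomorphic (tau A) (tau B)"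
  by (auto simp: isomorphic_def tau_relabel)

text \<open>Taking \<open>N'\<close> to be \<open>N\<close> or \<open>tau N\<close> covers the
  automorphisms that fix the poles and those that exchange them.\<close>

lemma bij_betw_conjugate:
  assumes f: "bij f" and "inner N' = inner N"
  shows "bij_betw (\<lambda>s. f \<circ> s \<circ> inv f) {s. s permutes inner N \<and> relabel s N = N'}
    {s. s permutes inner (relabel f N) \<and> relabel s (relabel f N) = relabel f N'}"
proof -
  have ff: "inv f \<circ> f = id" "f \<circ> inv f = id"
    using f by (simp_all add: bij_is_inj bij_is_surj surj_iff[symmetric])
  have perm: "(g \<circ> s \<circ> inv g) permutes g ` X" if "bij g" "s permutes X" for g s and X :: "nat set"
  proof -
    have "bij (g \<circ> s \<circ> inv g)"
      using that by (intro bij_comp bij_imp_bij_inv permutes_bij)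
    moreover have "(g \<circ> s \<circ> inv g) x = x" if "x \<notin> g ` X" for x
    proof -
      have "inv g x \<notin> X" using that \<open>bij g\<close> by (metis bij_inv_eq_iff image_eqI)
      then show ?thesis
        using permutes_not_in[OF \<open>s permutes X\<close>] \<open>bij g\<close> by (simp add: bij_is_surj surj_f_inv_f)
    qed
    ultimately show ?thesis
      unfolding permutes_def bij_iff by blast
  qed
  show ?thesis
  proof (rule bij_betw_byWitness[where f' = "\<lambda>s. inv f \<circ> s \<circ> f"])
    show "\<forall>s\<in>{s. s permutes inner N \<and> relabel s N = N'}. inv f \<circ> (f \<circ> s \<circ> inv f) \<circ> f = s"
      using ff by (metis comp_assoc comp_id id_comp)
    show "\<forall>s\<in>{s. s permutes inner (relabel f N) \<and> relabel s (relabel f N) = relabel f N'}.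
        f \<circ> (inv f \<circ> s \<circ> f) \<circ> inv f = s"
      using ff by (metis comp_assoc comp_id id_comp)
    show "(\<lambda>s. f \<circ> s \<circ> inv f) ` {s. s permutes inner N \<and> relabel s N = N'}
        \<subseteq> {s. s permutes inner (relabel f N) \<and> relabel s (relabel f N) = relabel f N'}"
    proof clarify
      fix s assume s: "s permutes inner N" "N' = relabel s N"
      have "relabel (f \<circ> s \<circ> inv f) (relabel f N) = relabel f (relabel s N)"
        unfolding relabel_relabel comp_assoc ff by simp
      then show "(f \<circ> s \<circ> inv f) permutes inner (relabel f N) \<and>
          relabel (f \<circ> s \<circ> inv f) (relabel f N) = relabel f (relabel s N)"
        using perm[OF f s(1)] by simp
    qed
    show "(\<lambda>s. inv f \<circ> s \<circ> f) ` {s. s permutes inner (relabel f N) \<and> relabel s (relabel f N) = relabel f N'}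
        \<subseteq> {s. s permutes inner N \<and> relabel s N = N'}"
    proof clarify
      fix s assume s: "s permutes inner (relabel f N)" "relabel s (relabel f N) = relabel f N'"
      have "relabel (inv f \<circ> s \<circ> f) N = relabel (inv f) (relabel s (relabel f N))"
        by (simp add: relabel_relabel comp_assoc)
      also have "\<dots> = N'" unfolding s(2) by (simp add: relabel_relabel ff)
      finally have "relabel (inv f \<circ> s \<circ> f) N = N'" .
      moreover have "(inv f \<circ> s \<circ> inv (inv f)) permutes inv f ` f ` inner N"
        using perm[OF bij_imp_bij_inv[OF f]] s(1) by simp
      ultimately show "(inv f \<circ> s \<circ> f) permutes inner N \<and> relabel (inv f \<circ> s \<circ> f) N = N'"
        using f by (simp add: inv_inv_eq image_inv_f_f bij_is_inj)
    qed
  qed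
qed

lemma weight_conjugate:
  assumes "wf_net N" "bij f"
  shows "s \<in> Aut_plus N \<Longrightarrow> weight_plus (relabel f N) (f \<circ> s \<circ> inv f) = weight_plus N s"
    and "s \<in> Aut_minus N \<Longrightarrow> weight_minus (relabel f N) (f \<circ> s \<circ> inv f) = weight_minus N s"
proof -
  have fin: "finite (inner N)" and E: "\<And>e. e \<in> edges N \<Longrightarrow> e \<subseteq> verts N"
    using assms(1) by (auto simp: wf_net_def)
  have inj: "inj_on f X" for X using assms(2) by (auto simp: bij_def intro: inj_on_subset)
  have ff: "(f \<circ> s \<circ> inv f) (f x) = f (s x)" for s x
    using assms(2) by (simp add: bij_is_inj)
  have mv: "map_vert (f \<circ> s \<circ> inv f) (map_vert f y) = map_vert f (map_vert s y)" for s y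
    using ff by (cases y) auto
  have vw: "vweight (f ` inner N) (f \<circ> s \<circ> inv f) = vweight (inner N) s" if "s permutes inner N" for s
    by (rule vweight_semiconj) (use inj ff permutes_image[OF that] in auto)
  {
    assume s: "s \<in> Aut_plus N"
    then have s': "s permutes inner N" by (simp add: Aut_plus_eq)
    have "f \<circ> s \<circ> inv f \<in> Aut_plus (relabel f N)"
      using bij_betw_conjugate[OF assms(2) refl, of N] s
      unfolding Aut_plus_eq by (auto dest: bij_betwE)
    then have "weight_plus (relabel f N) (f \<circ> s \<circ> inv f)
        = vweight (f ` inner N) (f \<circ> s \<circ> inv f) + eweight ((`) (map_vert f) ` edges N) (map_vert (f \<circ> s \<circ> inv f))"
      using fin by (subst weight_plus_eq) (auto simp: Aut_plus_eq)
    also have "eweight ((`) (map_vert f) ` edges N) (map_vert (f \<circ> s \<circ> inv f)) = eweight (edges N) (map_vert s)"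
    proof (rule eweight_semiconj[where V = "verts N"])
      show "(`) (map_vert s) ` edges N \<subseteq> edges N"
        using s by (auto simp: Aut_plus_eq network_eq_iff)
    qed (use finite_edges assms(1) inj_on_map_vert[OF inj] E map_vert_verts[OF s'] mv
        in \<open>auto simp: bij_betw_def\<close>)
    finally show "weight_plus (relabel f N) (f \<circ> s \<circ> inv f) = weight_plus N s"
      unfolding vw[OF s'] weight_plus_eq[OF fin s'] .
  next
    assume s: "s \<in> Aut_minus N"
    then have s': "s permutes inner N" by (simp add: Aut_minus_eq)
    have "f \<circ> s \<circ> inv f \<in> Aut_minus (relabel f N)"
      using bij_betw_conjugate[OF assms(2), of "tau N" N] s
      unfolding Aut_minus_eq tau_relabel by (auto dest: bij_betwE)
    then have "weight_minus (relabel f N) (f \<circ> s \<circ> inv f)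
        = vweight (f ` inner N) (f \<circ> s \<circ> inv f) +
          eweight ((`) (map_vert f) ` edges N) (swap_poles \<circ> map_vert (f \<circ> s \<circ> inv f))"
      using fin by (subst weight_minus_eq) (auto simp: Aut_minus_eq)
    also have "eweight ((`) (map_vert f) ` edges N) (swap_poles \<circ> map_vert (f \<circ> s \<circ> inv f))
        = eweight (edges N) (swap_poles \<circ> map_vert s)"
    proof (rule eweight_semiconj[where V = "verts N"])
      show "(`) (swap_poles \<circ> map_vert s) ` edges N \<subseteq> edges N"
        using s unfolding Aut_minus_def graph_aut_def minus_ext_def by blast
    qed (use finite_edges assms(1) inj_on_map_vert[OF inj] E swap_map_vert_verts[OF s'] mv
        in \<open>auto simp: bij_betw_def\<close>)
    finally show "weight_minus (relabel f N) (f \<circ> s \<circ> inv f) = weight_minus N s"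
      unfolding vw[OF s'] weight_minus_eq[OF fin s'] .
  }
qed

lemma index_plus_avg: "index_plus N = avg (Aut_plus N) (weight_plus N)"
  by (simp add: index_plus_def avg_def)

lemma index_minus_avg: "index_minus N = avg (Aut_minus N) (weight_minus N)"
  by (simp add: index_minus_def avg_def)

lemma index_isomorphic:
  assumes "wf_net N" "isomorphic N N'"
  shows "index_plus N = index_plus N'" "index_minus N = index_minus N'"
proof -
  obtain f where f: "bij f" "N' = relabel f N"
    using isomorphic_bij[OF assms] .
  have "bij_betw (\<lambda>s. f \<circ> s \<circ> inv f) (Aut_plus N) (Aut_plus N')"
    using bij_betw_conjugate[OF f(1) refl, of N] by (simp add: Aut_plus_eq f(2))
  then show "index_plus N = index_plus N'"
    unfolding index_plus_avg
    by (rule avg_reindex) (simp add: weight_conjugate(1)[OF assms(1) f(1)] f(2))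
  have "bij_betw (\<lambda>s. f \<circ> s \<circ> inv f) (Aut_minus N) (Aut_minus N')"
    using bij_betw_conjugate[OF f(1), of "tau N" N] by (simp add: Aut_minus_eq f(2) tau_relabel)
  then show "index_minus N = index_minus N'"
    unfolding index_minus_avg
    by (rule avg_reindex) (simp add: weight_conjugate(2)[OF assms(1) f(1)] f(2))
qed

section \<open>Transversals and local finiteness\<close>

definition transversal :: "network set \<Rightarrow> network set \<Rightarrow> bool" where
  "transversal F T \<longleftrightarrow> T \<subseteq> F \<and> (\<forall>N\<in>F. \<exists>K\<in>T. isomorphic N K) \<and>
     (\<forall>K\<in>T. \<forall>L\<in>T. isomorphic K L \<longrightarrow> K = L)"

lemma transversal_exists:
  assumes "\<forall>N\<in>F. wf_net N"
  obtains T where "transversal F T"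
proof -
  \<comment> \<open>The choice depends on \<open>N\<close> only through the predicate
    \<open>isomorphic N\<close>, which is the same for isomorphic networks; they are therefore sent
    to the same member.\<close>
  define c where "c N = (SOME K. K \<in> F \<and> isomorphic N K)" for N
  have c: "c N \<in> F \<and> isomorphic N (c N)" if "N \<in> F" for N
    unfolding c_def by (rule someI[of _ N]) (simp add: that isomorphic_refl)
  have eq: "c N = c N'" if "N \<in> F" "N' \<in> F" "isomorphic N N'" for N N'
  proof -
    have "isomorphic N' N" using isomorphic_sym that assms by blast
    then have "isomorphic N = isomorphic N'"
      using that(3) isomorphic_trans by blast
    then show ?thesis by (simp add: c_def)
  qed
  have "K = L" if KL: "K \<in> c ` F" "L \<in> c ` F" "isomorphic K L" for K L
  proof -
    obtain N N' where N: "N \<in> F" "N' \<in> F" "K = c N" "L = c N'" using KL by blast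
    then have "isomorphic N L" "isomorphic L N'"
      using c KL(3) isomorphic_trans isomorphic_sym assms by blast+
    then show ?thesis using N eq isomorphic_trans by blast
  qed
  then have "transversal F (c ` F)"
    using c by (auto simp: transversal_def)
  then show ?thesis using that by blast
qed

lemma ser_sum_iso_classes:
  assumes wf: "\<forall>N\<in>F. wf_net N" and T: "transversal F T"
    and f: "\<And>N N'. wf_net N \<Longrightarrow> isomorphic N N' \<Longrightarrow> f N = f N'"
  shows "ser_sum (\<lambda>C. f (representative C)) (iso_classes F) = ser_sum f T"
proof -
  define cl where "cl N = {(N, N'). N \<in> F \<and> N' \<in> F \<and> isomorphic N N'} `` {N}" for N
  have mem: "K \<in> cl N \<longleftrightarrow> N \<in> F \<and> K \<in> F \<and> isomorphic N K" for N K by (simp add: cl_def)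
  have cl: "cl N = cl K" if "N \<in> F" "K \<in> F" "isomorphic N K" for N K
    using that wf isomorphic_sym isomorphic_trans by (intro set_eqI) (metis mem)
  have "iso_classes F = cl ` F"
    by (auto simp: iso_classes_def quotient_def cl_def)
  also have "\<dots> = cl ` T"
  proof
    show "cl ` F \<subseteq> cl ` T"
    proof
      fix C assume "C \<in> cl ` F"
      then obtain N where N: "N \<in> F" "C = cl N" by blast
      then obtain K where "K \<in> T" "isomorphic N K" "K \<in> F"
        using T unfolding transversal_def by blast
      then show "C \<in> cl ` T" using N cl by blast
    qed
    show "cl ` T \<subseteq> cl ` F" using T by (auto simp: transversal_def)
  qed
  finally have classes: "iso_classes F = cl ` T" .
  have "inj_on cl T"
  proof (rule inj_onI)
    fix K L assume KL: "K \<in> T" "L \<in> T" "cl K = cl L"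
    then have "L \<in> cl K" using T mem isomorphic_refl by (auto simp: transversal_def)
    then show "K = L" using KL(1,2) T mem unfolding transversal_def by blast
  qed
  moreover have "f (representative (cl K)) = f K" if "K \<in> T" for K
  proof -
    have K: "K \<in> F" using that T by (auto simp: transversal_def)
    then have "K \<in> cl K" using mem isomorphic_refl by blast
    then have "representative (cl K) \<in> cl K"
      unfolding representative_def by (rule someI)
    then show ?thesis using f[of K "representative (cl K)"] mem wf K by auto
  qed
  ultimately show ?thesis
    unfolding classes by (rule ser_sum_reindex)
qed

lemma W_plus_transversal:
  "\<forall>N\<in>F. wf_net N \<Longrightarrow> transversal F T \<Longrightarrow> W\<^sup>+ F = ser_sum index_plus T"
  unfolding W_plus_def by (rule ser_sum_iso_classes) (auto intro: index_isomorphic)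

lemma W_minus_transversal:
  "\<forall>N\<in>F. wf_net N \<Longrightarrow> transversal {N \<in> F. tau_symmetric N} T \<Longrightarrow> W\<^sup>- F = ser_sum index_minus T"
  unfolding W_minus_def by (rule ser_sum_iso_classes) (auto intro: index_isomorphic)

text \<open>The number of vertices encoded by a weight: a vertex cycle of length \<open>k\<close>
  accounts for \<open>k\<close> of them, and edge variables for none.\<close>

definition vertex_degree :: "monomial \<Rightarrow> nat" where
  "vertex_degree m = sum_mset (image_mset (\<lambda>x. case x of VA k \<Rightarrow> k | _ \<Rightarrow> 0) m)"

lemma card_le_vertex_degree:
  assumes "finite X" "s ` X = X"
  shows "card X \<le> vertex_degree (vweight X s + m)"
proof -
  have fin: "finite (orbit s x)" if "x \<in> X" for x
    using orbit_subset_invariant[of s X x] assms that finite_subset by blast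
  have "X \<subseteq> \<Union>(orbit s ` X)"
  proof
    fix x assume "x \<in> X"
    then obtain y where "y \<in> X" "x = s y" using assms(2) by blast
    then show "x \<in> \<Union>(orbit s ` X)" using orbit.base by fastforce
  qed
  then have "card X \<le> card (\<Union>(orbit s ` X))"
    using assms(1) fin by (intro card_mono) auto
  also have "\<dots> \<le> sum card (orbit s ` X)"
    by (rule card_Union_le_sum_card)
  also have "\<dots> = vertex_degree (vweight X s)"
    by (simp add: vertex_degree_def vweight_def vertex_cycles_def multiset.map_comp comp_def
        sum_unfold_sum_mset)
  also have "\<dots> \<le> vertex_degree (vweight X s + m)"
    by (simp add: vertex_degree_def)
  finally show ?thesis .
qed

text \<open>Each member is isomorphic to a network labelled by numbers below \<open>n\<close>, of
  which there are finitely many, and non-isomorphic members need different codes.\<close>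

lemma finite_bounded_transversal:
  assumes wf: "\<And>N. N \<in> T \<Longrightarrow> wf_net N \<and> card (inner N) \<le> n"
    and distinct: "\<And>K L. K \<in> T \<Longrightarrow> L \<in> T \<Longrightarrow> isomorphic K L \<Longrightarrow> K = L"
  shows "finite T"
proof -
  define V :: "nat vert set" where "V = {Pole0, Pole1} \<union> Inner ` {..<n}"
  define D where "D = (\<lambda>(a, b, c). network.make a b c) ` (Pow {..<n} \<times> Pow (Pow V) \<times> Pow {..<n})"
  have D: "N \<in> D" if "wf_net N" "inner N \<subseteq> {..<n}" for N
  proof -
    have "N = network.make (inner N) (edges N) (joints N)"
      by (rule network_eqI) (simp_all add: network.make_def)
    moreover have "edges N \<subseteq> Pow V" "joints N \<subseteq> {..<n}"
      using that by (fastforce simp: wf_net_def V_def verts_def)+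
    ultimately show ?thesis
      unfolding D_def using that(2) by (intro image_eqI[of _ _ "(inner N, edges N, joints N)"]) auto
  qed
  have "\<exists>K. K \<in> D \<and> isomorphic N K" if "N \<in> T" for N
  proof -
    have N: "wf_net N" "finite (inner N)" "card (inner N) \<le> n"
      using wf[OF that] by (auto simp: wf_net_def)
    obtain f where f: "bij_betw f (inner N) {0..<card (inner N)}"
      using ex_bij_betw_finite_nat[OF N(2)] by blast
    then have inj: "inj_on f (inner N)" and im: "f ` inner N = {0..<card (inner N)}"
      by (auto simp: bij_betw_def)
    have "relabel f N \<in> D"
      by (rule D[OF wf_net_relabel[OF N(1) inj]]) (use im N(3) in auto)
    then show ?thesis using inj by (auto simp: isomorphic_def)
  qed
  then obtain code where code: "\<And>N. N \<in> T \<Longrightarrow> code N \<in> D \<and> isomorphic N (code N)"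
    by metis
  have "inj_on code T"
  proof (rule inj_onI)
    fix K L assume KL: "K \<in> T" "L \<in> T" "code K = code L"
    then have "isomorphic K (code L)" "isomorphic (code L) L"
      using code[OF KL(1)] code[OF KL(2)] wf[OF KL(2)] isomorphic_sym by auto
    then show "K = L" using distinct KL isomorphic_trans by blast
  qed
  moreover have "finite (code ` T)"
  proof (rule finite_subset)
    show "code ` T \<subseteq> D" using code by auto
    show "finite D" by (simp add: D_def V_def)
  qed
  ultimately show ?thesis by (rule finite_imageD[rotated])
qed

lemma avg_nonzero:
  assumes "avg I p m \<noteq> 0"
  obtains i where "i \<in> I" "p i = m"
proof -
  have "(\<Sum>i\<in>I. monom_ser (p i) m) \<noteq> 0" using assms by (auto simp: avg_def)
  then obtain i where "i \<in> I" "monom_ser (p i) m \<noteq> 0"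
    by (rule sum.not_neutral_contains_not_neutral)
  then show ?thesis using that by (auto simp: monom_ser_def split: if_splits)
qed

text \<open>A nonzero coefficient at \<open>m\<close> comes from a permutation of weight
  \<open>m\<close>, which leaves room for at most \<open>vertex_degree m\<close> inner
  vertices.\<close>

lemma locally_finite_index:
  assumes wf: "\<forall>N\<in>F. wf_net N" and T: "transversal F T"
  shows "locally_finite index_plus T" "locally_finite index_minus T"
proof -
  have T': "wf_net N" if "N \<in> T" for N using that wf T by (auto simp: transversal_def)
  have dist: "K = L" if "K \<in> T" "L \<in> T" "isomorphic K L" for K L
    using that T by (auto simp: transversal_def)
  show "locally_finite index_plus T"
    unfolding locally_finite_def
  proof
    fix m
    show "finite {N \<in> T. index_plus N m \<noteq> 0}"
    proof (rule finite_bounded_transversal)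
      fix N assume N: "N \<in> {N \<in> T. index_plus N m \<noteq> 0}"
      then obtain s where s: "s \<in> Aut_plus N" "weight_plus N s = m"
        unfolding index_plus_avg by (auto elim: avg_nonzero)
      have fin: "finite (inner N)" and p: "s permutes inner N"
        using N T' s by (auto simp: wf_net_def Aut_plus_eq)
      show "wf_net N \<and> card (inner N) \<le> vertex_degree m"
        using N T' card_le_vertex_degree[OF fin permutes_image[OF p]] s(2) weight_plus_eq[OF fin p]
        by auto
    qed (use dist in auto)
  qed
  show "locally_finite index_minus T"
    unfolding locally_finite_def
  proof
    fix m
    show "finite {N \<in> T. index_minus N m \<noteq> 0}"
    proof (rule finite_bounded_transversal)
      fix N assume N: "N \<in> {N \<in> T. index_minus N m \<noteq> 0}"
      then obtain s where s: "s \<in> Aut_minus N" "weight_minus N s = m"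
        unfolding index_minus_avg by (auto elim: avg_nonzero)
      have fin: "finite (inner N)" and p: "s permutes inner N"
        using N T' s by (auto simp: wf_net_def Aut_minus_eq)
      show "wf_net N \<and> card (inner N) \<le> vertex_degree m"
        using N T' card_le_vertex_degree[OF fin permutes_image[OF p]] s(2) weight_minus_eq[OF fin p]
        by auto
    qed (use dist in auto)
  qed
qed

section \<open>Isomorphisms of series compositions\<close>

lemma disjoint_parts_relabel:
  assumes "disjoint_parts v A B" "inj_on f (insert v (inner A \<union> inner B))"
  shows "disjoint_parts (f v) (relabel f A) (relabel f B)"
  using assms unfolding disjoint_parts_def inj_on_def by auto

lemma disjoint_parts_tau: "disjoint_parts v (tau B) (tau A) \<longleftrightarrow> disjoint_parts v A B"
  by (auto simp: disjoint_parts_def)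

text \<open>The parts may contain joints of their own, so the set of joints does not single out the
  connecting vertex; its image \<open>f v\<close> is built into the target. Relabelling is pushed
  into the parts and cancelled.\<close>

lemma relabel_series_comp_eq:
  assumes good: "good_net A" "good_net B" "good_net A'" "good_net B'"
    and dis: "disjoint_parts v A B" "disjoint_parts (f v) A' B'"
    and inj: "inj_on f (insert v (inner A \<union> inner B))"
    and eq: "relabel f (series_comp v A B) = series_comp (f v) A' B'"
  shows "relabel f A = A' \<and> relabel f B = B'"
proof (rule series_comp_cancel)
  have "inj_on f (inner A)" "inj_on f (inner B)"
    using inj by (auto intro: inj_on_subset)
  then show "good_net (relabel f A)" "wf_net (relabel f B)"
    using good_net_relabel good by (auto simp: good_net_def)
  show "disjoint_parts (f v) (relabel f A) (relabel f B)"
    using disjoint_parts_relabel[OF dis(1) inj] .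
  show "series_comp (f v) (relabel f A) (relabel f B) = series_comp (f v) A' B'"
    using eq by (simp add: relabel_series_comp)
qed (use good dis in \<open>auto simp: good_net_def\<close>)

text \<open>When the parts have no joints, the connecting vertex is the only joint on each side and
  must be carried to its counterpart.\<close>

lemma relabel_series_comp_eq_iff:
  assumes "good_net A" "good_net B" "good_net A'" "good_net B'"
    and "disjoint_parts v A B" "disjoint_parts v' A' B'"
    and "joints A = {}" "joints B = {}" "joints A' = {}" "joints B' = {}"
    and "inj_on f (insert v (inner A \<union> inner B))"
  shows "relabel f (series_comp v A B) = series_comp v' A' B'
    \<longleftrightarrow> f v = v' \<and> relabel f A = A' \<and> relabel f B = B'"
proof
  assume eq: "relabel f (series_comp v A B) = series_comp v' A' B'"
  have v: "f v = v'"
    using arg_cong[OF eq, of joints] assms(7-10) by simp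
  then show "f v = v' \<and> relabel f A = A' \<and> relabel f B = B'"
    using relabel_series_comp_eq[of A B A' B' v f] assms eq by simp
qed (auto simp: relabel_series_comp)

text \<open>With two connecting vertices one must rule out that \<open>f\<close> exchanges them: it would then carry
  a left part containing a joint onto one that contains none.\<close>

lemma relabel_series_comp3_eq_iff:
  assumes good: "good_net A" "good_net B" "good_net C" "good_net A'" "good_net B'" "good_net C'"
    and dis: "disjoint_parts v A B" "disjoint_parts w (series_comp v A B) C"
      "disjoint_parts v' A' B'" "disjoint_parts w' (series_comp v' A' B') C'"
    and joints: "joints A = {}" "joints B = {}" "joints C = {}"
      "joints A' = {}" "joints B' = {}" "joints C' = {}"
    and inj: "inj_on f (insert w (insert v (inner A \<union> inner B) \<union> inner C))"
  shows "relabel f (series_comp w (series_comp v A B) C) = series_comp w' (series_comp v' A' B') C'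
    \<longleftrightarrow> f v = v' \<and> f w = w' \<and> relabel f A = A' \<and> relabel f B = B' \<and> relabel f C = C'"
proof
  assume eq: "relabel f (series_comp w (series_comp v A B) C) = series_comp w' (series_comp v' A' B') C'"
  have good2: "good_net (series_comp v A B)" "good_net (series_comp v' A' B')"
    "good_net (series_comp w' B' C')"
    using good dis by (auto simp: disjoint_parts_def intro!: good_net_series_comp)
  have "f w \<noteq> v'"
  proof
    assume fw: "f w = v'"
    \<comment> \<open>The target is rebracketed so that \<open>v'\<close> becomes its outer joint;
      cancellation then compares the two left parts.\<close>
    have "relabel f (series_comp v A B) = A' \<and> relabel f C = series_comp w' B' C'"
    proof (rule relabel_series_comp_eq)
      show "disjoint_parts (f w) A' (series_comp w' B' C')"
        using dis(3,4) unfolding fw by (auto simp: disjoint_parts_def)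
      show "relabel f (series_comp w (series_comp v A B) C)
          = series_comp (f w) A' (series_comp w' B' C')"
        unfolding fw eq by (rule series_comp_assoc)
    qed (use good good2 dis(2) inj in auto)
    then have "joints (relabel f (series_comp v A B)) = {}"
      using joints by simp
    then show False by simp
  qed
  moreover have "{f w, f v} = {w', v'}"
    using arg_cong[OF eq, of joints] joints by simp
  ultimately have vw: "f w = w'" "f v = v'"
    by (auto simp: doubleton_eq_iff)
  have *: "relabel f (series_comp v A B) = series_comp v' A' B' \<and> relabel f C = C'"
    by (rule relabel_series_comp_eq) (use good good2 dis(2,4) inj vw eq in auto)
  have "inj_on f (insert v (inner A \<union> inner B))"
    using inj by (rule inj_on_subset) auto
  then show "f v = v' \<and> f w = w' \<and> relabel f A = A' \<and> relabel f B = B' \<and> relabel f C = C'"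
    using relabel_series_comp_eq[of A B A' B' v f] good dis vw * by simp
qed (auto simp: relabel_series_comp)

lemma isomorphic_series_comp:
  assumes wf: "wf_net A" "wf_net B"
    and dis: "disjoint_parts v A B" "disjoint_parts v' A' B'"
    and iso: "isomorphic A A'" "isomorphic B B'"
  shows "isomorphic (series_comp v A B) (series_comp v' A' B')"
proof -
  obtain f g where f: "inj_on f (inner A)" "A' = relabel f A" and g: "inj_on g (inner B)" "B' = relabel g B"
    using iso by (auto simp: isomorphic_def)
  define h where "h x = (if x = v then v' else if x \<in> inner A then f x else g x)" for x
  have hA: "h x = f x" if "x \<in> inner A" for x
    using that dis(1) by (auto simp: h_def disjoint_parts_def)
  have hB: "h x = g x" if "x \<in> inner B" for x
    using that dis(1) by (auto simp: h_def disjoint_parts_def)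
  have hv: "h v = v'" by (simp add: h_def)
  have rel: "relabel h A = A'" "relabel h B = B'"
    using relabel_cong[OF wf(1) hA] relabel_cong[OF wf(2) hB] f g by simp_all
  have "inj_on h (inner A)" "inj_on h (inner B)"
    using f(1) g(1) hA hB by (simp_all add: inj_on_def)
  moreover have "h ` inner A = inner A'" "h ` inner B = inner B'"
    using arg_cong[OF rel(1), of inner] arg_cong[OF rel(2), of inner] by simp_all
  ultimately have "inj_on h (insert v (inner A \<union> inner B))"
    using dis hv by (auto simp: disjoint_parts_def inj_on_Un)
  then show ?thesis
    unfolding isomorphic_def
    by (intro exI[of _ h]) (simp add: relabel_series_comp rel hv)
qed

lemma perm_restrict_permutes:
  assumes "inj s" "s ` X = X"
  shows "perm_restrict s X permutes X"
proof (rule bij_imp_permutes)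
  show "bij_betw (perm_restrict s X) X X"
    using assms by (subst bij_betw_cong[where g = s])
      (auto simp: perm_restrict_simps bij_betw_def intro: inj_on_subset)
qed (simp add: perm_restrict_simps)

lemma vweight_cong:
  assumes "s permutes X" "\<And>x. x \<in> X \<Longrightarrow> t x = s x"
  shows "vweight X t = vweight X s"
  using vweight_semiconj[of id X s t] assms permutes_image[OF assms(1)] by simp

lemma edges_image_semiconj:
  assumes "\<And>e. e \<in> E \<Longrightarrow> e \<subseteq> V" "\<And>y. y \<in> V \<Longrightarrow> g (h y) = k (f y)"
  shows "(`) g ` (`) h ` E = (`) k ` (`) f ` E"
  unfolding image_image
proof (rule image_cong[OF refl])
  fix e assume "e \<in> E"
  then show "(\<lambda>x. g (h x)) ` e = (\<lambda>x. k (f x)) ` e"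
    using assms by (intro image_cong) auto
qed

lemma wf_net_edge_subset: "wf_net N \<Longrightarrow> e \<in> edges N \<Longrightarrow> e \<subseteq> verts N"
  by (auto simp: wf_net_def)

text \<open>The supports of \<open>a\<close> and \<open>b\<close> are disjoint and miss
  \<open>v\<close>, so the composite acts as \<open>a\<close> on one part, as \<open>b\<close> on
  the other, and fixes the joint. Both weights are additive over these pieces.\<close>

lemma weight_plus_series_comp:
  assumes wf: "wf_net A" "wf_net B" and dis: "disjoint_parts v A B"
    and a: "a \<in> Aut_plus A" and b: "b \<in> Aut_plus B"
  shows "weight_plus (series_comp v A B) (a \<circ> b) = {#VA 1#} + weight_plus A a + weight_plus B b"
proof -
  have v: "v \<notin> inner A" "v \<notin> inner B" "inner A \<inter> inner B = {}"
    using dis by (auto simp: disjoint_parts_def)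
  have p: "a permutes inner A" "b permutes inner B" using a b by (auto simp: Aut_plus_eq)
  have sA: "(a \<circ> b) x = a x" if "x \<in> inner A" for x
    using that v(3) permutes_not_in[OF p(2), of x] by (auto simp: disjoint_iff)
  have sB: "(a \<circ> b) x = b x" if "x \<in> inner B" for x
    using that v(3) permutes_in_image[OF p(2), of x] permutes_not_in[OF p(1), of "b x"]
    by (auto simp: disjoint_iff)
  have sv: "(a \<circ> b) v = v"
    using v permutes_not_in[OF p(2), of v] permutes_not_in[OF p(1), of v] by auto
  have fin: "finite (inner A)" "finite (inner B)" using wf by (auto simp: wf_net_def)
  have perm: "(a \<circ> b) permutes insert v (inner A \<union> inner B)"
    using p by (intro permutes_compose) (auto intro: permutes_subset)
  have im: "(a \<circ> b) ` inner A = inner A" "(a \<circ> b) ` inner B = inner B"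
    using permutes_image[OF p(1)] permutes_image[OF p(2)] sA sB by simp_all
  have "insert v (inner A \<union> inner B) = {v} \<union> (inner A \<union> inner B)" by simp
  then have "vweight (insert v (inner A \<union> inner B)) (a \<circ> b)
      = vweight {v} (a \<circ> b) + vweight (inner A \<union> inner B) (a \<circ> b)"
    using v fin sv im by (simp only:) (rule vweight_Un, auto simp del: comp_apply)
  also have "vweight (inner A \<union> inner B) (a \<circ> b) = vweight (inner A) (a \<circ> b) + vweight (inner B) (a \<circ> b)"
    using v fin im by (intro vweight_Un) (auto simp del: comp_apply)
  also have "vweight {v} (a \<circ> b) = {#VA 1#}"
    using sv by (rule vweight_singleton)
  also have "vweight (inner A) (a \<circ> b) = vweight (inner A) a"
    using p(1) sA by (rule vweight_cong)
  also have "vweight (inner B) (a \<circ> b) = vweight (inner B) b"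
    using p(2) sB by (rule vweight_cong)
  finally have V: "vweight (insert v (inner A \<union> inner B)) (a \<circ> b)
      = {#VA 1#} + (vweight (inner A) a + vweight (inner B) b)" .
  let ?g = "map_vert (a \<circ> b)"
  have gA: "?g (join_left v y) = join_left v (map_vert a y)" if "y \<in> verts A" for y
    using that sA sv by (auto simp: verts_def)
  have gB: "?g (join_right v y) = join_right v (map_vert b y)" if "y \<in> verts B" for y
    using that sB sv by (auto simp: verts_def)
  have EA: "(`) (map_vert a) ` edges A = edges A" and EB: "(`) (map_vert b) ` edges B = edges B"
    using a b by (auto simp: Aut_plus_eq network_eq_iff)
  have "eweight ((`) (join_left v) ` edges A \<union> (`) (join_right v) ` edges B) ?g
      = eweight ((`) (join_left v) ` edges A) ?g + eweight ((`) (join_right v) ` edges B) ?g"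
  proof (rule eweight_Un)
    show "(`) ?g ` (`) (join_left v) ` edges A \<subseteq> (`) (join_left v) ` edges A"
      using edges_image_semiconj[of "edges A" "verts A" ?g "join_left v" "join_left v" "map_vert a"] gA wf_net_edge_subset[OF wf(1)] EA by simp
    show "(`) ?g ` (`) (join_right v) ` edges B \<subseteq> (`) (join_right v) ` edges B"
      using edges_image_semiconj[of "edges B" "verts B" ?g "join_right v" "join_right v" "map_vert b"] gB wf_net_edge_subset[OF wf(2)] EB by simp
  qed (use edges_parts(3)[OF wf dis] finite_edges wf in auto)
  also have "eweight ((`) (join_left v) ` edges A) ?g = eweight (edges A) (map_vert a)"
    by (rule eweight_semiconj[where V = "verts A"])
      (use finite_edges wf inj_on_join_left v gA EA map_vert_verts[OF p(1)] wf_net_edge_subset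
        in \<open>auto simp: bij_betw_def\<close>)
  also have "eweight ((`) (join_right v) ` edges B) ?g = eweight (edges B) (map_vert b)"
    by (rule eweight_semiconj[where V = "verts B"])
      (use finite_edges wf inj_on_join_right v gB EB map_vert_verts[OF p(2)] wf_net_edge_subset
        in \<open>auto simp: bij_betw_def\<close>)
  finally show ?thesis
    using V fin perm p by (simp add: weight_plus_eq del: comp_apply)
qed

lemma index_plus_series_comp:
  assumes good: "good_net A" "good_net B" and dis: "disjoint_parts v A B"
    and joints: "joints A = {}" "joints B = {}"
  shows "index_plus (series_comp v A B) = avar 1 \<otimes> index_plus A \<otimes> index_plus B"
proof -
  have wf: "wf_net A" "wf_net B" and fin: "finite (inner A)" "finite (inner B)"
    using good by (auto simp: good_net_def wf_net_def)
  have v: "v \<notin> inner A" "v \<notin> inner B" "inner A \<inter> inner B = {}"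
    using dis by (auto simp: disjoint_parts_def)
  have Aut: "Aut_plus (series_comp v A B) = {s. s permutes insert v (inner A \<union> inner B) \<and>
      s v = v \<and> relabel s A = A \<and> relabel s B = B}"
    using relabel_series_comp_eq_iff[OF good good dis dis joints joints permutes_inj_on]
    unfolding Aut_plus_eq inner_simps by blast
  \<comment> \<open>The inverse restricts an automorphism to each part; \<open>perm_restrict\<close>
    is the identity elsewhere and so yields a permutation of the part.\<close>
  have bij: "bij_betw (\<lambda>(a, b). a \<circ> b) (Aut_plus A \<times> Aut_plus B) (Aut_plus (series_comp v A B))"
  proof (rule bij_betw_byWitness[where
        f' = "\<lambda>s. (perm_restrict s (inner A), perm_restrict s (inner B))"])
    have vals: "\<forall>x\<in>inner A. a (b x) = a x" "\<forall>x\<in>inner B. a (b x) = b x" "a (b v) = v"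
      if "a permutes inner A" "b permutes inner B" for a b
      using v permutes_not_in[OF that(1)] permutes_not_in[OF that(2)] permutes_in_image[OF that(2)]
      by (auto simp: disjoint_iff)
    show "\<forall>x\<in>Aut_plus A \<times> Aut_plus B. (perm_restrict ((\<lambda>(a, b). a \<circ> b) x) (inner A),
        perm_restrict ((\<lambda>(a, b). a \<circ> b) x) (inner B)) = x"
      using vals permutes_not_in by (fastforce simp: Aut_plus_eq perm_restrict_def fun_eq_iff)
    show "\<forall>s\<in>Aut_plus (series_comp v A B). (\<lambda>(a, b). a \<circ> b)
        (perm_restrict s (inner A), perm_restrict s (inner B)) = s"
    proof
      fix s assume "s \<in> Aut_plus (series_comp v A B)"
      then have s: "s permutes insert v (inner A \<union> inner B)" "s v = v" "s ` inner B = inner B"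
        by (auto simp: Aut network_eq_iff)
      have "(perm_restrict s (inner A) \<circ> perm_restrict s (inner B)) x = s x" for x
      proof (cases "x \<in> inner B")
        case True
        then have "s x \<in> inner B" using s(3) by blast
        then show ?thesis using True v by (auto simp: perm_restrict_def)
      next
        case False
        then show ?thesis
          using permutes_not_in[OF s(1), of x] s(2)
          by (cases "x = v") (auto simp: perm_restrict_def)
      qed
      then show "(\<lambda>(a, b). a \<circ> b) (perm_restrict s (inner A), perm_restrict s (inner B)) = s"
        by auto
    qed
    show "(\<lambda>(a, b). a \<circ> b) ` (Aut_plus A \<times> Aut_plus B) \<subseteq> Aut_plus (series_comp v A B)"
    proof clarify
      fix a b assume ab: "a \<in> Aut_plus A" "b \<in> Aut_plus B"
      then have p: "a permutes inner A" "b permutes inner B" by (auto simp: Aut_plus_eq)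
      have "relabel (a \<circ> b) A = relabel a A" "relabel (a \<circ> b) B = relabel b B"
        using vals[OF p] wf by (auto intro!: relabel_cong)
      moreover have "(a \<circ> b) permutes insert v (inner A \<union> inner B)"
        using p by (intro permutes_compose) (auto intro: permutes_subset)
      ultimately show "a \<circ> b \<in> Aut_plus (series_comp v A B)"
        using ab vals[OF p] unfolding Aut by (simp add: Aut_plus_eq)
    qed
    show "(\<lambda>s. (perm_restrict s (inner A), perm_restrict s (inner B))) ` Aut_plus (series_comp v A B)
        \<subseteq> Aut_plus A \<times> Aut_plus B"
    proof clarify
      fix s assume "s \<in> Aut_plus (series_comp v A B)"
      then have s: "inj s" "relabel s A = A" "relabel s B = B"
        by (auto simp: Aut permutes_inj)
      then have im: "s ` inner A = inner A" "s ` inner B = inner B"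
        by (auto simp: network_eq_iff)
      have "relabel (perm_restrict s (inner A)) A = relabel s A"
        "relabel (perm_restrict s (inner B)) B = relabel s B"
        using wf by (auto intro!: relabel_cong simp: perm_restrict_simps)
      then show "perm_restrict s (inner A) \<in> Aut_plus A \<and> perm_restrict s (inner B) \<in> Aut_plus B"
        using s perm_restrict_permutes[OF s(1) im(1)] perm_restrict_permutes[OF s(1) im(2)]
        by (simp add: Aut_plus_eq)
    qed
  qed
  have "avar 1 \<otimes> index_plus A \<otimes> index_plus B = avg (Aut_plus A \<times> Aut_plus B)
      (\<lambda>(a, b). {#VA 1#} + weight_plus A a + weight_plus B b)"
    using finite_Aut fin by (simp add: index_plus_avg monom_mult_avg avg_mult)
  also have "\<dots> = index_plus (series_comp v A B)"
    unfolding index_plus_avg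
    by (rule avg_reindex[OF bij]) (use weight_plus_series_comp[OF wf dis] in auto)
  finally show ?thesis by simp
qed

text \<open>Pattern shared by the three formulas: a family of canonical members meeting each class
  for exactly one parameter is a transversal, and a sum over it becomes a sum over the
  parameters.\<close>

lemma transversal_image:
  assumes "\<And>p. p \<in> P \<Longrightarrow> c p \<in> F" "\<And>N. N \<in> F \<Longrightarrow> \<exists>p\<in>P. isomorphic N (c p)"
    and "\<And>p q. p \<in> P \<Longrightarrow> q \<in> P \<Longrightarrow> isomorphic (c p) (c q) \<Longrightarrow> p = q"
  shows "transversal F (c ` P) \<and> inj_on c P"
proof
  show "transversal F (c ` P)" using assms by (auto simp: transversal_def)
  show "inj_on c P" using assms(3) isomorphic_refl by (metis inj_onI)
qed

text \<open>The two outer parts occupy the labels \<open>4 * x + 2\<close> and \<open>4 * x + 3\<close>, which \<open>flip\<close> exchanges;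
  0 and 1 serve as connecting vertices and \<open>4 * x + 4\<close> as labels of a middle part.\<close>

definition left_label :: "nat \<Rightarrow> nat" where "left_label x = 4 * x + 2"
definition right_label :: "nat \<Rightarrow> nat" where "right_label x = 4 * x + 3"
definition middle_label :: "nat \<Rightarrow> nat" where "middle_label x = 4 * x + 4"
definition flip :: "nat \<Rightarrow> nat" where "flip x = (if even x then x + 1 else x - 1)"

lemma inj_labels: "inj left_label" "inj right_label" "inj middle_label"
  by (auto simp: inj_def left_label_def right_label_def middle_label_def)

lemma label_neq:
  "left_label x \<noteq> right_label y" "left_label x \<noteq> middle_label y" "right_label x \<noteq> middle_label y"
  "left_label x \<noteq> 0" "right_label x \<noteq> 0" "middle_label x \<noteq> 0"
  "left_label x \<noteq> Suc 0" "right_label x \<noteq> Suc 0" "middle_label x \<noteq> Suc 0"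
  unfolding left_label_def right_label_def middle_label_def by presburger+

lemma flip_simps [simp]:
  "flip (left_label x) = right_label x" "flip (right_label x) = left_label x"
  "flip (flip y) = y" "flip 0 = Suc 0" "flip (Suc 0) = 0"
  by (auto simp: flip_def left_label_def right_label_def)

definition composite :: "network \<Rightarrow> network \<Rightarrow> network" where
  "composite K L = series_comp 0 (relabel left_label K) (relabel right_label L)"

lemma isomorphic_relabel: "inj f \<Longrightarrow> isomorphic N (relabel f N)"
  by (auto simp: isomorphic_def intro: inj_on_subset)

lemma good_net_relabel_inj: "good_net N \<Longrightarrow> inj f \<Longrightarrow> good_net (relabel f N)"
  by (rule good_net_relabel) (auto intro: inj_on_subset)

lemma index_relabel:
  assumes "good_net N" "inj f"
  shows "index_plus (relabel f N) = index_plus N" "index_minus (relabel f N) = index_minus N"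
  using index_isomorphic[OF _ isomorphic_relabel[OF assms(2)], of N] assms(1)
  by (simp_all add: good_net_def)

lemma disjoint_parts_composite:
  "disjoint_parts 0 (relabel left_label K) (relabel right_label L)"
  by (auto simp: disjoint_parts_def label_neq label_neq[symmetric])

lemma isomorphic_relabel_cancel:
  assumes "good_net K" "inj f" "inj g" "isomorphic (relabel f K) (relabel g L)" "good_net L"
  shows "isomorphic K L"
proof -
  have "isomorphic (relabel g L) L"
    using assms isomorphic_relabel isomorphic_sym by (auto simp: good_net_def)
  then show ?thesis
    using assms isomorphic_relabel isomorphic_trans by blast
qed

lemma composite_isomorphic:
  assumes "good_net A" "good_net B" "disjoint_parts v A B" "isomorphic A K" "isomorphic B L"
  shows "isomorphic (series_comp v A B) (composite K L)"
  unfolding composite_def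
proof (rule isomorphic_series_comp)
  show "isomorphic A (relabel left_label K)" "isomorphic B (relabel right_label L)"
    using assms isomorphic_relabel inj_labels isomorphic_trans by blast+
qed (use assms disjoint_parts_composite in \<open>auto simp: good_net_def\<close>)

lemma isomorphic_composite:
  assumes good: "good_net K" "good_net L" "good_net K'" "good_net L'"
    and joints: "joints K = {}" "joints L = {}" "joints K' = {}" "joints L' = {}"
    and iso: "isomorphic (composite K L) (composite K' L')"
  shows "isomorphic K K' \<and> isomorphic L L'"
proof -
  obtain f where f: "inj_on f (inner (composite K L))" "relabel f (composite K L) = composite K' L'"
    using iso by (auto simp: isomorphic_def)
  have "relabel f (relabel left_label K) = relabel left_label K'"
    "relabel f (relabel right_label L) = relabel right_label L'"
    using f(2) f(1) good joints inj_labels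
    unfolding composite_def
    by (simp_all add: relabel_series_comp_eq_iff good_net_relabel_inj disjoint_parts_composite)
  moreover have "inj_on f (inner (relabel left_label K))" "inj_on f (inner (relabel right_label L))"
    using f(1) by (auto simp: composite_def intro: inj_on_subset)
  ultimately have "isomorphic (relabel left_label K) (relabel left_label K')"
    "isomorphic (relabel right_label L) (relabel right_label L')"
    unfolding isomorphic_def by metis+
  then show ?thesis
    using isomorphic_relabel_cancel good inj_labels by blast
qed

section \<open>Species and the formula for \<open>W\<^sup>+\<close>\<close>

lemma species_good:
  assumes "network_species F" "K \<in> F"
  shows "good_net K" "joints K = {}"
  using assms is_network_imp_good by (auto simp: network_species_def)

lemma species_isomorphic: "network_species F \<Longrightarrow> K \<in> F \<Longrightarrow> isomorphic K L \<Longrightarrow> L \<in> F"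
  by (auto simp: network_species_def)

lemma composite_in_series_species:
  assumes "network_species F" "network_species G" "K \<in> F" "L \<in> G"
  shows "composite K L \<in> F \<cdot>\<^sub>s G"
proof -
  have "relabel left_label K \<in> F" "relabel right_label L \<in> G"
    using assms species_isomorphic isomorphic_relabel inj_labels by blast+
  then show ?thesis
    using disjoint_parts_composite[of K L]
    unfolding composite_def series_species_def disjoint_parts_def by blast
qed

lemma series_speciesE:
  assumes "N \<in> F \<cdot>\<^sub>s G"
  obtains v A B where "N = series_comp v A B" "A \<in> F" "B \<in> G" "disjoint_parts v A B"
  using assms by (auto simp: series_species_def disjoint_parts_def)

lemma series_species_wf:
  assumes "\<And>K. K \<in> F \<Longrightarrow> good_net K" "\<And>K. K \<in> G \<Longrightarrow> good_net K"
  shows "\<And>N. N \<in> F \<cdot>\<^sub>s G \<Longrightarrow> good_net N"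
  using assms by (auto elim!: series_speciesE simp: disjoint_parts_def intro: good_net_series_comp)

lemma index_plus_composite:
  assumes "good_net K" "good_net L" "joints K = {}" "joints L = {}"
  shows "index_plus (composite K L) = avar 1 \<otimes> index_plus K \<otimes> index_plus L"
proof -
  have "index_plus (composite K L)
      = avar 1 \<otimes> index_plus (relabel left_label K) \<otimes> index_plus (relabel right_label L)"
    unfolding composite_def
    by (rule index_plus_series_comp)
      (use assms good_net_relabel_inj inj_labels disjoint_parts_composite in auto)
  then show ?thesis
    using inj_labels assms(1,2) by (simp add: index_relabel)
qed

text \<open>Pairs of representatives parametrize the classes of compositions, and the index series
  is multiplicative on each pair; local finiteness splits the sum over pairs into a product of
  sums.\<close>

lemma W_plus_series:
  assumes F: "network_species F" and G: "network_species G"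
  shows "W\<^sup>+ (F \<cdot>\<^sub>s G) = avar 1 \<otimes> W\<^sup>+ F \<otimes> W\<^sup>+ G"
proof -
  note gF = species_good[OF F] and gG = species_good[OF G]
  have wfF: "\<forall>N\<in>F. wf_net N" and wfG: "\<forall>N\<in>G. wf_net N" and wfFG: "\<forall>N\<in>F \<cdot>\<^sub>s G. wf_net N"
    using gF gG series_species_wf[of F G] by (auto simp: good_net_def)
  obtain S where S: "transversal F S" using transversal_exists[OF wfF] .
  obtain T where T: "transversal G T" using transversal_exists[OF wfG] .
  have sub: "S \<subseteq> F" "T \<subseteq> G" using S T by (auto simp: transversal_def)
  let ?c = "\<lambda>(K, L). composite K L"
  have "transversal (F \<cdot>\<^sub>s G) (?c ` (S \<times> T)) \<and> inj_on ?c (S \<times> T)"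
  proof (rule transversal_image)
    show "?c p \<in> F \<cdot>\<^sub>s G" if "p \<in> S \<times> T" for p
      using that sub composite_in_series_species[OF F G] by auto
    show "\<exists>p\<in>S \<times> T. isomorphic N (?c p)" if "N \<in> F \<cdot>\<^sub>s G" for N
    proof -
      obtain v A B where N: "N = series_comp v A B" "A \<in> F" "B \<in> G" "disjoint_parts v A B"
        using \<open>N \<in> F \<cdot>\<^sub>s G\<close> by (rule series_speciesE)
      obtain K L where KL: "K \<in> S" "isomorphic A K" "L \<in> T" "isomorphic B L"
        using S T N unfolding transversal_def by blast
      then have "isomorphic N (composite K L)"
        using composite_isomorphic N gF gG by blast
      then show ?thesis using KL by auto
    qed
    show "p = q" if pq: "p \<in> S \<times> T" "q \<in> S \<times> T" "isomorphic (?c p) (?c q)" for p q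
    proof -
      obtain K L K' L' where p: "p = (K, L)" "q = (K', L')" by (cases p; cases q)
      have "isomorphic K K' \<and> isomorphic L L'"
        by (rule isomorphic_composite) (use pq p sub gF gG in auto)
      then show ?thesis using p pq S T by (auto simp: transversal_def)
    qed
  qed
  then have inj: "inj_on ?c (S \<times> T)" and "W\<^sup>+ (F \<cdot>\<^sub>s G) = ser_sum index_plus (?c ` (S \<times> T))"
    using W_plus_transversal[OF wfFG] by auto
  note this(2)
  also have "ser_sum index_plus (?c ` (S \<times> T))
      = ser_sum (\<lambda>(K, L). avar 1 \<otimes> index_plus K \<otimes> index_plus L) (S \<times> T)"
    by (rule ser_sum_reindex[OF inj]) (use index_plus_composite sub gF gG in \<open>auto simp: subset_iff\<close>)
  also have "\<dots> = ser_sum (\<lambda>K. avar 1 \<otimes> index_plus K) S \<otimes> ser_sum index_plus T"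
    using locally_finite_index(1)[OF wfF S] locally_finite_index(1)[OF wfG T]
    by (intro ser_sum_mult locally_finite_mult)
  also have "\<dots> = avar 1 \<otimes> W\<^sup>+ F \<otimes> W\<^sup>+ G"
    using locally_finite_index(1)[OF wfF S] W_plus_transversal[OF wfF S] W_plus_transversal[OF wfG T]
    by (simp add: ser_sum_mult_left)
  finally show ?thesis .
qed

section \<open>Mirror-symmetric compositions\<close>

text \<open>One description of the pole-exchanging automorphisms for two and for three parts.
  \<open>R\<close> is what lies between the outer parts, either the joint alone or the middle part
  with both joints, and \<open>Q\<close> lists the permitted actions on it.\<close>

definition mirror_perms :: "network \<Rightarrow> network \<Rightarrow> nat set \<Rightarrow> (nat \<Rightarrow> nat) set \<Rightarrow> (nat \<Rightarrow> nat) set" where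
  "mirror_perms A C R Q = {s. s permutes (inner A \<union> inner C \<union> R) \<and>
     relabel s A = tau C \<and> relabel s C = tau A \<and> perm_restrict s R \<in> Q}"

lemma mirror_perms_image:
  assumes "s \<in> mirror_perms A C R Q" "R \<inter> (inner A \<union> inner C) = {}"
  shows "inj s" "s ` inner A = inner C" "s ` inner C = inner A" "s ` R = R"
proof -
  have s: "s permutes (inner A \<union> inner C \<union> R)" "relabel s A = tau C" "relabel s C = tau A"
    using assms(1) by (auto simp: mirror_perms_def)
  show inj: "inj s" using s(1) by (rule permutes_inj)
  show im: "s ` inner A = inner C" "s ` inner C = inner A"
    using arg_cong[OF s(2), of inner] arg_cong[OF s(3), of inner] by simp_all
  have "R = (inner A \<union> inner C \<union> R) - (inner A \<union> inner C)" using assms(2) by auto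
  then have "s ` R = s ` (inner A \<union> inner C \<union> R) - s ` (inner A \<union> inner C)"
    using image_set_diff[OF inj] by metis
  also have "\<dots> = R"
    unfolding permutes_image[OF s(1)] using im assms(2) by (auto simp: image_Un)
  finally show "s ` R = R" .
qed

text \<open>An element \<open>s\<close> of \<open>mirror_perms\<close> is determined by \<open>\<psi> \<circ> s\<close> on the left part, by its square \<open>\<rho>\<close>
  there, and by its restriction to \<open>R\<close>; only the last two affect the weight.\<close>

lemma avg_mirror_perms:
  assumes wf: "wf_net A" and \<psi>: "\<And>x. \<psi> (\<psi> x) = x" and C: "C = tau (relabel \<psi> A)"
    and dis: "inner A \<inter> inner C = {}" "R \<inter> (inner A \<union> inner C) = {}"
    and Q: "\<And>q. q \<in> Q \<Longrightarrow> q permutes R"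
    and w: "\<And>s. s \<in> mirror_perms A C R Q \<Longrightarrow>
      w s = g (perm_restrict (s \<circ> s) (inner A)) (perm_restrict s R)"
  shows "avg (mirror_perms A C R Q) w = avg (Aut_plus A \<times> Q) (\<lambda>(\<rho>, q). g \<rho> q)"
proof -
  let ?X = "inner A" and ?Y = "inner C"
  have Y: "?Y = \<psi> ` ?X" by (simp add: C)
  have \<psi>Y: "\<psi> y \<in> ?X" if "y \<in> ?Y" for y using that \<psi> by (auto simp: Y)
  have \<psi>X: "\<psi> x \<in> ?Y" if "x \<in> ?X" for x using that by (auto simp: Y)
  have inj\<psi>: "inj \<psi>" using \<psi> by (metis injI)
  have \<psi>\<psi>: "\<psi> \<circ> \<psi> = id" using \<psi> by (simp add: fun_eq_iff)
  have tauC: "tau C = relabel \<psi> A" by (simp add: C)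
  have relC: "relabel \<psi> C = tau A" by (simp add: C tau_relabel[symmetric] relabel_relabel \<psi>\<psi>)
  have wfC: "wf_net C" using wf_net_relabel[OF wf, of \<psi>] inj\<psi> by (auto simp: C intro: inj_on_subset)
  \<comment> \<open>\<open>\<psi>\<close> may move labels outside the outer parts, such as
    connecting vertices; only its action on the outer parts is kept.\<close>
  define \<phi> where "\<phi> = perm_restrict \<psi> (?X \<union> ?Y)"
  have \<phi>: "\<phi> permutes (?X \<union> ?Y)"
    unfolding \<phi>_def by (rule perm_restrict_permutes[OF inj\<psi>]) (auto simp: Y image_Un image_image \<psi>)
  \<comment> \<open>Going to the right part by \<open>\<psi> \<circ> a\<close> and back by
    \<open>\<rho> \<circ> inv a \<circ> \<psi>\<close> makes the square on the left part equal to
    \<open>\<rho>\<close>, whatever \<open>a\<close> is. Each factor fixes everything outside its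
    own domain, so a single composite realizes all three prescribed actions.\<close>
  define G :: "(nat \<Rightarrow> nat) \<times> (nat \<Rightarrow> nat) \<times> (nat \<Rightarrow> nat) \<Rightarrow> nat \<Rightarrow> nat" where "G = (\<lambda>(a, \<rho>, q). \<rho> \<circ> inv a \<circ> \<phi> \<circ> a \<circ> q)"
  define J where "J s = (perm_restrict (\<psi> \<circ> s) ?X, perm_restrict (s \<circ> s) ?X, perm_restrict s R)" for s
  have G: "G (a, \<rho>, q) permutes (?X \<union> ?Y \<union> R)
      \<and> (\<forall>x\<in>?X. G (a, \<rho>, q) x = \<psi> (a x)) \<and> (\<forall>x\<in>?Y. G (a, \<rho>, q) x = \<rho> (inv a (\<psi> x)))
      \<and> (\<forall>x\<in>R. G (a, \<rho>, q) x = q x)"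
    if "a permutes ?X" "\<rho> permutes ?X" "q permutes R" for a \<rho> q
  proof -
    have ia: "inv a permutes ?X" using that(1) by (rule permutes_inv)
    have "G (a, \<rho>, q) permutes (?X \<union> ?Y \<union> R)"
      unfolding G_def using that ia \<phi>
      by (auto intro!: permutes_compose intro: permutes_subset)
    moreover have "G (a, \<rho>, q) x = \<psi> (a x)" if x: "x \<in> ?X" for x
    proof -
      have "a x \<in> ?X" using x permutes_in_image[OF \<open>a permutes ?X\<close>] by blast
      then have "\<psi> (a x) \<in> ?Y" "\<psi> (a x) \<notin> ?X" using \<psi>X dis(1) by blast+
      moreover have "q x = x" using x dis(2) permutes_not_in[OF \<open>q permutes R\<close>, of x] by blast
      ultimately show ?thesis
        using \<open>a x \<in> ?X\<close> permutes_not_in[OF ia] permutes_not_in[OF \<open>\<rho> permutes ?X\<close>]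
        by (simp add: G_def \<phi>_def perm_restrict_def)
    qed
    moreover have "G (a, \<rho>, q) x = \<rho> (inv a (\<psi> x))" if x: "x \<in> ?Y" for x
    proof -
      have "q x = x" "a x = x"
        using x dis permutes_not_in[OF \<open>q permutes R\<close>, of x] permutes_not_in[OF \<open>a permutes ?X\<close>, of x]
        by blast+
      then show ?thesis using x by (simp add: G_def \<phi>_def perm_restrict_def)
    qed
    moreover have "G (a, \<rho>, q) x = q x" if x: "x \<in> R" for x
    proof -
      have "q x \<in> R" using x permutes_in_image[OF \<open>q permutes R\<close>] by blast
      then have "q x \<notin> ?X" "q x \<notin> ?Y" using dis(2) by blast+
      then show ?thesis
        using permutes_not_in[OF ia] permutes_not_in[OF \<open>\<rho> permutes ?X\<close>]
          permutes_not_in[OF \<open>a permutes ?X\<close>]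
        by (simp add: G_def \<phi>_def perm_restrict_def)
    qed
    ultimately show ?thesis by blast
  qed
  have "bij_betw J (mirror_perms A C R Q) (Aut_plus A \<times> (Aut_plus A \<times> Q))"
  proof (rule bij_betw_byWitness[where f' = G])
    have J: "J s \<in> Aut_plus A \<times> (Aut_plus A \<times> Q)" if s: "s \<in> mirror_perms A C R Q" for s
    proof -
      note im = mirror_perms_image[OF s dis(2)]
      have rel: "relabel s A = tau C" "relabel s C = tau A" "perm_restrict s R \<in> Q"
        using s by (auto simp: mirror_perms_def)
      have "(\<psi> \<circ> s) ` ?X = ?X"
        unfolding image_comp[symmetric] im(2) by (simp add: Y image_image \<psi>)
      then have a: "perm_restrict (\<psi> \<circ> s) ?X permutes ?X"
        using im(1) inj\<psi> by (intro perm_restrict_permutes inj_compose)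
      have "(s \<circ> s) ` ?X = ?X"
        unfolding image_comp[symmetric] im(2,3) ..
      then have \<rho>: "perm_restrict (s \<circ> s) ?X permutes ?X"
        using im(1) by (intro perm_restrict_permutes inj_compose)
      have "relabel (perm_restrict (\<psi> \<circ> s) ?X) A = relabel (\<psi> \<circ> s) A"
        by (rule relabel_cong[OF wf]) (simp add: perm_restrict_simps)
      also have "\<dots> = A"
        by (simp add: relabel_relabel[symmetric] rel tauC) (simp add: relabel_relabel \<psi>\<psi>)
      finally have a': "relabel (perm_restrict (\<psi> \<circ> s) ?X) A = A" .
      have "relabel (perm_restrict (s \<circ> s) ?X) A = relabel (s \<circ> s) A"
        by (rule relabel_cong[OF wf]) (simp add: perm_restrict_simps)
      also have "\<dots> = A"
        by (simp add: relabel_relabel[symmetric] rel tau_relabel[symmetric])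
      finally have \<rho>': "relabel (perm_restrict (s \<circ> s) ?X) A = A" .
      show ?thesis using a \<rho> a' \<rho>' rel(3) by (simp add: J_def Aut_plus_eq)
    qed
    then show "J ` mirror_perms A C R Q \<subseteq> Aut_plus A \<times> (Aut_plus A \<times> Q)" by blast
    show "\<forall>s\<in>mirror_perms A C R Q. G (J s) = s"
    proof
      fix s assume s: "s \<in> mirror_perms A C R Q"
      note im = mirror_perms_image[OF s dis(2)]
      have sp: "s permutes (?X \<union> ?Y \<union> R)" using s by (simp add: mirror_perms_def)
      define a where "a = perm_restrict (\<psi> \<circ> s) ?X"
      have p: "a permutes ?X" "perm_restrict (s \<circ> s) ?X permutes ?X" "perm_restrict s R permutes R"
        using J[OF s] Q by (auto simp: J_def Aut_plus_eq a_def)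
      have JG: "J s = (a, perm_restrict (s \<circ> s) ?X, perm_restrict s R)"
        by (simp add: J_def a_def)
      have GJ: "G (J s) permutes (?X \<union> ?Y \<union> R)" "\<And>x. x \<in> ?X \<Longrightarrow> G (J s) x = \<psi> (a x)"
        "\<And>x. x \<in> ?Y \<Longrightarrow> G (J s) x = perm_restrict (s \<circ> s) ?X (inv a (\<psi> x))"
        "\<And>x. x \<in> R \<Longrightarrow> G (J s) x = perm_restrict s R x"
        unfolding JG using G[OF p] by blast+
      show "G (J s) = s"
      proof
        fix x
        consider "x \<in> ?X" | "x \<in> ?Y" | "x \<in> R" | "x \<notin> ?X \<union> ?Y \<union> R" by blast
        then show "G (J s) x = s x"
        proof cases
          case 1
          then show ?thesis by (simp add: GJ(2) a_def perm_restrict_simps \<psi>)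
        next
          case 2
          then have "x \<in> s ` ?X" by (simp only: im(2))
          then obtain y where y: "y \<in> ?X" "s y = x" by (metis imageE)
          then have "a y = \<psi> x" by (simp add: a_def perm_restrict_simps)
          then have "inv a (\<psi> x) = y"
            using permutes_inverses(2)[OF p(1), of y] by simp
          then show ?thesis using 2 y by (simp add: GJ(3) perm_restrict_simps)
        next
          case 3
          then show ?thesis by (simp add: GJ(4) perm_restrict_simps)
        next
          case 4
          then show ?thesis using permutes_not_in[OF sp] permutes_not_in[OF GJ(1)] by simp
        qed
      qed
    qed
    have GT: "G (a, \<rho>, q) \<in> mirror_perms A C R Q \<and> J (G (a, \<rho>, q)) = (a, \<rho>, q)"
      if t: "a \<in> Aut_plus A" "\<rho> \<in> Aut_plus A" "q \<in> Q" for a \<rho> q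
    proof -
      have p: "a permutes ?X" "\<rho> permutes ?X" "q permutes R"
        and rel: "relabel a A = A" "relabel \<rho> A = A"
        using t Q by (auto simp: Aut_plus_eq)
      let ?s = "G (a, \<rho>, q)"
      have Gs: "?s permutes (?X \<union> ?Y \<union> R)" "\<And>x. x \<in> ?X \<Longrightarrow> ?s x = \<psi> (a x)"
        "\<And>x. x \<in> ?Y \<Longrightarrow> ?s x = \<rho> (inv a (\<psi> x))" "\<And>x. x \<in> R \<Longrightarrow> ?s x = q x"
        using G[OF p] by blast+
      have ia: "relabel (inv a) A = A"
      proof -
        have "relabel (inv a) A = relabel (inv a) (relabel a A)" by (simp add: rel)
        also have "\<dots> = A" using permutes_inv_o(2)[OF p(1)] by (simp add: relabel_relabel)
        finally show ?thesis .
      qed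
      have "relabel ?s A = relabel (\<psi> \<circ> a) A"
        by (rule relabel_cong[OF wf]) (simp add: Gs)
      also have "\<dots> = tau C" by (simp add: relabel_relabel[symmetric] rel tauC)
      finally have 1: "relabel ?s A = tau C" .
      have "relabel ?s C = relabel (\<rho> \<circ> (inv a \<circ> \<psi>)) C"
        by (rule relabel_cong[OF wfC]) (simp add: Gs)
      also have "\<dots> = tau A"
        by (simp add: relabel_relabel[symmetric] relC tau_relabel[symmetric] ia rel)
      finally have 2: "relabel ?s C = tau A" .
      have 3: "perm_restrict ?s R = q"
        using Gs(4) permutes_not_in[OF p(3)] by (auto simp: perm_restrict_def fun_eq_iff)
      have 4: "perm_restrict (\<psi> \<circ> ?s) ?X = a"
        using Gs(2) permutes_not_in[OF p(1)] by (auto simp: perm_restrict_def fun_eq_iff \<psi>)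
      have "?s (?s x) = \<rho> x" if "x \<in> ?X" for x
      proof -
        have "\<psi> (a x) \<in> ?Y" using that permutes_in_image[OF p(1)] \<psi>X by blast
        then show ?thesis
          using Gs(2)[OF that] Gs(3) permutes_inverses(2)[OF p(1)] by (simp add: \<psi>)
      qed
      then have 5: "perm_restrict (?s \<circ> ?s) ?X = \<rho>"
        using permutes_not_in[OF p(2)] by (auto simp: perm_restrict_def fun_eq_iff)
      show ?thesis
        using Gs(1) 1 2 3 4 5 t(3) by (simp add: mirror_perms_def J_def)
    qed
    then show "\<forall>t\<in>Aut_plus A \<times> (Aut_plus A \<times> Q). J (G t) = t"
      "G ` (Aut_plus A \<times> (Aut_plus A \<times> Q)) \<subseteq> mirror_perms A C R Q"
      by auto
  qed
  then have "avg (mirror_perms A C R Q) w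
      = avg (Aut_plus A \<times> (Aut_plus A \<times> Q)) (\<lambda>(a, t). case t of (\<rho>, q) \<Rightarrow> g \<rho> q)"
    by (rule avg_reindex) (simp add: w J_def)
  also have "\<dots> = avg (Aut_plus A \<times> Q) (\<lambda>(\<rho>, q). g \<rho> q)"
    using finite_Aut(1)[of A] id_in_Aut_plus[of A] wf by (intro avg_snd) (auto simp: wf_net_def)
  finally show ?thesis .
qed

text \<open>One application takes \<open>A\<close> to the reversal of \<open>C\<close>, and the next
  takes this to \<open>A\<close> reversed twice.\<close>

lemma mirror_square_in_Aut_plus:
  assumes "wf_net A" "s \<in> mirror_perms A C R Q" "R \<inter> (inner A \<union> inner C) = {}"
  shows "perm_restrict (s \<circ> s) (inner A) \<in> Aut_plus A"
proof -
  note im = mirror_perms_image[OF assms(2,3)]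
  have "(s \<circ> s) ` inner A = inner A"
    unfolding image_comp[symmetric] im(2,3) ..
  then have "perm_restrict (s \<circ> s) (inner A) permutes inner A"
    using im(1) by (intro perm_restrict_permutes inj_compose)
  moreover have "relabel (perm_restrict (s \<circ> s) (inner A)) A = relabel (s \<circ> s) A"
    by (rule relabel_cong[OF assms(1)]) (simp add: perm_restrict_simps)
  moreover have "relabel (s \<circ> s) A = A"
    using assms(2) by (simp add: mirror_perms_def relabel_relabel[symmetric] tau_relabel[symmetric])
  ultimately show ?thesis by (simp add: Aut_plus_eq)
qed

lemma vweight_mirror:
  assumes "wf_net A" "s \<in> mirror_perms A C R Q" "inner A \<inter> inner C = {}" "R \<inter> (inner A \<union> inner C) = {}"
  shows "vweight (inner A \<union> inner C) s
    = image_mset (scale_var 2) (vweight (inner A) (perm_restrict (s \<circ> s) (inner A)))"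
proof -
  note im = mirror_perms_image[OF assms(2,4)]
  have "vweight (inner A \<union> s ` inner A) s = image_mset (scale_var 2) (vweight (inner A) (s \<circ> s))"
  proof (rule vweight_double)
    show "(s \<circ> s) ` inner A = inner A" unfolding image_comp[symmetric] im(2,3) ..
  qed (use assms im(1,2) in \<open>auto simp: wf_net_def intro: inj_on_subset\<close>)
  moreover have "vweight (inner A) (s \<circ> s) = vweight (inner A) (perm_restrict (s \<circ> s) (inner A))"
    using mirror_square_in_Aut_plus[OF assms(1,2,4)]
    by (intro vweight_cong) (auto simp: Aut_plus_eq perm_restrict_simps)
  ultimately show ?thesis by (simp add: im(2))
qed

text \<open>\<open>v\<close> and \<open>w\<close> are the joints to which the outer parts are
  attached; they coincide when there are only two parts. Exchanging the poles and applying
  \<open>s\<close> turns the left embedding at \<open>v\<close> into the right embedding at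
  \<open>w\<close>, so the embedded edge sets of \<open>A\<close> and \<open>C\<close> are two
  exchanged halves.\<close>

lemma eweight_mirror:
  assumes wf: "wf_net A" "wf_net C" and s: "s \<in> mirror_perms A C R Q"
    and dis: "R \<inter> (inner A \<union> inner C) = {}" and v: "v \<in> R" "w \<in> R" "s v = w" "s w = v"
    and disE: "(`) (join_left v) ` edges A \<inter> (`) (join_right w) ` edges C = {}"
  shows "eweight ((`) (join_left v) ` edges A \<union> (`) (join_right w) ` edges C) (swap_poles \<circ> map_vert s)
    = image_mset (scale_var 2) (eweight (edges A) (map_vert (perm_restrict (s \<circ> s) (inner A))))"
    and "(`) (swap_poles \<circ> map_vert s) ` ((`) (join_left v) ` edges A \<union> (`) (join_right w) ` edges C)
      = (`) (join_left v) ` edges A \<union> (`) (join_right w) ` edges C"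
proof -
  let ?g = "swap_poles \<circ> map_vert s" and ?E = "(`) (join_left v) ` edges A"
  let ?\<rho> = "perm_restrict (s \<circ> s) (inner A)"
  note im = mirror_perms_image[OF s dis]
  have gl: "?g (join_left v y) = join_right w (swap_poles (map_vert s y))" for y
    using v by (cases y) auto
  have gr: "?g (join_right w y) = join_left v (swap_poles (map_vert s y))" for y
    using v by (cases y) auto
  have rel: "relabel s A = tau C" "relabel s C = tau A" using s by (auto simp: mirror_perms_def)
  have EC: "(`) (swap_poles \<circ> map_vert s) ` edges A = edges C"
    using arg_cong[OF arg_cong[OF rel(1), of tau], of edges]
    by (simp add: image_image image_comp)
  have EA: "(`) (swap_poles \<circ> map_vert s) ` edges C = edges A"
    using arg_cong[OF arg_cong[OF rel(2), of tau], of edges]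
    by (simp add: image_image image_comp)
  have gE: "(`) ?g ` ?E = (`) (join_right w) ` edges C"
    unfolding EC[symmetric] by (rule edges_image_semiconj[where V = UNIV]) (use gl in auto)
  have gE': "(`) ?g ` (`) (join_right w) ` edges C = ?E"
    unfolding EA[symmetric] by (rule edges_image_semiconj[where V = UNIV]) (use gr in auto)
  show "(`) ?g ` (?E \<union> (`) (join_right w) ` edges C) = ?E \<union> (`) (join_right w) ` edges C"
    unfolding image_Un gE gE' by blast
  have \<rho>: "?\<rho> \<in> Aut_plus A"
    by (rule mirror_square_in_Aut_plus[OF wf(1) s dis])
  then have \<rho>E: "(`) (map_vert ?\<rho>) ` edges A = edges A" and \<rho>p: "?\<rho> permutes inner A"
    by (auto simp: Aut_plus_eq network_eq_iff)
  have "inj ?g"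
    using im(1) by (intro inj_compose inj_swap_poles vert.inj_map)
  then have "eweight (?E \<union> (`) ?g ` ?E) ?g = image_mset (scale_var 2) (eweight ?E (?g \<circ> ?g))"
  proof (rule eweight_double[rotated])
    have "(`) (?g \<circ> ?g) ` ?E = (`) ?g ` (`) ?g ` ?E"
      by (simp add: image_image image_comp)
    then show "(`) (?g \<circ> ?g) ` ?E = ?E" unfolding gE gE' .
    show "?E \<inter> (`) ?g ` ?E = {}" unfolding gE by (rule disE)
  qed (use finite_edges[OF wf(1)] in auto)
  also have "eweight ?E (?g \<circ> ?g) = eweight (edges A) (map_vert ?\<rho>)"
  proof (rule eweight_semiconj[where V = "verts A"])
    show "inj_on (join_left v) (verts A)"
      using dis v(1) by (intro inj_on_join_left) auto
    show "(?g \<circ> ?g) (join_left v y) = join_left v (map_vert ?\<rho> y)" if "y \<in> verts A" for y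
      using that v by (auto simp: verts_def perm_restrict_simps)
  qed (use finite_edges[OF wf(1)] wf_net_edge_subset[OF wf(1)] \<rho>E map_vert_verts[OF \<rho>p]
      in \<open>auto simp: bij_betw_def\<close>)
  finally show "eweight (?E \<union> (`) (join_right w) ` edges C) ?g
      = image_mset (scale_var 2) (eweight (edges A) (map_vert ?\<rho>))"
    unfolding gE .
qed

section \<open>Pole-exchanging automorphisms of two and three parts\<close>

lemma Aut_minus_mirror_pair:
  assumes good: "good_net A" "good_net C" and dis: "disjoint_parts v A C"
    and joints: "joints A = {}" "joints C = {}"
  shows "Aut_minus (series_comp v A C) = mirror_perms A C {v} {id :: nat \<Rightarrow> nat}"
proof -
  \<comment> \<open>On the one-point set \<open>{v}\<close> the permitted action \<open>id\<close>
    expresses that the joint is fixed.\<close>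
  have v: "perm_restrict s {v} \<in> {id} \<longleftrightarrow> s v = v" for s
    by (auto simp: perm_restrict_def fun_eq_iff)
  have "relabel s (series_comp v A C) = tau (series_comp v A C)
      \<longleftrightarrow> s v = v \<and> relabel s A = tau C \<and> relabel s C = tau A"
    if "s permutes insert v (inner A \<union> inner C)" for s
    unfolding tau_series_comp
    by (rule relabel_series_comp_eq_iff)
      (use good dis joints in \<open>simp_all add: disjoint_parts_tau permutes_inj_on[OF that] del: inj_on_insert\<close>)
  moreover have "inner A \<union> inner C \<union> {v} = insert v (inner A \<union> inner C)" by auto
  ultimately show ?thesis
    unfolding Aut_minus_eq mirror_perms_def inner_simps v by metis
qed

text \<open>The right part is a reversed copy of the left one along an involution, so the same map
  identifies the parts in both directions. The joint is a fixed point and gives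
  \<open>avar 1\<close>; the mirrored parts give doubled indices.\<close>

lemma index_minus_mirror_pair:
  assumes good: "good_net A" and \<psi>: "\<And>x. \<psi> (\<psi> x) = x" and C: "C = tau (relabel \<psi> A)"
    and dis: "disjoint_parts v A C" and joints: "joints A = {}"
  shows "index_minus (series_comp v A C) = avar 1 \<otimes> pleth 2 (index_plus A)"
proof -
  have inj\<psi>: "inj \<psi>" using \<psi> by (metis injI)
  have goodC: "good_net C" unfolding C good_net_tau using good inj\<psi> by (rule good_net_relabel_inj)
  have wf: "wf_net A" "wf_net C" and fin: "finite (inner A)" "finite (inner C)"
    using good goodC by (auto simp: good_net_def wf_net_def)
  have jC: "joints C = {}" using joints by (simp add: C)
  have d: "inner A \<inter> inner C = {}" "{v} \<inter> (inner A \<union> inner C) = {}"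
    using dis by (auto simp: disjoint_parts_def)
  note Aut = Aut_minus_mirror_pair[OF good goodC dis joints jC]
  have w: "weight_minus (series_comp v A C) s = {#VA 1#} +
      image_mset (scale_var 2) (weight_plus A (perm_restrict (s \<circ> s) (inner A)))"
    if s: "s \<in> mirror_perms A C {v} {id :: nat \<Rightarrow> nat}" for s
  proof -
    note im = mirror_perms_image[OF s d(2)]
    have sv: "s v = v" using im(4) by simp
    have sp: "s permutes inner (series_comp v A C)" using s Aut by (auto simp: Aut_minus_eq)
    have "vweight ({v} \<union> (inner A \<union> inner C)) s = vweight {v} s + vweight (inner A \<union> inner C) s"
      by (rule vweight_Un) (use d fin sv im in auto)
    then have V: "vweight (inner (series_comp v A C)) s = {#VA 1#} +
        image_mset (scale_var 2) (vweight (inner A) (perm_restrict (s \<circ> s) (inner A)))"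
      using vweight_mirror[OF wf(1) s d] vweight_singleton[of s v, OF sv] by simp
    have E: "eweight (edges (series_comp v A C)) (swap_poles \<circ> map_vert s)
        = image_mset (scale_var 2) (eweight (edges A) (map_vert (perm_restrict (s \<circ> s) (inner A))))"
      unfolding edges_simps
      by (rule eweight_mirror(1)[OF wf s d(2)]) (use sv edges_parts(3)[OF wf dis] in auto)
    have "perm_restrict (s \<circ> s) (inner A) permutes inner A"
      using mirror_square_in_Aut_plus[OF wf(1) s d(2)] by (simp add: Aut_plus_eq)
    then have P: "weight_plus A (perm_restrict (s \<circ> s) (inner A))
        = vweight (inner A) (perm_restrict (s \<circ> s) (inner A))
          + eweight (edges A) (map_vert (perm_restrict (s \<circ> s) (inner A)))"
      by (rule weight_plus_eq[OF fin(1)])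
    have "weight_minus (series_comp v A C) s = vweight (inner (series_comp v A C)) s
        + eweight (edges (series_comp v A C)) (swap_poles \<circ> map_vert s)"
      by (rule weight_minus_eq[OF _ sp]) (use fin in simp)
    then show ?thesis
      unfolding V E P by simp
  qed
  have "index_minus (series_comp v A C) = avg (Aut_plus A \<times> {id :: nat \<Rightarrow> nat})
      (\<lambda>(\<rho>, _). {#VA 1#} + image_mset (scale_var 2) (weight_plus A \<rho>))"
    unfolding index_minus_avg Aut
  proof (rule avg_mirror_perms[where \<psi> = \<psi> and
        g = "\<lambda>\<rho> _. {#VA 1#} + image_mset (scale_var 2) (weight_plus A \<rho>)"])
    show "weight_minus (series_comp v A C) s = {#VA 1#} +
        image_mset (scale_var 2) (weight_plus A (perm_restrict (s \<circ> s) (inner A)))"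
      if "s \<in> mirror_perms A C {v} {id :: nat \<Rightarrow> nat}" for s
      using that by (rule w)
  qed (use wf \<psi> C d in \<open>auto simp: permutes_id\<close>)
  also have "\<dots> = avg (Aut_plus A) (\<lambda>\<rho>. {#VA 1#} + image_mset (scale_var 2) (weight_plus A \<rho>))"
    by (rule avg_reindex[where h = fst]) (auto simp: bij_betw_def inj_on_def)
  also have "\<dots> = avar 1 \<otimes> pleth 2 (index_plus A)"
    by (simp add: index_plus_avg pleth_avg monom_mult_avg finite_Aut fin)
  finally show ?thesis .
qed

definition middle_perms :: "nat \<Rightarrow> nat \<Rightarrow> network \<Rightarrow> (nat \<Rightarrow> nat) set" where
  "middle_perms v w B = {q. q permutes insert v (insert w (inner B)) \<and>
     q v = w \<and> q w = v \<and> relabel q B = tau B}"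

lemma Aut_minus_mirror_triple:
  assumes good: "good_net A" "good_net B" "good_net C"
    and dis: "disjoint_parts v A B" "disjoint_parts w (series_comp v A B) C"
    and joints: "joints A = {}" "joints B = {}" "joints C = {}"
  shows "Aut_minus (series_comp w (series_comp v A B) C)
    = mirror_perms A C (insert v (insert w (inner B))) (middle_perms v w B)"
proof (rule set_eqI)
  fix s
  let ?R = "insert v (insert w (inner B))"
  have d: "?R \<inter> (inner A \<union> inner C) = {}"
    using dis by (auto simp: disjoint_parts_def)
  \<comment> \<open>Reversal brackets to the right; reassociation restores the shape needed for
    cancellation, with the two joints in exchanged order.\<close>
  have tau: "tau (series_comp w (series_comp v A B) C)
      = series_comp v (series_comp w (tau C) (tau B)) (tau A)"
    by (simp add: tau_series_comp series_comp_assoc)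
  have U: "inner (series_comp w (series_comp v A B) C) = inner A \<union> inner C \<union> ?R" by auto
  have rel: "relabel s (series_comp w (series_comp v A B) C) = tau (series_comp w (series_comp v A B) C)
      \<longleftrightarrow> s v = w \<and> s w = v \<and> relabel s A = tau C \<and> relabel s B = tau B \<and> relabel s C = tau A"
    if "s permutes inner A \<union> inner C \<union> ?R"
    unfolding tau
  proof (rule relabel_series_comp3_eq_iff)
    show "inj_on s (insert w (insert v (inner A \<union> inner B) \<union> inner C))"
      using that by (rule permutes_inj_on)
    show "disjoint_parts w (tau C) (tau B)" "disjoint_parts v (series_comp w (tau C) (tau B)) (tau A)"
      using dis by (auto simp: disjoint_parts_def)
  qed (use good dis joints in auto)
  \<comment> \<open>\<open>UNIV\<close> drops the condition on the middle block, so the equivalence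
    is available before that condition is known.\<close>
  have restr: "perm_restrict s ?R \<in> middle_perms v w B \<longleftrightarrow> s v = w \<and> s w = v \<and> relabel s B = tau B"
    if "s \<in> mirror_perms A C ?R UNIV"
  proof -
    have "perm_restrict s ?R permutes ?R"
      using mirror_perms_image[OF that d] by (intro perm_restrict_permutes)
    moreover have "relabel (perm_restrict s ?R) B = relabel s B"
      using good(2) by (intro relabel_cong) (auto simp: good_net_def perm_restrict_simps)
    ultimately show ?thesis by (simp add: middle_perms_def perm_restrict_simps)
  qed
  show "s \<in> Aut_minus (series_comp w (series_comp v A B) C) \<longleftrightarrow>
      s \<in> mirror_perms A C ?R (middle_perms v w B)"
    using rel restr unfolding Aut_minus_eq mirror_perms_def U mem_Collect_eq by blast
qed

text \<open>On the joints \<open>q\<close> is forced to agree with \<open>transpose v w\<close>, so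
  all freedom lies in its restriction to \<open>B\<close>.\<close>

lemma bij_betw_middle_perms:
  assumes wf: "wf_net B" and v: "v \<notin> inner B" "w \<notin> inner B"
  shows "bij_betw (\<lambda>q. perm_restrict q (inner B)) (middle_perms v w B) (Aut_minus B)"
proof (rule bij_betw_byWitness[where f' = "\<lambda>b. b \<circ> transpose v w"])
  have rel: "relabel (perm_restrict q (inner B)) B = relabel q B" for q
    by (rule relabel_cong[OF wf]) (simp add: perm_restrict_simps)
  show "\<forall>q\<in>middle_perms v w B. perm_restrict q (inner B) \<circ> transpose v w = q"
  proof
    fix q assume q: "q \<in> middle_perms v w B"
    show "perm_restrict q (inner B) \<circ> transpose v w = q"
    proof
      fix x
      show "(perm_restrict q (inner B) \<circ> transpose v w) x = q x"
        using q v permutes_not_in[of q "insert v (insert w (inner B))" x]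
        by (cases "x = v"; cases "x = w"; cases "x \<in> inner B")
          (auto simp: middle_perms_def perm_restrict_def)
    qed
  qed
  show "\<forall>b\<in>Aut_minus B. perm_restrict (b \<circ> transpose v w) (inner B) = b"
  proof
    fix b assume "b \<in> Aut_minus B"
    then have "b permutes inner B" by (simp add: Aut_minus_eq)
    then show "perm_restrict (b \<circ> transpose v w) (inner B) = b"
      using v permutes_not_in[of b "inner B"]
      by (auto simp: perm_restrict_def fun_eq_iff transpose_def)
  qed
  show "(\<lambda>q. perm_restrict q (inner B)) ` middle_perms v w B \<subseteq> Aut_minus B"
  proof clarify
    fix q assume "q \<in> middle_perms v w B"
    then have q: "inj q" "relabel q B = tau B" by (auto simp: middle_perms_def permutes_inj)
    have "q ` inner B = inner B" using arg_cong[OF q(2), of inner] by simp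
    then show "perm_restrict q (inner B) \<in> Aut_minus B"
      using q perm_restrict_permutes rel by (simp add: Aut_minus_eq)
  qed
  show "(\<lambda>b. b \<circ> transpose v w) ` Aut_minus B \<subseteq> middle_perms v w B"
  proof clarify
    fix b assume "b \<in> Aut_minus B"
    then have b: "b permutes inner B" "relabel b B = tau B" by (auto simp: Aut_minus_eq)
    have "relabel (b \<circ> transpose v w) B = relabel b B"
      by (rule relabel_cong[OF wf]) (use v in \<open>auto simp: transpose_def\<close>)
    moreover have "(b \<circ> transpose v w) permutes insert v (insert w (inner B))"
      using b(1) by (intro permutes_compose permutes_swap_id) (auto intro: permutes_subset)
    ultimately show "b \<circ> transpose v w \<in> middle_perms v w B"
      using b v permutes_not_in[OF b(1)] by (simp add: middle_perms_def)
  qed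
qed

lemma index_minus_mirror_triple:
  assumes good: "good_net A" "good_net B" and \<psi>: "\<And>x. \<psi> (\<psi> x) = x" and C: "C = tau (relabel \<psi> A)"
    and dis: "disjoint_parts v A B" "disjoint_parts w (series_comp v A B) C"
    and joints: "joints A = {}" "joints B = {}"
  shows "index_minus (series_comp w (series_comp v A B) C)
    = avar 2 \<otimes> pleth 2 (index_plus A) \<otimes> index_minus B"
proof -
  let ?N = "series_comp w (series_comp v A B) C" and ?R = "insert v (insert w (inner B))"
  let ?Q = "middle_perms v w B"
  have inj\<psi>: "inj \<psi>" using \<psi> by (metis injI)
  have goodC: "good_net C" unfolding C good_net_tau using good(1) inj\<psi> by (rule good_net_relabel_inj)
  have wf: "wf_net A" "wf_net B" "wf_net C"
    and fin: "finite (inner A)" "finite (inner B)" "finite (inner C)"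
    using good goodC by (auto simp: good_net_def wf_net_def)
  have jC: "joints C = {}" using joints by (simp add: C)
  have d: "inner A \<inter> inner C = {}" "?R \<inter> (inner A \<union> inner C) = {}"
    and vw: "v \<noteq> w" "v \<notin> inner B" "w \<notin> inner B"
    using dis by (auto simp: disjoint_parts_def)
  have disB: "disjoint_parts w B C" "disjoint_parts v A (series_comp w B C)"
    using dis by (auto simp: disjoint_parts_def)
  note Aut = Aut_minus_mirror_triple[OF good goodC dis joints jC]
  have w: "weight_minus ?N s = {#VA 2#} +
      image_mset (scale_var 2) (weight_plus A (perm_restrict (s \<circ> s) (inner A))) +
      weight_minus B (perm_restrict (perm_restrict s ?R) (inner B))"
    if s: "s \<in> mirror_perms A C ?R ?Q" for s
  proof -
    define \<rho> where "\<rho> = perm_restrict (s \<circ> s) (inner A)"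
    define \<beta> where "\<beta> = perm_restrict s (inner B)"
    have \<beta>': "perm_restrict (perm_restrict s ?R) (inner B) = \<beta>"
      by (auto simp: \<beta>_def perm_restrict_def fun_eq_iff)
    have q: "perm_restrict s ?R \<in> ?Q" using s by (simp add: mirror_perms_def)
    have sv: "s v = w" "s w = v" using q by (auto simp: middle_perms_def perm_restrict_simps)
    have sN: "s \<in> Aut_minus ?N" using s Aut by blast
    then have sp: "s permutes inner ?N" by (auto simp: Aut_minus_eq)
    have \<beta>: "\<beta> \<in> Aut_minus B"
      using bij_betw_middle_perms[OF wf(2) vw(2,3)] q unfolding \<beta>'[symmetric] by (auto dest: bij_betwE)
    have \<beta>p: "\<beta> permutes inner B" using \<beta> by (simp add: Aut_minus_eq)
    have s\<beta>: "s x = \<beta> x" if "x \<in> inner B" for x using that by (simp add: \<beta>_def perm_restrict_simps)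
    have sB: "s ` inner B = inner B" using permutes_image[OF \<beta>p] s\<beta> by simp
    note im = mirror_perms_image[OF s d(2)]
    \<comment> \<open>The two joints form a single cycle of length 2, obtained by doubling the point
      \<open>v\<close>; this is the source of the factor \<open>avar 2\<close>.\<close>
    have "vweight ({v} \<union> s ` {v}) s = image_mset (scale_var 2) (vweight {v} (s \<circ> s))"
      by (rule vweight_double) (use sv vw in auto)
    then have "vweight {v, w} s = {#VA 2#}"
      using sv by (simp add: vweight_singleton insert_commute)
    moreover have "vweight (inner B) s = vweight (inner B) \<beta>"
      using \<beta>p s\<beta> by (rule vweight_cong)
    moreover have "vweight ({v, w} \<union> inner B) s = vweight {v, w} s + vweight (inner B) s"
      by (rule vweight_Un) (use fin vw sv sB in auto)
    moreover have "vweight ({v, w} \<union> inner B \<union> (inner A \<union> inner C)) s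
        = vweight ({v, w} \<union> inner B) s + vweight (inner A \<union> inner C) s"
      by (rule vweight_Un) (use fin d im sv sB in auto)
    moreover have "inner ?N = {v, w} \<union> inner B \<union> (inner A \<union> inner C)" by auto
    ultimately have V: "vweight (inner ?N) s
        = {#VA 2#} + vweight (inner B) \<beta> + image_mset (scale_var 2) (vweight (inner A) \<rho>)"
      using vweight_mirror[OF wf(1) s d] by (simp only: \<rho>_def)
    \<comment> \<open>\<open>?h\<close> embeds the middle part, sending \<open>Pole0\<close> to the
      joint \<open>v\<close> and \<open>Pole1\<close> to the joint \<open>w\<close>.\<close>
    let ?g = "swap_poles \<circ> map_vert s" and ?h = "\<lambda>y. join_left w (join_right v y)"
    let ?EA = "(`) (join_left v) ` edges A" and ?EB = "(`) ?h ` edges B"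
    let ?EC = "(`) (join_right w) ` edges C"
    have jj: "join_left w (join_left v y) = join_left v y"
      "join_right v (join_left w y) = join_left w (join_right v y)"
      "join_right v (join_right w y) = join_right w y" for y by (cases y; simp)+
    \<comment> \<open>The outer edge sets are grouped together because the automorphism exchanges
      them, while the middle edges are invariant by themselves.\<close>
    have EN: "edges ?N = (?EA \<union> ?EC) \<union> ?EB"
      by (auto simp: image_Un image_image jj)
    \<comment> \<open>Pairwise disjointness of the three edge sets comes from cutting the
      composition at \<open>w\<close> and, with the other bracketing, at \<open>v\<close>.\<close>
    have "?EA \<union> ?EB = (`) (join_left w) ` edges (series_comp v A B)"
      by (simp add: image_Un image_image jj)
    then have dC: "(?EA \<union> ?EB) \<inter> ?EC = {}"
      using edges_parts(3)[OF wf_net_series_comp wf(3) dis(2)] wf dis(1)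
      by (simp add: disjoint_parts_def)
    have "?EB \<union> ?EC = (`) (join_right v) ` edges (series_comp w B C)"
      by (simp add: image_Un image_image jj)
    then have dA: "?EA \<inter> (?EB \<union> ?EC) = {}"
      using edges_parts(3)[OF wf(1) wf_net_series_comp disB(2)] wf disB(1)
      by (simp add: disjoint_parts_def)
    have dAC: "?EA \<inter> ?EC = {}" using dC by (simp only: Int_Un_distrib2 Un_empty)
    note mirror = eweight_mirror[OF wf(1,3) s d(2) insertI1 insertI2[OF insertI1] sv dAC]
    have gh: "?g (?h y) = ?h ((swap_poles \<circ> map_vert \<beta>) y)" if "y \<in> verts B" for y
      using that sv s\<beta> by (auto simp: verts_def)
    have E\<beta>: "(`) (swap_poles \<circ> map_vert \<beta>) ` edges B = edges B"
      using \<beta> unfolding Aut_minus_def graph_aut_def minus_ext_def by blast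
    have injh: "inj_on ?h (verts B)"
      using vw by (auto simp: inj_on_def verts_def)
    have "eweight (edges ?N) ?g = eweight (?EA \<union> ?EC) ?g + eweight ?EB ?g"
      unfolding EN
    proof (rule eweight_Un)
      show "(`) ?g ` (?EA \<union> ?EC) \<subseteq> ?EA \<union> ?EC"
        using mirror(2) by (rule equalityD1)
      have "(`) ?g ` ?EB = (`) ?h ` (`) (swap_poles \<circ> map_vert \<beta>) ` edges B"
        by (rule edges_image_semiconj[where V = "verts B"]) (use gh wf_net_edge_subset[OF wf(2)] in auto)
      then show "(`) ?g ` ?EB \<subseteq> ?EB" unfolding E\<beta> by simp
      show "(?EA \<union> ?EC) \<inter> ?EB = {}"
        using dA dC by (simp only: Int_Un_distrib Int_Un_distrib2 Un_empty Int_commute[of ?EC ?EB])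
    qed (use finite_edges wf in auto)
    also have "eweight (?EA \<union> ?EC) ?g = image_mset (scale_var 2) (eweight (edges A) (map_vert \<rho>))"
      unfolding \<rho>_def by (rule mirror(1))
    also have "eweight ?EB ?g = eweight (edges B) (swap_poles \<circ> map_vert \<beta>)"
    proof (rule eweight_semiconj[where V = "verts B"])
      show "?g (?h y) = ?h ((swap_poles \<circ> map_vert \<beta>) y)" if "y \<in> verts B" for y
        using that by (rule gh)
      show "(swap_poles \<circ> map_vert \<beta>) ` verts B \<subseteq> verts B"
        using swap_map_vert_verts[OF \<beta>p] by (simp add: bij_betw_def)
    qed (use finite_edges[OF wf(2)] wf_net_edge_subset[OF wf(2)] E\<beta> injh in auto)
    finally have E: "eweight (edges ?N) ?g = image_mset (scale_var 2) (eweight (edges A) (map_vert \<rho>))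
        + eweight (edges B) (swap_poles \<circ> map_vert \<beta>)" .
    have "\<rho> permutes inner A"
      using mirror_square_in_Aut_plus[OF wf(1) s d(2)] by (simp add: Aut_plus_eq \<rho>_def)
    then have P: "weight_plus A \<rho> = vweight (inner A) \<rho> + eweight (edges A) (map_vert \<rho>)"
      by (rule weight_plus_eq[OF fin(1)])
    have "weight_minus ?N s = vweight (inner ?N) s + eweight (edges ?N) ?g"
      by (rule weight_minus_eq[OF _ sp]) (use fin in simp)
    then show ?thesis
      unfolding V E \<beta>' weight_minus_eq[OF fin(2) \<beta>p] \<rho>_def[symmetric] P
      by (simp add: add_ac)
  qed
  have "index_minus ?N = avg (Aut_plus A \<times> ?Q) (\<lambda>(\<rho>, q). {#VA 2#} +
      image_mset (scale_var 2) (weight_plus A \<rho>) + weight_minus B (perm_restrict q (inner B)))"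
    unfolding index_minus_avg Aut
  proof (rule avg_mirror_perms[where \<psi> = \<psi> and g = "\<lambda>\<rho> q. {#VA 2#} +
      image_mset (scale_var 2) (weight_plus A \<rho>) + weight_minus B (perm_restrict q (inner B))"])
    show "weight_minus ?N s = {#VA 2#} +
        image_mset (scale_var 2) (weight_plus A (perm_restrict (s \<circ> s) (inner A))) +
        weight_minus B (perm_restrict (perm_restrict s ?R) (inner B))"
      if "s \<in> mirror_perms A C ?R ?Q" for s
      using that by (rule w)
    show "q permutes ?R" if "q \<in> ?Q" for q using that by (simp add: middle_perms_def)
  qed (use wf \<psi> C d in auto)
  also have "\<dots> = avg (Aut_plus A \<times> Aut_minus B)
      (\<lambda>(\<rho>, b). {#VA 2#} + image_mset (scale_var 2) (weight_plus A \<rho>) + weight_minus B b)"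
    by (rule avg_reindex[where h = "map_prod id (\<lambda>q. perm_restrict q (inner B))"])
      (use bij_betw_middle_perms[OF wf(2) vw(2,3)] in \<open>auto intro!: bij_betw_map_prod\<close>)
  also have "\<dots> = avar 2 \<otimes> pleth 2 (index_plus A) \<otimes> index_minus B"
    by (simp add: index_plus_avg index_minus_avg pleth_avg monom_mult_avg avg_mult finite_Aut fin)
  finally show ?thesis .
qed

section \<open>The formulas for \<open>W\<^sup>-\<close>\<close>

lemma composite_tau_mirror: "relabel right_label (tau K) = tau (relabel flip (relabel left_label K))"
proof -
  have "flip \<circ> left_label = right_label" by (simp add: fun_eq_iff)
  then show ?thesis by (simp add: relabel_relabel tau_relabel)
qed

lemma index_minus_composite_tau:
  assumes "good_net K" "joints K = {}"
  shows "index_minus (composite K (tau K)) = avar 1 \<otimes> pleth 2 (index_plus K)"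
proof -
  have "index_minus (composite K (tau K)) = avar 1 \<otimes> pleth 2 (index_plus (relabel left_label K))"
    unfolding composite_def
  proof (rule index_minus_mirror_pair[where \<psi> = flip])
    show "relabel right_label (tau K) = tau (relabel flip (relabel left_label K))"
      by (rule composite_tau_mirror)
    show "disjoint_parts 0 (relabel left_label K) (relabel right_label (tau K))"
      by (rule disjoint_parts_composite)
  qed (use assms good_net_relabel_inj inj_labels in auto)
  then show ?thesis
    using index_relabel(1)[OF assms(1) inj_labels(1)] by simp
qed

text \<open>A symmetry of a composition identifies its right part with the reversal of its left
  part, so a symmetric class is determined by the class of the left part. Closure under
  \<open>tau\<close> makes every class of \<open>F\<close> occur.\<close>

lemma W_minus_series_self:
  assumes F: "network_species F" and tauF: "tau_closed F"
  shows "W\<^sup>- (F \<cdot>\<^sub>s F) = avar 1 \<otimes> pleth 2 (W\<^sup>+ F)"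
proof -
  note gF = species_good[OF F]
  have wfF: "\<forall>N\<in>F. wf_net N" and wfFF: "\<forall>N\<in>F \<cdot>\<^sub>s F. wf_net N"
    using gF series_species_wf[of F F] by (auto simp: good_net_def)
  obtain S where S: "transversal F S" using transversal_exists[OF wfF] .
  have sub: "S \<subseteq> F" using S by (auto simp: transversal_def)
  let ?c = "\<lambda>K. composite K (tau K)"
  have "transversal {N \<in> F \<cdot>\<^sub>s F. tau_symmetric N} (?c ` S) \<and> inj_on ?c S"
  proof (rule transversal_image)
    fix K assume "K \<in> S"
    then have K: "K \<in> F" "tau K \<in> F" using sub tauF by (auto simp: tau_closed_def)
    \<comment> \<open>Reversal puts the right labels on the left part and conversely, so the
      canonical composite returns only up to isomorphism.\<close>
    have "tau (?c K) = series_comp 0 (relabel right_label K) (relabel left_label (tau K))"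
      by (simp add: composite_def tau_series_comp tau_relabel)
    moreover have "isomorphic \<dots> (?c K)"
    proof (rule composite_isomorphic)
      show "disjoint_parts 0 (relabel right_label K) (relabel left_label (tau K))"
        using disjoint_parts_composite[of "tau K" K] by (auto simp: disjoint_parts_def)
      show "isomorphic (relabel right_label K) K" "isomorphic (relabel left_label (tau K)) (tau K)"
        using wfF K isomorphic_sym isomorphic_relabel inj_labels by blast+
    qed (use gF K good_net_relabel_inj inj_labels in auto)
    ultimately show "?c K \<in> {N \<in> F \<cdot>\<^sub>s F. tau_symmetric N}"
      using composite_in_series_species[OF F F K] by (simp add: tau_symmetric_def)
  next
    fix N assume "N \<in> {N \<in> F \<cdot>\<^sub>s F. tau_symmetric N}"
    then obtain v A B where N: "N = series_comp v A B" "A \<in> F" "B \<in> F" "disjoint_parts v A B"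
      and sym: "tau_symmetric N" by (auto elim: series_speciesE)
    obtain f where f: "inj_on f (inner (tau N))" "N = relabel f (tau N)"
      using sym by (auto simp: tau_symmetric_def isomorphic_def)
    have "relabel f (series_comp v (tau B) (tau A)) = series_comp v A B
        \<longleftrightarrow> f v = v \<and> relabel f (tau B) = A \<and> relabel f (tau A) = B"
      by (rule relabel_series_comp_eq_iff)
        (use N gF f(1) in \<open>auto simp: disjoint_parts_tau Un_commute simp del: inj_on_insert\<close>)
    then have "relabel f (tau A) = B" using f(2) N(1) by (simp add: tau_series_comp)
    moreover have "inj_on f (inner (tau A))" using f(1) by (rule inj_on_subset) (auto simp: N)
    ultimately have "isomorphic (tau A) B" by (auto simp: isomorphic_def)
    then have BA: "isomorphic B (tau A)" using wfF N isomorphic_sym by (metis wf_net_tau)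
    obtain K where K: "K \<in> S" "isomorphic A K" using S N unfolding transversal_def by blast
    have "isomorphic B (tau K)" using BA isomorphic_tau[OF K(2)] isomorphic_trans by blast
    then have "isomorphic N (?c K)"
      unfolding N(1) using composite_isomorphic N gF K by blast
    then show "\<exists>K\<in>S. isomorphic N (?c K)" using K by blast
  next
    fix K L assume KL: "K \<in> S" "L \<in> S" "isomorphic (?c K) (?c L)"
    have "isomorphic K L \<and> isomorphic (tau K) (tau L)"
      by (rule isomorphic_composite) (use KL sub gF in \<open>auto simp: subset_iff\<close>)
    then show "K = L" using KL S by (auto simp: transversal_def)
  qed
  then have inj: "inj_on ?c S" and "W\<^sup>- (F \<cdot>\<^sub>s F) = ser_sum index_minus (?c ` S)"
    using W_minus_transversal[OF wfFF] by auto
  note this(2)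
  also have "ser_sum index_minus (?c ` S) = ser_sum (\<lambda>K. avar 1 \<otimes> pleth 2 (index_plus K)) S"
    by (rule ser_sum_reindex[OF inj]) (use index_minus_composite_tau sub gF in \<open>auto simp: subset_iff\<close>)
  also have "\<dots> = avar 1 \<otimes> pleth 2 (W\<^sup>+ F)"
    using locally_finite_index(1)[OF wfF S] W_plus_transversal[OF wfF S]
    by (simp add: ser_sum_mult_left ser_sum_pleth locally_finite_pleth)
  finally show ?thesis .
qed

text \<open>In a symmetric triple composition the third part is, up to isomorphism, the reversal of
  the first, so two parameters suffice. The joints are 0 and 1.\<close>

definition composite3 :: "network \<Rightarrow> network \<Rightarrow> network" where
  "composite3 K L = series_comp 1 (series_comp 0 (relabel left_label K) (relabel middle_label L))
     (relabel right_label (tau K))"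

lemma disjoint_parts_composite3:
  "disjoint_parts 0 (relabel left_label K) (relabel middle_label L)"
  "disjoint_parts 1 (series_comp 0 (relabel left_label K) (relabel middle_label L))
     (relabel right_label M)"
  by (auto simp: disjoint_parts_def label_neq label_neq[symmetric])

lemma index_minus_composite3:
  assumes "good_net K" "good_net L" "joints K = {}" "joints L = {}"
  shows "index_minus (composite3 K L) = avar 2 \<otimes> pleth 2 (index_plus K) \<otimes> index_minus L"
proof -
  have "index_minus (composite3 K L) = avar 2 \<otimes> pleth 2 (index_plus (relabel left_label K))
      \<otimes> index_minus (relabel middle_label L)"
    unfolding composite3_def
  proof (rule index_minus_mirror_triple[where \<psi> = flip])
    show "relabel right_label (tau K) = tau (relabel flip (relabel left_label K))"
      by (rule composite_tau_mirror)
    show "disjoint_parts 0 (relabel left_label K) (relabel middle_label L)"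
      "disjoint_parts 1 (series_comp 0 (relabel left_label K) (relabel middle_label L))
        (relabel right_label (tau K))"
      by (rule disjoint_parts_composite3)+
  qed (use assms good_net_relabel_inj inj_labels in auto)
  then show ?thesis
    using index_relabel(1)[OF assms(1) inj_labels(1)] index_relabel(2)[OF assms(2) inj_labels(3)]
    by simp
qed

lemma composite3_isomorphic:
  assumes "good_net A" "good_net B" "good_net C"
    and "disjoint_parts v A B" "disjoint_parts w (series_comp v A B) C"
    and "isomorphic A K" "isomorphic B L" "isomorphic C (tau K)"
  shows "isomorphic (series_comp w (series_comp v A B) C) (composite3 K L)"
  unfolding composite3_def
proof (intro isomorphic_series_comp)
  show "isomorphic A (relabel left_label K)" "isomorphic B (relabel middle_label L)"
    "isomorphic C (relabel right_label (tau K))"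
    using assms isomorphic_relabel inj_labels isomorphic_trans by blast+
  show "wf_net (series_comp v A B)"
    using assms by (auto simp: good_net_def disjoint_parts_def intro: wf_net_series_comp)
qed (use assms disjoint_parts_composite3 in \<open>auto simp: good_net_def\<close>)

lemma isomorphic_composite3:
  assumes good: "good_net K" "good_net L" "good_net K'" "good_net L'"
    and joints: "joints K = {}" "joints L = {}" "joints K' = {}" "joints L' = {}"
    and iso: "isomorphic (composite3 K L) (composite3 K' L')"
  shows "isomorphic K K' \<and> isomorphic L L'"
proof -
  obtain f where f: "inj_on f (inner (composite3 K L))" "relabel f (composite3 K L) = composite3 K' L'"
    using iso by (auto simp: isomorphic_def)
  have "relabel f (composite3 K L) = composite3 K' L' \<longleftrightarrow> f 0 = 0 \<and> f 1 = 1 \<and>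
      relabel f (relabel left_label K) = relabel left_label K' \<and>
      relabel f (relabel middle_label L) = relabel middle_label L' \<and>
      relabel f (relabel right_label (tau K)) = relabel right_label (tau K')"
    unfolding composite3_def
    by (rule relabel_series_comp3_eq_iff)
      (use f(1) good joints disjoint_parts_composite3 good_net_relabel_inj inj_labels
        in \<open>auto simp: composite3_def simp del: inj_on_insert\<close>)
  then have "relabel f (relabel left_label K) = relabel left_label K'"
    "relabel f (relabel middle_label L) = relabel middle_label L'"
    using f(2) by auto
  moreover have "inj_on f (inner (relabel left_label K))" "inj_on f (inner (relabel middle_label L))"
    by (rule inj_on_subset[OF f(1)]; auto simp: composite3_def)+
  ultimately have "isomorphic (relabel left_label K) (relabel left_label K')"
    "isomorphic (relabel middle_label L) (relabel middle_label L')"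
    unfolding isomorphic_def by metis+
  then show ?thesis
    using isomorphic_relabel_cancel good inj_labels by blast
qed

text \<open>A symmetry must carry the middle part to its own reversal. The parameters are therefore
  a representative of \<open>F\<close> and one of the symmetric members of \<open>G\<close>, and the
  second factor is \<open>W\<^sup>- G\<close>.\<close>

lemma W_minus_series_sandwich:
  assumes F: "network_species F" and G: "network_species G" and tauF: "tau_closed F"
  shows "W\<^sup>- (F \<cdot>\<^sub>s G \<cdot>\<^sub>s F) = avar 2 \<otimes> pleth 2 (W\<^sup>+ F) \<otimes> W\<^sup>- G"
proof -
  note gF = species_good[OF F] and gG = species_good[OF G]
  let ?G = "{N \<in> G. tau_symmetric N}"
  have goodFG: "\<And>N. N \<in> F \<cdot>\<^sub>s G \<Longrightarrow> good_net N"
    using gF gG series_species_wf[of F G] by blast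
  have wfF: "\<forall>N\<in>F. wf_net N" and wfG: "\<forall>N\<in>G. wf_net N" and wfG': "\<forall>N\<in>?G. wf_net N"
    and wfFGF: "\<forall>N\<in>F \<cdot>\<^sub>s G \<cdot>\<^sub>s F. wf_net N"
    using gF gG goodFG series_species_wf[of "F \<cdot>\<^sub>s G" F] by (auto simp: good_net_def)
  obtain S where S: "transversal F S" using transversal_exists[OF wfF] .
  obtain T where T: "transversal ?G T" using transversal_exists[OF wfG'] .
  have sub: "S \<subseteq> F" "T \<subseteq> G" using S T by (auto simp: transversal_def)
  let ?c = "\<lambda>(K, L). composite3 K L"
  have "transversal {N \<in> F \<cdot>\<^sub>s G \<cdot>\<^sub>s F. tau_symmetric N} (?c ` (S \<times> T)) \<and> inj_on ?c (S \<times> T)"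
  proof (rule transversal_image)
    fix p assume "p \<in> S \<times> T"
    then obtain K L where p: "p = (K, L)" "K \<in> S" "L \<in> T" by blast
    then have K: "K \<in> F" "tau K \<in> F" and L: "L \<in> G" "tau_symmetric L"
      using S T tauF by (auto simp: tau_closed_def transversal_def)
    let ?A = "relabel left_label K" and ?B = "relabel middle_label L"
      and ?C = "relabel right_label (tau K)"
    have mem: "?A \<in> F" "?B \<in> G" "?C \<in> F"
      using K L species_isomorphic[OF F] species_isomorphic[OF G] isomorphic_relabel inj_labels
      by blast+
    have "series_comp 0 ?A ?B \<in> F \<cdot>\<^sub>s G"
      using mem disjoint_parts_composite3(1)[of K L]
      unfolding series_species_def disjoint_parts_def by blast
    then have "composite3 K L \<in> F \<cdot>\<^sub>s G \<cdot>\<^sub>s F"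
      using mem disjoint_parts_composite3(2)[of K L "tau K"]
      unfolding composite3_def series_species_def[of "F \<cdot>\<^sub>s G" F] disjoint_parts_def by blast
    moreover have "tau_symmetric (composite3 K L)"
    proof -
      have "tau (composite3 K L)
          = series_comp 0 (series_comp 1 (relabel right_label K) (relabel middle_label (tau L)))
              (relabel left_label (tau K))"
        by (simp add: composite3_def tau_series_comp tau_relabel series_comp_assoc)
      moreover have "isomorphic \<dots> (composite3 K L)"
      proof (rule composite3_isomorphic)
        show "disjoint_parts 1 (relabel right_label K) (relabel middle_label (tau L))"
          "disjoint_parts 0 (series_comp 1 (relabel right_label K) (relabel middle_label (tau L)))
            (relabel left_label (tau K))"
          by (auto simp: disjoint_parts_def label_neq label_neq[symmetric])
        have iso: "isomorphic (relabel g N) N" if "wf_net N" "inj g" for g N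
          using that isomorphic_relabel isomorphic_sym by blast
        show "isomorphic (relabel right_label K) K" "isomorphic (relabel left_label (tau K)) (tau K)"
          using iso wfF K inj_labels by blast+
        have "isomorphic (relabel middle_label (tau L)) (tau L)"
          using iso wfG L inj_labels by simp
        \<comment> \<open>Reversal leaves \<open>tau L\<close> in the middle; the symmetry of
          \<open>L\<close> turns it back into \<open>L\<close>.\<close>
        then show "isomorphic (relabel middle_label (tau L)) L"
          using L(2) isomorphic_trans unfolding tau_symmetric_def by blast
      qed (use gF gG K L good_net_relabel_inj inj_labels in auto)
      ultimately show ?thesis by (simp add: tau_symmetric_def)
    qed
    ultimately show "?c p \<in> {N \<in> F \<cdot>\<^sub>s G \<cdot>\<^sub>s F. tau_symmetric N}" by (simp add: p)
  next
    fix N assume "N \<in> {N \<in> F \<cdot>\<^sub>s G \<cdot>\<^sub>s F. tau_symmetric N}"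
    then obtain w v A B C where N: "N = series_comp w (series_comp v A B) C" "A \<in> F" "B \<in> G" "C \<in> F"
      "disjoint_parts v A B" "disjoint_parts w (series_comp v A B) C"
      and sym: "tau_symmetric N" by (auto elim!: series_speciesE)
    obtain f where f: "inj_on f (inner (tau N))" "N = relabel f (tau N)"
      using sym by (auto simp: tau_symmetric_def isomorphic_def)
    have tauN: "tau N = series_comp v (series_comp w (tau C) (tau B)) (tau A)"
      by (simp add: N(1) tau_series_comp series_comp_assoc)
    have "relabel f (series_comp v (series_comp w (tau C) (tau B)) (tau A))
        = series_comp w (series_comp v A B) C
        \<longleftrightarrow> f w = v \<and> f v = w \<and> relabel f (tau C) = A \<and> relabel f (tau B) = B \<and> relabel f (tau A) = C"
    proof (rule relabel_series_comp3_eq_iff)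
      show "disjoint_parts w (tau C) (tau B)" "disjoint_parts v (series_comp w (tau C) (tau B)) (tau A)"
        using N(5,6) by (auto simp: disjoint_parts_def)
      show "inj_on f (insert v (insert w (inner (tau C) \<union> inner (tau B)) \<union> inner (tau A)))"
        using f(1) unfolding tauN inner_simps .
    qed (use N gF gG in auto)
    moreover have "relabel f (series_comp v (series_comp w (tau C) (tau B)) (tau A))
        = series_comp w (series_comp v A B) C"
      unfolding tauN[symmetric] N(1)[symmetric] by (rule f(2)[symmetric])
    ultimately have rel: "relabel f (tau B) = B" "relabel f (tau A) = C"
      by simp_all
    have "inj_on f (inner (tau A))" "inj_on f (inner (tau B))"
      by (rule inj_on_subset[OF f(1)]; auto simp: N)+
    then have symB: "tau_symmetric B" and "isomorphic (tau A) C"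
      using rel unfolding tau_symmetric_def isomorphic_def by metis+
    then have CA: "isomorphic C (tau A)" using wfF N isomorphic_sym by (metis wf_net_tau)
    obtain K where K: "K \<in> S" "isomorphic A K" using S N unfolding transversal_def by blast
    obtain L where L: "L \<in> T" "isomorphic B L" using T N symB unfolding transversal_def by blast
    have "isomorphic C (tau K)" using CA isomorphic_tau[OF K(2)] isomorphic_trans by blast
    then have "isomorphic N (composite3 K L)"
      unfolding N(1) using composite3_isomorphic N gF gG K L by blast
    then show "\<exists>p\<in>S \<times> T. isomorphic N (?c p)" using K L by auto
  next
    fix p q assume pq: "p \<in> S \<times> T" "q \<in> S \<times> T" "isomorphic (?c p) (?c q)"
    obtain K L K' L' where p: "p = (K, L)" "q = (K', L')" by (cases p; cases q)
    have "isomorphic K K' \<and> isomorphic L L'"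
      by (rule isomorphic_composite3) (use pq p sub gF gG in \<open>auto simp: subset_iff\<close>)
    then show "p = q" using p pq S T by (auto simp: transversal_def)
  qed
  then have inj: "inj_on ?c (S \<times> T)" and "W\<^sup>- (F \<cdot>\<^sub>s G \<cdot>\<^sub>s F) = ser_sum index_minus (?c ` (S \<times> T))"
    using W_minus_transversal[OF wfFGF] by auto
  note this(2)
  also have "ser_sum index_minus (?c ` (S \<times> T))
      = ser_sum (\<lambda>(K, L). avar 2 \<otimes> pleth 2 (index_plus K) \<otimes> index_minus L) (S \<times> T)"
    by (rule ser_sum_reindex[OF inj])
      (use index_minus_composite3 sub gF gG in \<open>auto simp: subset_iff\<close>)
  also have "\<dots> = ser_sum (\<lambda>K. avar 2 \<otimes> pleth 2 (index_plus K)) S \<otimes> ser_sum index_minus T"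
    using locally_finite_index(1)[OF wfF S] locally_finite_index(2)[OF wfG' T]
    by (intro ser_sum_mult locally_finite_mult locally_finite_pleth)
  also have "\<dots> = avar 2 \<otimes> pleth 2 (W\<^sup>+ F) \<otimes> W\<^sup>- G"
    using locally_finite_index(1)[OF wfF S] W_plus_transversal[OF wfF S] W_minus_transversal[OF wfG T]
    by (simp add: ser_sum_mult_left ser_sum_pleth locally_finite_pleth)
  finally show ?thesis .
qed

theorem theorem6:
  fixes M N :: "network set"
  assumes "network_species M" and "\<forall>K\<in>M. \<not> trivial_network K"
    and "network_species N" and "\<forall>K\<in>N. \<not> trivial_network K"
  shows "W\<^sup>+ (M \<cdot>\<^sub>s N) = avar 1 \<otimes> W\<^sup>+ M \<otimes> W\<^sup>+ N \<and>
    (tau_closed M \<longrightarrow> W\<^sup>- (M \<cdot>\<^sub>s M) = avar 1 \<otimes> pleth 2 (W\<^sup>+ M)) \<and>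
    (tau_closed M \<longrightarrow> W\<^sup>- (M \<cdot>\<^sub>s N \<cdot>\<^sub>s M) = avar 2 \<otimes> pleth 2 (W\<^sup>+ M) \<otimes> W\<^sup>- N)"
  using W_plus_series[OF assms(1,3)] W_minus_series_self[OF assms(1)]
    W_minus_series_sandwich[OF assms(1,3)] by simp

end
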